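(* For every integer $d > 0$, letting $C = \{-d, -d+1, \dots, d-1, d\}$, there exists a constant $\delta > 0$ (depending only on $d$) and a randomized algorithm that solves Subset Balancing on coefficient set $C$ with high probability in time $O^*\left(|C|^{(1/2 - \delta)n}\right)$.
   Context: Subset Balancing on a fixed finite coefficient set $C \subseteq \mathbb{Z}$: given $\vec{x} \in \mathbb{Z}^n$, find a nonzero vector $\vec{c} \in C^n \setminus \{\vec{0}\}$ with $\vec{c}\cdot\vec{x} = 0$ (a "solution vector"), or report that none exists. Input integers are assumed to have absolute value at most $2^{n^{O(1)}}$, and arithmetic operations on input integers take unit time. $O^*$ suppresses factors polynomial in $n$. An algorithm solves the problem "with high probability" if it never outputs an invalid solution (no false positives) and, whenever a solution exists, outputs one with probability at least $1 - 2^{-\Omega(n)}$. *)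

theory Defs
  imports "HOL-Probability.Probability" "HOL-Library.Landau_Symbols"
begin

section \<open>Subset Balancing\<close>

definition is_solution :: "int set \<Rightarrow> int list \<Rightarrow> int list \<Rightarrow> bool" where
  "is_solution C x c \<longleftrightarrow>
     length c = length x \<and> set c \<subseteq> C \<and> (\<exists>i<length c. c ! i \<noteq> 0) \<and>
     (\<Sum>i<length x. c ! i * x ! i) = 0"

section \<open>A randomized random access machine\<close>

text \<open>
  Algorithms are programs of a While language over integer variables and finitely many
  unbounded random access arrays, i.e. a structured form of the word RAM. A program is a finite
  object that does not depend on the input, so the model is uniform.

  Arithmetic takes unit time, but every integer that is computed has to fit into a word of \<open>w\<close>
  bits plus sign; otherwise the run aborts. Below, \<open>w\<close> is polynomial in the input length. The
  restriction is essential: with unit-cost multiplication of unbounded integers, exponentially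
  large data could be packed into single numbers.
\<close>

datatype binop = Add | Sub | Mul | Div | Mod | Less | Eq

datatype exp = Const int | Var nat | Elem nat exp | Bin binop exp exp

datatype com =
    Skip
  | Assign nat exp
  | Store nat exp exp
  | Rand nat exp
  | Seq com com
  | Cond exp com com
  | While exp com

record state =
  vars :: "nat \<Rightarrow> int"
  arrs :: "nat \<Rightarrow> int \<Rightarrow> int"

fun binop_val :: "binop \<Rightarrow> int \<Rightarrow> int \<Rightarrow> int" where
  "binop_val Add i j = i + j"
| "binop_val Sub i j = i - j"
| "binop_val Mul i j = i * j"
| "binop_val Div i j = i div j"
| "binop_val Mod i j = i mod j"
| "binop_val Less i j = of_bool (i < j)"
| "binop_val Eq i j = of_bool (i = j)"

definition word :: "nat \<Rightarrow> int \<Rightarrow> int option" where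
  "word w i = (if \<bar>i\<bar> < 2 ^ w then Some i else None)"

fun eval_exp :: "nat \<Rightarrow> state \<Rightarrow> exp \<Rightarrow> int option" where
  "eval_exp w s (Const i) = word w i"
| "eval_exp w s (Var v) = word w (vars s v)"
| "eval_exp w s (Elem a e) = Option.bind (eval_exp w s e) (\<lambda>i. word w (arrs s a i))"
| "eval_exp w s (Bin f e1 e2) =
     Option.bind (eval_exp w s e1) (\<lambda>i.
     Option.bind (eval_exp w s e2) (\<lambda>j. word w (binop_val f i j)))"

text \<open>
  One step of a program. An expression is part of the fixed program and hence has constant size,
  so that evaluating it counts as part of a single step. In the type \<open>spmf\<close> of
  subprobability distributions (probability mass functions on an option type), the lost mass
  (\<open>None\<close>) stands for aborted runs. The command \<open>Rand v e\<close> draws \<open>v\<close> uniformly from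
  \<open>{0..<m}\<close>, where \<open>m\<close> is the value of \<open>e\<close>, and aborts if \<open>m \<le> 0\<close>. In conditions, every
  nonzero value counts as true.
\<close>

primrec step :: "nat \<Rightarrow> com \<Rightarrow> state \<Rightarrow> (com \<times> state) spmf" where
  "step w Skip s = return_spmf (Skip, s)"
| "step w (Assign v e) s =
     map_spmf (\<lambda>i. (Skip, s\<lparr>vars := (vars s)(v := i)\<rparr>)) (return_pmf (eval_exp w s e))"
| "step w (Store a e1 e2) s =
     bind_spmf (return_pmf (eval_exp w s e1)) (\<lambda>i.
     map_spmf (\<lambda>j. (Skip, s\<lparr>arrs := (arrs s)(a := (arrs s a)(i := j))\<rparr>))
       (return_pmf (eval_exp w s e2)))"
| "step w (Rand v e) s =
     bind_spmf (return_pmf (eval_exp w s e)) (\<lambda>m.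
     map_spmf (\<lambda>i. (Skip, s\<lparr>vars := (vars s)(v := i)\<rparr>)) (spmf_of_set {0..<m}))"
| "step w (Seq c1 c2) s =
     (if c1 = Skip then return_spmf (c2, s)
      else map_spmf (\<lambda>(c, s'). (Seq c c2, s')) (step w c1 s))"
| "step w (Cond e c1 c2) s =
     map_spmf (\<lambda>i. (if i \<noteq> 0 then c1 else c2, s)) (return_pmf (eval_exp w s e))"
| "step w (While e c) s =
     map_spmf (\<lambda>i. (if i \<noteq> 0 then Seq c (While e c) else Skip, s))
       (return_pmf (eval_exp w s e))"

primrec steps :: "nat \<Rightarrow> nat \<Rightarrow> com \<times> state \<Rightarrow> (com \<times> state) spmf" where
  "steps w 0 cs = return_spmf cs"
| "steps w (Suc t) cs = bind_spmf (step w (fst cs) (snd cs)) (steps w t)"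

text \<open>
  Input convention: variable 0 holds the length \<open>n\<close> and array 0 the integers; all other cells are
  0. Output convention: if variable 1 is nonzero, the entries \<open>0, \<dots>, n - 1\<close> of array 1 are the
  output vector; otherwise the program reports that there is no solution.
\<close>

definition input_state :: "int list \<Rightarrow> state" where
  "input_state x =
     \<lparr>vars = (\<lambda>v. if v = 0 then int (length x) else 0),
      arrs = (\<lambda>a i. if a = 0 \<and> 0 \<le> i \<and> i < int (length x) then x ! nat i else 0)\<rparr>"

definition result_of :: "nat \<Rightarrow> state \<Rightarrow> int list option" where
  "result_of n s =
     (if vars s 1 \<noteq> 0 then Some (map (\<lambda>i. arrs s 1 (int i)) [0..<n]) else None)"

definition halts_within :: "nat \<Rightarrow> nat \<Rightarrow> com \<Rightarrow> int list \<Rightarrow> bool" where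
  "halts_within w t p x \<longleftrightarrow>
     lossless_spmf (steps w t (p, input_state x)) \<and>
     (\<forall>(c, s) \<in> set_spmf (steps w t (p, input_state x)). c = Skip)"

text \<open>Meaningful when the program halts within \<open>t\<close> steps, as halted configurations do not change.\<close>

definition run :: "nat \<Rightarrow> nat \<Rightarrow> com \<Rightarrow> int list \<Rightarrow> int list option spmf" where
  "run w t p x = map_spmf (\<lambda>(c, s). result_of (length x) s) (steps w t (p, input_state x))"

section \<open>Solving Subset Balancing with high probability\<close>

definition poly_bounded :: "(nat \<Rightarrow> nat) \<Rightarrow> bool" where
  "poly_bounded f \<longleftrightarrow> (\<exists>k::nat. (\<lambda>n. real (f n)) \<in> O(\<lambda>n. real n ^ k))"

definition O_star :: "(nat \<Rightarrow> real) \<Rightarrow> (nat \<Rightarrow> nat) set" where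
  "O_star g = {T. \<exists>k::nat. (\<lambda>n. real (T n)) \<in> O(\<lambda>n. real n ^ k * g n)}"

definition inputs :: "(nat \<Rightarrow> nat) \<Rightarrow> nat \<Rightarrow> int list set" where
  "inputs b n = {x. length x = n \<and> (\<forall>i<n. \<bar>x ! i\<bar> \<le> 2 ^ b n)}"

text \<open>
  The program \<open>p\<close> solves Subset Balancing on \<open>C\<close> with high probability, for inputs of at most
  \<open>b n\<close> bits, on words of \<open>w n\<close> bits, in (worst-case) time \<open>T n\<close>. The failure probability
  \<open>2\<close> to the \<open>-\<Omega>(n)\<close> is spelled out because \<open>\<Omega>\<close> of the library only concerns absolute values.
\<close>

definition solves_whp ::
  "int set \<Rightarrow> (nat \<Rightarrow> nat) \<Rightarrow> (nat \<Rightarrow> nat) \<Rightarrow> (nat \<Rightarrow> nat) \<Rightarrow> com \<Rightarrow> bool" where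
  "solves_whp C b w T p \<longleftrightarrow>
     (\<forall>n. \<forall>x \<in> inputs b n. halts_within (w n) (T n) p x) \<and>
     (\<forall>n. \<forall>x \<in> inputs b n. \<forall>c.
        Some c \<in> set_spmf (run (w n) (T n) p x) \<longrightarrow> is_solution C x c) \<and>
     (\<exists>\<epsilon>>0. \<forall>\<^sub>F n in sequentially. \<forall>x \<in> inputs b n. (\<exists>c. is_solution C x c) \<longrightarrow>
        measure (measure_spmf (run (w n) (T n) p x)) {Some c |c. is_solution C x c}
          \<ge> 1 - 2 powr (- \<epsilon> * real n))"

text \<open>
  Solving within time \<open>O\<^sup>*(g)\<close>, for inputs of absolute value at most 2 to the power of an
  arbitrary polynomial in \<open>n\<close>. The program is the same for all such polynomials; the word length and
  the suppressed polynomial factors may depend on them.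
\<close>

definition solves_in_O_star :: "int set \<Rightarrow> com \<Rightarrow> (nat \<Rightarrow> real) \<Rightarrow> bool" where
  "solves_in_O_star C p g \<longleftrightarrow>
     (\<forall>b. poly_bounded b \<longrightarrow>
        (\<exists>w T. poly_bounded w \<and> T \<in> O_star g \<and> solves_whp C b w T p))"

end

theory Submission imports Defs begin

text \<open>
  Let \<open>c\<close> be a solution of minimal \<open>l\<^sub>1\<close>-norm. If the norm deviates by a linear amount from its average
  over \<open>C\<^sup>n\<close>, then \<open>c\<close> is one of exponentially fewer than \<open>|C|\<^sup>n\<close> candidates, and meeting in the middle
  over a suitable cyclic rotation, whose two halves have proportional norm, is fast enough.

  Otherwise write \<open>c = y - y'\<close> with \<open>y, y' \<in> {0..d}\<^sup>n\<close>. There are \<open>\<Prod>\<^sub>i (d + 1 - |c\<^sub>i|)\<close> such pairs, and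
  their sums \<open>y \<bullet> x\<close> are distinct: if \<open>y\<^sub>1\<close> and \<open>y\<^sub>2\<close> have the same sum, then \<open>y\<^sub>1 - y\<^sub>2\<close> is a solution with
  \<open>|y\<^sub>1 - y\<^sub>2| \<le> d - |c|\<close> in every coordinate, hence of smaller norm, as the norm of \<open>c\<close> exceeds
  \<open>d n / 2\<close>. A random bucket of a hash function of the form \<open>y \<mapsto> a (y \<bullet> x) + r mod Q\<close> therefore contains
  both vectors of some pair with high probability, while only few of the \<open>(d + 1)\<^sup>n\<close> vectors fall into
  it. Since the hash is linear, a bucket can be listed from two halves, and a table
  indexed by sums then finds the two vectors.
\<close>

section \<open>Total correctness with running times\<close>

text \<open>Why hashing suffices near the average norm: this average over C^n is n d (d + 1) / (2 d
  + 1), and a vector of that norm has at least (d + 1)^(n d / (2 d + 1)) pairs. With about as many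
  buckets, one bucket holds about (d + 1)^(n (d + 1) / (2 d + 1)) of the (d + 1)^n box vectors,
  exponentially fewer than (2 d + 1)^(n / 2) since (d + 1)^(2 d + 2) < (2 d + 1)^(2 d + 1). This
  inequality is strict, so hashing can also cover a linear range of norms around the average, and
  the other case keeps a linear deviation.

  Minimality enters because a bucket is likely to catch some pair only if the pairs have many
  different sums.

  The program knows neither norm nor rotation: it tries n rotations for each direction of deviation
  and then one bucket. A limit on the candidates of a run turns the running time into a worst-case
  bound; exceeding it in the last run becomes part of the failure probability. Arrays can be indexed
  by any word, so sums serve directly as addresses.\<close>

definition ds :: "nat \<Rightarrow> com \<times> state \<Rightarrow> com \<times> state \<Rightarrow> bool" where
  "ds w cs cs' \<longleftrightarrow> fst cs \<noteq> Skip \<and> step w (fst cs) (snd cs) = return_spmf cs'"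

text \<open>Only the two \<open>Rand\<close> commands branch, so all other segments of a run are
  described by the relation \<open>ds\<close> and its powers. \<open>ds\<close> excludes
  \<open>Skip\<close>, on which \<open>step\<close> stutters, so the power counts the steps up to
  termination.\<close>

lemma steps_ds: "(ds w ^^ t) cs cs' \<Longrightarrow> steps w (t + k) cs = steps w k cs'"
proof (induction t arbitrary: cs)
  case (Suc t)
  then obtain cs1 where "ds w cs cs1" "(ds w ^^ t) cs1 cs'" by (metis relpowp_Suc_D2)
  then have "steps w (t + k) cs1 = steps w k cs'" by (simp only: Suc.IH)
  with \<open>ds w cs cs1\<close> show ?case by (simp add: ds_def)
qed simp

lemma steps_Skip: "steps w k (Skip, s) = return_spmf (Skip, s)"
  by (induction k) auto

lemma ds_Seq: "ds w (c, s) (c', s') \<Longrightarrow> ds w (Seq c c2, s) (Seq c' c2, s')"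
  by (simp add: ds_def)

lemma ds_pow_Seq: "(ds w ^^ t) (c, s) (c', s') \<Longrightarrow> (ds w ^^ t) (Seq c c2, s) (Seq c' c2, s')"
proof (induction t arbitrary: c s)
  case (Suc t)
  then obtain c1 s1 where "ds w (c, s) (c1, s1)" "(ds w ^^ t) (c1, s1) (c', s')"
    by (metis relpowp_Suc_D2 surj_pair)
  then show ?case using Suc.IH ds_Seq by (meson relpowp_Suc_I2)
qed simp

section \<open>Size of intermediate results\<close>

definition bounded_state :: "int \<Rightarrow> state \<Rightarrow> bool" where
  "bounded_state H s \<longleftrightarrow> (\<forall>v. \<bar>vars s v\<bar> \<le> H) \<and> (\<forall>a i. \<bar>arrs s a i\<bar> \<le> H)"

primrec evl :: "state \<Rightarrow> exp \<Rightarrow> int" where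
  "evl s (Const i) = i"
| "evl s (Var v) = vars s v"
| "evl s (Elem a e) = arrs s a (evl s e)"
| "evl s (Bin f e1 e2) = binop_val f (evl s e1) (evl s e2)"

text \<open>The exponent of \<open>H\<close> in a bound on the value: on a state bounded by
  \<open>H\<close>, an expression of size m has absolute value at most \<open>H ^ m\<close>.\<close>

primrec esize :: "exp \<Rightarrow> nat" where
  "esize (Const i) = 1"
| "esize (Var v) = 1"
| "esize (Elem a e) = Suc (esize e)"
| "esize (Bin f e1 e2) = esize e1 + esize e2"

primrec consts_le :: "int \<Rightarrow> exp \<Rightarrow> bool" where
  "consts_le H (Const i) \<longleftrightarrow> \<bar>i\<bar> \<le> H"
| "consts_le H (Var v) \<longleftrightarrow> True"
| "consts_le H (Elem a e) \<longleftrightarrow> consts_le H e"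
| "consts_le H (Bin f e1 e2) \<longleftrightarrow> consts_le H e1 \<and> consts_le H e2"

lemma esize_pos: "0 < esize e" by (induction e) auto

lemma abs_div_le: "\<bar>i div j\<bar> \<le> \<bar>i :: int\<bar>"
proof (cases "j = 0")
  case False
  have *: "\<bar>i div j\<bar> \<le> \<bar>i\<bar>" if "j > 0" for i j :: int
  proof -
    have m: "i mod j \<ge> 0" "i mod j < j" using that by auto
    have e: "i = j * (i div j) + i mod j" by simp
    show ?thesis
    proof (cases "i \<ge> 0")
      case True
      then show ?thesis using that zdiv_mono2[of i 1 j] by (simp add: pos_imp_zdiv_nonneg_iff)
    next
      case False
      have "i div j \<ge> i"
      proof (rule ccontr)
        assume "\<not> ?thesis"
        then have "i div j \<le> i - 1" by simp
        then have "j * (i div j) \<le> j * (i - 1)" using that by simp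
        then have "i < j * (i - 1) + j" using e m by linarith
        then have "i < j * i" by (simp add: algebra_simps)
        moreover have "j * i \<le> 1 * i" using that False by (intro mult_right_mono_neg) auto
        ultimately show False by simp
      qed
      moreover have "i div j \<le> 0" using False that
        by (metis div_neg_pos_less0 linorder_not_le nless_le order_le_less)
      ultimately show ?thesis by simp
    qed
  qed
  show ?thesis using *[of j i] *[of "-j" "-i"] False
    by (cases "j > 0") (auto)
qed simp

lemma abs_mod_le: "\<bar>i mod j\<bar> \<le> max \<bar>i\<bar> \<bar>j :: int\<bar>"
proof (cases "j = 0")
  case False
  then have "\<bar>i mod j\<bar> < \<bar>j\<bar>" by (rule abs_mod_less)
  then show ?thesis by simp
qed simp

text \<open>Both bounds a and b are at least 2, so (a - 1) (b - 1) \<ge> 1, that is a + b \<le> a b.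
  Sums therefore obey the same bound as products, and adding exponents is right for every
  operation.\<close>

lemma abs_binop_le:
  assumes "\<bar>i\<bar> \<le> H ^ m" "\<bar>j\<bar> \<le> H ^ k" "2 \<le> H" "0 < m" "0 < k"
  shows "\<bar>binop_val f i j\<bar> \<le> (H :: int) ^ (m + k)"
proof -
  let ?a = "H ^ m" and ?b = "H ^ k"
  have H1: "2 \<le> ?a" "2 \<le> ?b"
    using assms self_le_power[of H m] self_le_power[of H k] by auto
  have "0 \<le> (?a - 1) * (?b - 1) - 1"
    using mult_mono[of 1 "?a - 1" 1 "?b - 1"] H1 by simp
  then have sum: "?a + ?b \<le> ?a * ?b" by (simp add: algebra_simps)
  have prod: "\<bar>i * j\<bar> \<le> ?a * ?b" unfolding abs_mult using assms by (intro mult_mono) auto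
  show ?thesis
  proof (cases f)
    case Div
    then show ?thesis using abs_div_le[of i j] assms(1) sum H1 by (simp add: power_add)
  next
    case Mod
    then show ?thesis using abs_mod_le[of i j] assms(1,2) sum H1 by (simp add: power_add)
  qed (use sum prod assms H1 in \<open>auto simp: power_add abs_le_iff\<close>)
qed

lemma abs_ev_le:
  assumes "bounded_state H s" "2 \<le> H" "consts_le H e"
  shows "\<bar>evl s e\<bar> \<le> H ^ esize e"
  using assms(3)
proof (induction e)
  case (Elem a e)
  have "\<bar>arrs s a (evl s e)\<bar> \<le> H" using assms by (auto simp: bounded_state_def)
  also have "\<dots> \<le> H ^ Suc (esize e)" using self_le_power[of H "Suc (esize e)"] assms by auto
  finally show ?case by simp
next
  case (Bin f e1 e2)
  then show ?case using assms by (auto intro!: abs_binop_le esize_pos)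
qed (use assms in \<open>auto simp: bounded_state_def\<close>)

lemma eval_exp_ev:
  assumes "bounded_state H s" "2 \<le> H" "consts_le H e" "esize e \<le> M" "H ^ M < 2 ^ w"
  shows "eval_exp w s e = Some (evl s e)"
  using assms(3,4)
proof (induction e)
  case (Const i)
  then have "\<bar>i\<bar> < 2 ^ w"
    using assms self_le_power[of H M] by (cases "M = 0") auto
  then show ?case by (simp add: word_def)
next
  case (Var v)
  then have "\<bar>vars s v\<bar> < 2 ^ w"
    using assms self_le_power[of H M]
    by (cases "M = 0") (auto simp: bounded_state_def dest!: spec[where x = v])
  then show ?case by (simp add: word_def)
next
  case (Elem a e)
  then have "H \<le> H ^ M" using assms self_le_power[of H M] by (cases "M = 0") auto
  then have "\<bar>arrs s a (evl s e)\<bar> < 2 ^ w"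
    using assms by (auto simp: bounded_state_def dest!: spec[where x = a] spec[where x = "evl s e"])
  then show ?case using Elem by (simp add: word_def)
next
  case (Bin f e1 e2)
  have "\<bar>evl s (Bin f e1 e2)\<bar> \<le> H ^ esize (Bin f e1 e2)"
    using abs_ev_le assms Bin.prems by blast
  also have "\<dots> \<le> H ^ M" using assms Bin.prems by (intro power_increasing) auto
  finally have "\<bar>binop_val f (evl s e1) (evl s e2)\<bar> < 2 ^ w" using assms by simp
  then show ?case using Bin by (simp add: word_def)
qed

definition set_var :: "nat \<Rightarrow> int \<Rightarrow> state \<Rightarrow> state" where
  "set_var v i s = s\<lparr>vars := (vars s)(v := i)\<rparr>"

definition set_arr :: "nat \<Rightarrow> int \<Rightarrow> int \<Rightarrow> state \<Rightarrow> state" where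
  "set_arr a i j s = s\<lparr>arrs := (arrs s)(a := (arrs s a)(i := j))\<rparr>"

lemma set_var_simps [simp]:
  "vars (set_var v i s) u = (if u = v then i else vars s u)"
  "arrs (set_var v i s) = arrs s"
  by (auto simp: set_var_def)

lemma set_arr_simps [simp]:
  "vars (set_arr a i j s) = vars s"
  "arrs (set_arr a i j s) a' i' = (if a' = a \<and> i' = i then j else arrs s a' i')"
  by (auto simp: set_arr_def)

lemma bounded_state_upd:
  "bounded_state H s \<Longrightarrow> \<bar>i\<bar> \<le> H \<Longrightarrow> bounded_state H (set_var v i s)"
  "bounded_state H s \<Longrightarrow> \<bar>j\<bar> \<le> H \<Longrightarrow> bounded_state H (set_arr a i j s)"
  by (auto simp: bounded_state_def)

text \<open>
  Total correctness: from a state bounded by \<open>H\<close> at time \<open>t\<close>, the run is deterministic, never leaves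
  the states bounded by \<open>H\<close>, and ends at some time \<open>t'\<close> in a state \<open>s'\<close> with \<open>Q t' s'\<close>. Words have
  to hold the intermediate results of expressions of size at most \<open>16\<close>.
\<close>

definition wp ::
  "nat \<Rightarrow> int \<Rightarrow> com \<Rightarrow> (nat \<Rightarrow> state \<Rightarrow> bool) \<Rightarrow> nat \<Rightarrow> state \<Rightarrow> bool" where
  "wp w H c Q t s \<longleftrightarrow> (bounded_state H s \<longrightarrow>
     (\<exists>k s'. (ds w ^^ k) (c, s) (Skip, s') \<and> bounded_state H s' \<and> Q (t + k) s'))"

definition exp_ok :: "int \<Rightarrow> exp \<Rightarrow> bool" where
  "exp_ok H e \<longleftrightarrow> consts_le H e \<and> esize e \<le> 16"

locale word_size =
  fixes w :: nat and H :: int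
  assumes H2: "2 \<le> H" and Hw: "H ^ 16 < 2 ^ w"
begin

lemmas [simp] = H2 exp_ok_def

lemma H_pos [simp]: "0 \<le> H" "1 \<le> H" using H2 by linarith+

lemma eval_ok: "bounded_state H s \<Longrightarrow> exp_ok H e \<Longrightarrow> eval_exp w s e = Some (evl s e)"
  using eval_exp_ev H2 Hw by (auto simp: exp_ok_def)

lemma wp_mono: "wp w H c Q t s \<Longrightarrow> (\<And>t s. Q t s \<Longrightarrow> Q' t s) \<Longrightarrow> wp w H c Q' t s"
  unfolding wp_def by blast

text \<open>Makes the bound on the state available inside a derivation. It is used for values such
  as list pointers, which are merely copied and whose size no invariant records.\<close>

lemma wp_bounded: "(bounded_state H s \<Longrightarrow> wp w H c Q t s) \<Longrightarrow> wp w H c Q t s"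
  by (auto simp: wp_def)

lemma wp_Skip: "Q t s \<Longrightarrow> wp w H Skip Q t s"
  unfolding wp_def by (metis Nat.add_0_right relpowp_0_I)

lemma wp_Assign:
  assumes "exp_ok H e" "\<bar>evl s e\<bar> \<le> H" "Q (Suc t) (set_var v (evl s e) s)"
  shows "wp w H (Assign v e) Q t s"
  unfolding wp_def
proof
  assume b: "bounded_state H s"
  have "ds w (Assign v e, s) (Skip, set_var v (evl s e) s)"
    using eval_ok[OF b assms(1)] by (simp add: ds_def set_var_def)
  then have "(ds w ^^ 1) (Assign v e, s) (Skip, set_var v (evl s e) s)" unfolding relpowp_1 .
  then show "\<exists>k s'. (ds w ^^ k) (Assign v e, s) (Skip, s') \<and> bounded_state H s' \<and> Q (t + k) s'"
    using assms b bounded_state_upd(1) by (metis Suc_eq_plus1)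
qed

lemma wp_Store:
  assumes "exp_ok H e1" "exp_ok H e2" "\<bar>evl s e2\<bar> \<le> H" "Q (Suc t) (set_arr a (evl s e1) (evl s e2) s)"
  shows "wp w H (Store a e1 e2) Q t s"
  unfolding wp_def
proof
  assume b: "bounded_state H s"
  have "ds w (Store a e1 e2, s) (Skip, set_arr a (evl s e1) (evl s e2) s)"
    using eval_ok[OF b assms(1)] eval_ok[OF b assms(2)] by (simp add: ds_def set_arr_def)
  then have "(ds w ^^ 1) (Store a e1 e2, s) (Skip, set_arr a (evl s e1) (evl s e2) s)" unfolding relpowp_1 .
  then show "\<exists>k s'. (ds w ^^ k) (Store a e1 e2, s) (Skip, s') \<and> bounded_state H s' \<and> Q (t + k) s'"
    using assms b bounded_state_upd(2) by (metis Suc_eq_plus1)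
qed

text \<open>The \<open>Suc\<close> pays for the step that discards the finished \<open>Skip\<close>
  in front of \<open>c2\<close>.\<close>

lemma wp_Seq:
  assumes "wp w H c1 (\<lambda>t s. wp w H c2 Q (Suc t) s) t s"
  shows "wp w H (Seq c1 c2) Q t s"
  unfolding wp_def
proof
  assume "bounded_state H s"
  then obtain k1 s1 where 1: "(ds w ^^ k1) (c1, s) (Skip, s1)" "bounded_state H s1"
    "wp w H c2 Q (Suc (t + k1)) s1" using assms by (auto simp: wp_def)
  then obtain k2 s2 where 2: "(ds w ^^ k2) (c2, s1) (Skip, s2)" "bounded_state H s2"
    "Q (Suc (t + k1) + k2) s2" by (auto simp: wp_def)
  have "ds w (Seq Skip c2, s1) (c2, s1)" by (simp add: ds_def)
  then have "(ds w ^^ Suc k2) (Seq Skip c2, s1) (Skip, s2)" using 2(1) by (meson relpowp_Suc_I2)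
  then have "(ds w ^^ (k1 + Suc k2)) (Seq c1 c2, s) (Skip, s2)"
    using ds_pow_Seq[OF 1(1)] by (metis relpowp_trans)
  then show "\<exists>k s'. (ds w ^^ k) (Seq c1 c2, s) (Skip, s') \<and> bounded_state H s' \<and> Q (t + k) s'"
    using 2 by (intro exI[of _ "k1 + Suc k2"] exI[of _ s2]) (simp del: relpowp.simps add: add.assoc)
qed

lemma wp_Cond:
  assumes "exp_ok H e" "evl s e \<noteq> 0 \<Longrightarrow> wp w H c1 Q (Suc t) s" "evl s e = 0 \<Longrightarrow> wp w H c2 Q (Suc t) s"
  shows "wp w H (Cond e c1 c2) Q t s"
  unfolding wp_def
proof
  assume b: "bounded_state H s"
  let ?c = "if evl s e \<noteq> 0 then c1 else c2"
  have *: "ds w (Cond e c1 c2, s) (?c, s)"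
    using eval_ok[OF b assms(1)] by (simp add: ds_def)
  have "wp w H ?c Q (Suc t) s" using assms(2,3) by simp
  then obtain k s' where "(ds w ^^ k) (?c, s) (Skip, s')" "bounded_state H s'" "Q (Suc t + k) s'"
    using b unfolding wp_def by blast
  then show "\<exists>k s'. (ds w ^^ k) (Cond e c1 c2, s) (Skip, s') \<and> bounded_state H s' \<and> Q (t + k) s'"
    using * by (intro exI[of _ "Suc k"] exI[of _ s']) (auto intro: relpowp_Suc_I2 simp del: relpowp.simps)
qed

text \<open>The measure \<open>m\<close> only yields termination. Time is tracked by the invariant
  itself, which sees the clock: one step for unrolling the loop before the body, and one for
  dropping the leading \<open>Skip\<close> after it.\<close>

lemma wp_While:
  fixes m :: "state \<Rightarrow> nat"
  assumes "exp_ok H e" "I t s"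
    and body: "\<And>t s. I t s \<Longrightarrow> evl s e \<noteq> 0 \<Longrightarrow>
          wp w H c (\<lambda>t' s'. I (Suc t') s' \<and> m s' < m s) (Suc t) s"
    and fin: "\<And>t s. I t s \<Longrightarrow> evl s e = 0 \<Longrightarrow> Q (Suc t) s"
  shows "wp w H (While e c) Q t s"
  using assms(2)
proof (induction "m s" arbitrary: t s rule: less_induct)
  case less
  show ?case unfolding wp_def
  proof
    assume b: "bounded_state H s"
    note evl = eval_ok[OF b assms(1)]
    show "\<exists>k s'. (ds w ^^ k) (While e c, s) (Skip, s') \<and> bounded_state H s' \<and> Q (t + k) s'"
    proof (cases "evl s e = 0")
      case True
      then have "ds w (While e c, s) (Skip, s)" using evl by (simp add: ds_def)
      then have "(ds w ^^ 1) (While e c, s) (Skip, s)" unfolding relpowp_1 .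
      then show ?thesis using fin[OF less.prems True] b by (metis Suc_eq_plus1)
    next
      case False
      then have 0: "ds w (While e c, s) (Seq c (While e c), s)" using evl by (simp add: ds_def)
      obtain k1 s1 where 1: "(ds w ^^ k1) (c, s) (Skip, s1)" "bounded_state H s1"
        "I (Suc (Suc t + k1)) s1" "m s1 < m s"
        using body[OF less.prems False] b by (auto simp: wp_def)
      obtain k2 s2 where 2: "(ds w ^^ k2) (While e c, s1) (Skip, s2)" "bounded_state H s2"
        "Q (Suc (Suc t + k1) + k2) s2"
        using less.hyps[OF 1(4,3)] 1(2) by (auto simp: wp_def)
      have "ds w (Seq Skip (While e c), s1) (While e c, s1)" by (simp add: ds_def)
      then have "(ds w ^^ Suc k2) (Seq Skip (While e c), s1) (Skip, s2)"
        using 2(1) by (meson relpowp_Suc_I2)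
      then have "(ds w ^^ (k1 + Suc k2)) (Seq c (While e c), s) (Skip, s2)"
        using ds_pow_Seq[OF 1(1)] by (metis relpowp_trans)
      then have "(ds w ^^ Suc (k1 + Suc k2)) (While e c, s) (Skip, s2)"
        using 0 by (meson relpowp_Suc_I2)
      then show ?thesis using 2 by (intro exI[of _ "Suc (k1 + Suc k2)"] exI[of _ s2])
          (simp del: relpowp.simps add: add.assoc)
    qed
  qed
qed

end

section \<open>Listing vectors of bounded weight\<close>

abbreviation add_exp :: "exp \<Rightarrow> exp \<Rightarrow> exp" (infixl "\<oplus>" 65) where "a \<oplus> b \<equiv> Bin Add a b"
abbreviation sub_exp :: "exp \<Rightarrow> exp \<Rightarrow> exp" (infixl "\<ominus>" 65) where "a \<ominus> b \<equiv> Bin Sub a b"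
abbreviation mul_exp :: "exp \<Rightarrow> exp \<Rightarrow> exp" (infixl "\<otimes>" 70) where "a \<otimes> b \<equiv> Bin Mul a b"
abbreviation seq_com :: "com \<Rightarrow> com \<Rightarrow> com" (infixr ";;" 60) where "c1;; c2 \<equiv> Seq c1 c2"

abbreviation (input) abs_exp :: "exp \<Rightarrow> exp" where
  "abs_exp e \<equiv> e \<otimes> (Const 1 \<ominus> Const 2 \<otimes> Bin Less e (Const 0))"

text \<open>
  Position \<open>k\<close> of the arrays \<open>aTOT\<close>, \<open>aCOD\<close>, \<open>aWT\<close> describes one listed vector \<open>y\<close>: its sum \<open>y \<bullet> x\<close>, its
  code \<open>\<Sum>\<^sub>p y\<^sub>p (2 d + 1)\<^sup>p\<close>, which is linear in \<open>y\<close>, and its weight. The array \<open>aHEAD\<close> points to linked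
  lists over \<open>aNEXT\<close>, with pointers shifted by one so that \<open>0\<close> is the null pointer, and \<open>aTAB\<close> is a table
  of codes indexed by sums. Each run uses its own residue class of indices of \<open>aHEAD\<close> and \<open>aTAB\<close>.
\<close>

abbreviation (input) "vN \<equiv> 0 :: nat"
abbreviation (input) "vFLAG \<equiv> 1 :: nat"
abbreviation (input) "vX \<equiv> 2 :: nat"
abbreviation (input) "vPW \<equiv> 3 :: nat"
abbreviation (input) "vDN \<equiv> 4 :: nat"
abbreviation (input) "vK3 \<equiv> 5 :: nat"
abbreviation (input) "vLIM \<equiv> 6 :: nat"
abbreviation (input) "vI \<equiv> 7 :: nat"
abbreviation (input) "vL3 \<equiv> 8 :: nat"
abbreviation (input) "vA3 \<equiv> 9 :: nat"
abbreviation (input) "vR3 \<equiv> 10 :: nat"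
abbreviation (input) "vRUN \<equiv> 11 :: nat"
abbreviation (input) "vTL \<equiv> 12 :: nat"
abbreviation (input) "vLO \<equiv> 13 :: nat"
abbreviation (input) "vTAU \<equiv> 14 :: nat"
abbreviation (input) "vW0 \<equiv> 15 :: nat"
abbreviation (input) "vW1 \<equiv> 16 :: nat"
abbreviation (input) "vA \<equiv> 17 :: nat"
abbreviation (input) "vR \<equiv> 18 :: nat"
abbreviation (input) "vL \<equiv> 19 :: nat"
abbreviation (input) "vK \<equiv> 20 :: nat"
abbreviation (input) "vPOS \<equiv> 21 :: nat"
abbreviation (input) "vLEN \<equiv> 22 :: nat"
abbreviation (input) "vHD \<equiv> 23 :: nat"
abbreviation (input) "vLEV \<equiv> 24 :: nat"
abbreviation (input) "vP \<equiv> 25 :: nat"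
abbreviation (input) "vEND \<equiv> 26 :: nat"
abbreviation (input) "vC \<equiv> 27 :: nat"
abbreviation (input) "vWT \<equiv> 28 :: nat"
abbreviation (input) "vCNT \<equiv> 29 :: nat"
abbreviation (input) "vS1 \<equiv> 30 :: nat"
abbreviation (input) "vT1 \<equiv> 31 :: nat"
abbreviation (input) "vQ \<equiv> 32 :: nat"
abbreviation (input) "vPTR \<equiv> 34 :: nat"
abbreviation (input) "vTOT \<equiv> 35 :: nat"
abbreviation (input) "vZ \<equiv> 36 :: nat"
abbreviation (input) "vY \<equiv> 37 :: nat"
abbreviation (input) "vOUT \<equiv> 38 :: nat"
abbreviation (input) "vB1 \<equiv> 39 :: nat"
abbreviation (input) "vNR \<equiv> 40 :: nat"

abbreviation (input) "aX \<equiv> 0 :: nat"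
abbreviation (input) "aOUT \<equiv> 1 :: nat"
abbreviation (input) "aPW \<equiv> 2 :: nat"
abbreviation (input) "aTOT \<equiv> 3 :: nat"
abbreviation (input) "aCOD \<equiv> 4 :: nat"
abbreviation (input) "aWT \<equiv> 5 :: nat"
abbreviation (input) "aNEXT \<equiv> 6 :: nat"
abbreviation (input) "aHEAD \<equiv> 7 :: nat"
abbreviation (input) "aTAB \<equiv> 8 :: nat"

text \<open>The weight of a coefficient c is \<open>vW0\<close> + \<open>vW1\<close> |c|. One piece
  of code thus serves the weights |c|, d - |c| and 0, with (\<open>vW0\<close>, \<open>vW1\<close>)
  equal to (0, 1), (d, -1) and (0, 0).\<close>

definition digit_loop :: "int \<Rightarrow> com" where
  "digit_loop d = While (Bin Less (Var vC) (Const (d + 1)))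
     (Assign vWT (Elem aWT (Var vHD) \<oplus> (Var vW0 \<oplus> Var vW1 \<otimes> abs_exp (Var vC)));;
      Cond (Bin Less (Var vTAU) (Var vWT)) Skip
        (Store aTOT (Var vTL) (Elem aTOT (Var vHD) \<oplus> Var vC \<otimes> Elem aX (Var vP));;
         Store aCOD (Var vTL) (Elem aCOD (Var vHD) \<oplus> Var vC \<otimes> Elem aPW (Var vP));;
         Store aWT (Var vTL) (Var vWT);;
         Assign vTL (Var vTL \<oplus> Const 1));;
      Assign vC (Var vC \<oplus> Const 1))"

definition item_loop :: "int \<Rightarrow> com" where
  "item_loop d = While (Bin Less (Var vHD) (Var vEND))
     (Assign vC (Var vLO);;
      digit_loop d;;
      Assign vHD (Var vHD \<oplus> Const 1))"

definition level_loop :: "int \<Rightarrow> com" where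
  "level_loop d = While (Bin Less (Var vLEV) (Var vLEN))
     (Assign vP (Bin Mod (Var vPOS \<oplus> Var vLEV) (Var vN));;
      Assign vEND (Var vTL);;
      item_loop d;;
      Assign vLEV (Var vLEV \<oplus> Const 1))"

definition build :: "int \<Rightarrow> com" where
  "build d =
     (Store aTOT (Var vTL) (Const 0);;
      Store aCOD (Var vTL) (Const 0);;
      Store aWT (Var vTL) (Const 0);;
      Assign vHD (Var vTL);;
      Assign vTL (Var vTL \<oplus> Const 1);;
      Assign vLEV (Const 0);;
      level_loop d)"

section \<open>Mathematical description of the lists, sums and codes\<close>

type_synonym vec = "nat \<Rightarrow> int"

definition tot :: "int list \<Rightarrow> vec \<Rightarrow> int" where
  "tot x y = (\<Sum>p<length x. y p * x ! p)"

definition cod :: "int \<Rightarrow> nat \<Rightarrow> vec \<Rightarrow> int" where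
  "cod d n y = (\<Sum>p<n. y p * (2 * d + 1) ^ p)"

definition small :: "int \<Rightarrow> vec \<Rightarrow> bool" where
  "small d y \<longleftrightarrow> (\<forall>p. \<bar>y p\<bar> \<le> d)"

text \<open>Pruning partial vectors loses nothing: weights of coefficients are nonnegative, so every
  prefix of a vector within the bound is within the bound. It keeps the intermediate levels as small
  as the final one is guaranteed to be.\<close>

definition ext :: "(int \<Rightarrow> int) \<Rightarrow> int \<Rightarrow> nat \<Rightarrow> int list \<Rightarrow> vec \<times> int \<Rightarrow> (vec \<times> int) list" where
  "ext f \<tau> p cs = (\<lambda>(y, m). map (\<lambda>c. (y(p := c), m + f c)) (filter (\<lambda>c. m + f c \<le> \<tau>) cs))"

text \<open>
  The vectors of weight at most \<open>\<tau>\<close> that are supported on the \<open>l\<close> cyclically consecutive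
  positions from \<open>pos\<close> on and have coefficients \<open>cs\<close> there, paired with their weights.
\<close>

primrec lev ::
  "nat \<Rightarrow> int list \<Rightarrow> (int \<Rightarrow> int) \<Rightarrow> int \<Rightarrow> nat \<Rightarrow> nat \<Rightarrow> (vec \<times> int) list" where
  "lev n cs f \<tau> pos 0 = [(\<lambda>_. 0, 0)]"
| "lev n cs f \<tau> pos (Suc l) = concat (map (ext f \<tau> ((pos + l) mod n) cs) (lev n cs f \<tau> pos l))"

lemma ext_snoc:
  "ext f \<tau> p (cs @ [c]) (y, m) =
     ext f \<tau> p cs (y, m) @ (if m + f c \<le> \<tau> then [(y(p := c), m + f c)] else [])"
  by (simp add: ext_def)

lemma tot_upd:
  assumes "p < length x" "y p = 0"
  shows "tot x (y(p := c)) = tot x y + c * x ! p"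
proof -
  have "tot x (y(p := c)) = (\<Sum>i<length x. y i * x ! i + (if i = p then c * x ! p else 0))"
    unfolding tot_def using assms by (intro sum.cong) auto
  then show ?thesis using assms by (simp add: sum.distrib tot_def)
qed

lemma cod_upd:
  assumes "p < n" "y p = 0"
  shows "cod d n (y(p := c)) = cod d n y + c * (2 * d + 1) ^ p"
proof -
  have "cod d n (y(p := c)) =
      (\<Sum>i<n. y i * (2 * d + 1) ^ i + (if i = p then c * (2 * d + 1) ^ p else 0))"
    unfolding cod_def using assms by (intro sum.cong) auto
  then show ?thesis using assms by (simp add: sum.distrib cod_def)
qed

lemma mod_add_left_cancel:
  fixes i j m n :: nat
  assumes "(m + i) mod n = (m + j) mod n" "i < n" "j < n"
  shows "i = j"
proof -
  have *: "j \<le> i" if "(m + i) mod n = (m + j) mod n" "i < n" "j < n" for i j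
  proof (rule ccontr)
    assume "\<not> j \<le> i"
    then have "n dvd (m + j) - (m + i)" using that mod_eq_dvd_iff_nat[of "m + i" "m + j" n] by simp
    then have "n \<le> j - i" using \<open>\<not> j \<le> i\<close> by (intro dvd_imp_le) auto
    then show False using that by simp
  qed
  show ?thesis using *[of i j] *[of j i] assms by simp
qed

lemma abs_tot_le:
  assumes "small d y"
  shows "\<bar>tot x y\<bar> \<le> d * (\<Sum>i<length x. \<bar>x ! i\<bar>)"
proof -
  have "\<bar>tot x y\<bar> \<le> (\<Sum>i<length x. \<bar>y i * x ! i\<bar>)" unfolding tot_def by (rule sum_abs)
  also have "\<dots> \<le> (\<Sum>i<length x. d * \<bar>x ! i\<bar>)"
    using assms by (intro sum_mono) (auto simp: abs_mult small_def intro!: mult_right_mono)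
  finally show ?thesis by (simp add: sum_distrib_left)
qed

text \<open>Codes are balanced representations to the base 2 d + 1 with digits from -d to d; the
  extreme value, all digits d, is ((2 d + 1)^n - 1) / 2.\<close>

lemma abs_cod_less:
  assumes "small d y" "0 \<le> d"
  shows "2 * \<bar>cod d n y\<bar> < (2 * d + 1) ^ n"
proof (induction n)
  case (Suc n)
  have "\<bar>y n * (2 * d + 1) ^ n\<bar> \<le> d * (2 * d + 1) ^ n"
    using assms by (auto simp: abs_mult small_def intro!: mult_right_mono)
  moreover have "\<bar>cod d (Suc n) y\<bar> \<le> \<bar>cod d n y\<bar> + \<bar>y n * (2 * d + 1) ^ n\<bar>"
    by (simp add: cod_def)
  ultimately have "2 * \<bar>cod d (Suc n) y\<bar> < (2 * d + 1) ^ n + 2 * (d * (2 * d + 1) ^ n)"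
    using Suc by linarith
  then show ?case by (simp add: algebra_simps)
qed (simp add: cod_def)

lemma length_ext_le: "length (ext f \<tau> p cs z) \<le> length cs"
  by (cases z) (simp add: ext_def)

text \<open>Lists are only appended, so a loop that starts writing at index \<open>k\<close>
  preserves everything below. This is what keeps earlier levels and the list of the first half
  intact.\<close>

definition frame :: "nat set \<Rightarrow> nat set \<Rightarrow> int \<Rightarrow> state \<Rightarrow> state \<Rightarrow> bool" where
  "frame V A k s s' \<longleftrightarrow>
     (\<forall>v. v \<notin> V \<longrightarrow> vars s' v = vars s v) \<and>
     (\<forall>a i. a \<notin> A \<or> i < k \<longrightarrow> arrs s' a i = arrs s a i)"

lemma frame_refl: "frame V A k s s" by (simp add: frame_def)

lemma frame_trans: "frame V A k s s' \<Longrightarrow> frame V A k s' s'' \<Longrightarrow> frame V A k s s''"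
  by (auto simp: frame_def)

lemma frame_var: "frame V A k s s' \<Longrightarrow> v \<notin> V \<Longrightarrow> vars s' v = vars s v"
  by (simp add: frame_def)

lemma frame_arr: "frame V A k s s' \<Longrightarrow> a \<notin> A \<or> i < k \<Longrightarrow> arrs s' a i = arrs s a i"
  by (simp add: frame_def)

text \<open>The four bounds on \<open>H\<close> cover sums, codes with the powers of the base,
  weights with positions, and the base constant itself.\<close>

locale alg = word_size +
  fixes x :: "int list" and d :: int
  assumes d_pos: "0 < d"
    and H_tot: "d * (\<Sum>i<length x. \<bar>x ! i\<bar>) \<le> H"
    and H_cod: "(2 * d + 1) ^ length x \<le> H"
    and H_dn: "d * (2 * int (length x) + 2) \<le> H"
    and H_b: "2 * d + 1 \<le> H"
begin

abbreviation n where "n \<equiv> length x"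

definition inp :: "state \<Rightarrow> bool" where
  "inp s \<longleftrightarrow> vars s vN = int n \<and> (\<forall>p<n. arrs s aX (int p) = x ! p \<and>
      arrs s aPW (int p) = (2 * d + 1) ^ p)"

definition seg :: "state \<Rightarrow> int \<Rightarrow> (vec \<times> int) list \<Rightarrow> bool" where
  "seg s k zs \<longleftrightarrow> (\<forall>i<length zs. arrs s aTOT (k + int i) = tot x (fst (zs ! i)) \<and>
      arrs s aCOD (k + int i) = cod d n (fst (zs ! i)) \<and> arrs s aWT (k + int i) = snd (zs ! i))"

lemma inp_frame:
  assumes "inp s" "frame V A k s s'" "vN \<notin> V" "aX \<notin> A" "aPW \<notin> A"
  shows "inp s'"
  using assms by (auto simp: inp_def frame_def)

lemma seg_append:
  "seg s k (ys @ zs) \<longleftrightarrow> seg s k ys \<and> seg s (k + int (length ys)) zs"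
proof -
  have "seg s (k + int (length ys)) zs" if "seg s k (ys @ zs)"
    unfolding seg_def
  proof (intro allI impI)
    fix i assume "i < length zs"
    then show "arrs s aTOT (k + int (length ys) + int i) = tot x (fst (zs ! i)) \<and>
      arrs s aCOD (k + int (length ys) + int i) = cod d n (fst (zs ! i)) \<and>
      arrs s aWT (k + int (length ys) + int i) = snd (zs ! i)"
      using that[unfolded seg_def, rule_format, of "length ys + i"]
      by (simp add: nth_append add.assoc)
  qed
  moreover have "seg s k ys" if "seg s k (ys @ zs)"
    using that by (auto simp: seg_def nth_append)
  moreover have "seg s k (ys @ zs)" if "seg s k ys" "seg s (k + int (length ys)) zs"
    unfolding seg_def
  proof (intro allI impI)
    fix i assume "i < length (ys @ zs)"
    then show "arrs s aTOT (k + int i) = tot x (fst ((ys @ zs) ! i)) \<and>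
      arrs s aCOD (k + int i) = cod d n (fst ((ys @ zs) ! i)) \<and>
      arrs s aWT (k + int i) = snd ((ys @ zs) ! i)"
      using that(1)[unfolded seg_def, rule_format, of i]
        that(2)[unfolded seg_def, rule_format, of "i - length ys"]
      by (auto simp: nth_append add.assoc of_nat_diff)
  qed
  ultimately show ?thesis by blast
qed

lemma seg_Nil [simp]: "seg s k []" by (simp add: seg_def)

lemma seg_frame:
  assumes "seg s k zs" "frame V A k' s s'" "k + int (length zs) \<le> k'"
  shows "seg s' k zs"
  using assms by (auto simp: seg_def frame_def)

lemma n_le_H: "2 * int n + 2 \<le> H"
proof -
  have "1 * (2 * int n + 2) \<le> d * (2 * int n + 2)" using d_pos by (intro mult_right_mono) auto
  from this H_dn have "1 * (2 * int n + 2) \<le> H" by (rule order_trans)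
  then show ?thesis by simp
qed

lemma tot_le_H: "small d y \<Longrightarrow> \<bar>tot x y\<bar> \<le> H"
  using abs_tot_le[of d y x] H_tot by linarith

lemma cod_le_H: "small d y \<Longrightarrow> \<bar>cod d n y\<bar> \<le> H"
  using abs_cod_less[of d y n] H_cod d_pos by linarith

lemma wp_digit_loop:
  assumes inp: "inp s" and p: "p < n" "y p = 0" and y: "small d y"
    and v: "vars s vHD = h" "vars s vTL = tp" "vars s vP = int p" "vars s vC = lo"
      "vars s vW0 = w0" "vars s vW1 = w1" "vars s vTAU = \<tau>"
    and f: "f = (\<lambda>c. w0 + w1 * \<bar>c\<bar>)" "\<And>c. \<bar>c\<bar> \<le> d \<Longrightarrow> 0 \<le> f c \<and> f c \<le> d"
    and h: "0 \<le> h" "h < tp" "seg s h [(y, m)]" "tp + 2 * d + 1 \<le> H" "0 \<le> m" "m + d \<le> H"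
    and lo: "- d \<le> lo" "lo \<le> d"
  shows "wp w H (digit_loop d) (\<lambda>t' s'. t' \<le> t + 16 * nat (2 * d + 1) + 1 \<and>
      frame {vC, vWT, vTL} {aTOT, aCOD, aWT} tp s s' \<and>
      vars s' vTL = tp + int (length (ext f \<tau> p [lo..d] (y, m))) \<and>
      seg s' tp (ext f \<tau> p [lo..d] (y, m))) t s"
proof -
  let ?E = "\<lambda>c. ext f \<tau> p [lo..c - 1] (y, m)"
  define I where "I = (\<lambda>t' s'. lo \<le> vars s' vC \<and> vars s' vC \<le> d + 1 \<and>
      t' \<le> t + 16 * nat (vars s' vC - lo) \<and>
      frame {vC, vWT, vTL} {aTOT, aCOD, aWT} tp s s' \<and>
      vars s' vTL = tp + int (length (?E (vars s' vC))) \<and> seg s' tp (?E (vars s' vC)))"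
  show ?thesis unfolding digit_loop_def
  proof (rule wp_While[where I = I and m = "\<lambda>s. nat (d + 1 - vars s vC)"])
    show "exp_ok H (Bin Less (Var vC) (Const (d + 1)))"
      using d_pos H_b by simp
    show "I t s" using v lo by (simp add: I_def frame_refl ext_def)
  next
    fix t' s' assume I: "I t' s'" and e: "evl s' (Bin Less (Var vC) (Const (d + 1))) \<noteq> 0"
    define c where "c = vars s' vC"
    have c: "lo \<le> c" "c \<le> d" using I e by (auto simp: I_def c_def)
    then have c': "\<bar>c\<bar> \<le> d" using lo by auto
    note fr = I[unfolded I_def, THEN conjunct2, THEN conjunct2, THEN conjunct2, THEN conjunct1]
    have vs: "vars s' vHD = h" "vars s' vP = int p" "vars s' vW0 = w0" "vars s' vW1 = w1"
      "vars s' vTAU = \<tau>" using frame_var[OF fr] v by auto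
    have arr: "arrs s' aWT h = m" "arrs s' aTOT h = tot x y" "arrs s' aCOD h = cod d n y"
      "arrs s' aX (int p) = x ! p" "arrs s' aPW (int p) = (2 * d + 1) ^ p"
      using frame_arr[OF fr] h inp p by (auto simp: seg_def inp_def)
    have snoc: "[lo..c] = [lo..c - 1] @ [c]" using c by (simp add: upto_rec2)
    have len: "int (length (?E c)) \<le> 2 * d"
      using length_ext_le[of f \<tau> p "[lo..c - 1]" "(y, m)"] c lo by simp
    have tp': "vars s' vTL = tp + int (length (?E c))" and sg: "seg s' tp (?E c)"
      and tm: "t' \<le> t + 16 * nat (c - lo)"
      using I by (auto simp: I_def c_def)
    have small': "small d (y(p := c))" using y c' by (auto simp: small_def)
    have T: "tot x (y(p := c)) = tot x y + c * x ! p" "cod d n (y(p := c)) = cod d n y + c * (2 * d + 1) ^ p"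
      using tot_upd[OF p(1)] cod_upd[OF p(1)] p(2) by auto
    have TH: "\<bar>tot x y + c * x ! p\<bar> \<le> H" "\<bar>cod d n y + c * (2 * d + 1) ^ p\<bar> \<le> H"
      using tot_le_H[OF small'] cod_le_H[OF small'] T by auto
    have fc: "w0 + w1 * \<bar>c\<bar> = f c" "0 \<le> f c" "f c \<le> d" using f c' by auto
    have abs_eq: "c * (1 - 2 * of_bool (c < 0)) = \<bar>c\<bar>" by (simp add: abs_if)
    have dH: "d \<le> H" "\<bar>c + 1\<bar> \<le> H" using H_b d_pos c' by auto
    have nn: "nat (d + 1 - c) = Suc (nat (d - c))" "nat (c + 1 - lo) = Suc (nat (c - lo))"
      using c by auto
    show "wp w H (Assign vWT (Elem aWT (Var vHD) \<oplus> (Var vW0 \<oplus> Var vW1 \<otimes> abs_exp (Var vC)));;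
      Cond (Bin Less (Var vTAU) (Var vWT)) Skip
        (Store aTOT (Var vTL) (Elem aTOT (Var vHD) \<oplus> Var vC \<otimes> Elem aX (Var vP));;
         Store aCOD (Var vTL) (Elem aCOD (Var vHD) \<oplus> Var vC \<otimes> Elem aPW (Var vP));;
         Store aWT (Var vTL) (Var vWT);;
         Assign vTL (Var vTL \<oplus> Const 1));;
      Assign vC (Var vC \<oplus> Const 1))
      (\<lambda>t'' s''. I (Suc t'') s'' \<and> nat (d + 1 - vars s'' vC) < nat (d + 1 - vars s' vC)) (Suc t') s'"
      apply (rule wp_Seq, rule wp_Assign, simp)
       apply (use h fc in \<open>simp add: vs arr c_def[symmetric] abs_eq\<close>)
      apply (rule wp_Seq, rule wp_Cond, simp)
       apply (rule wp_Skip, rule wp_Assign, simp)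
        apply (use dH in \<open>simp add: c_def\<close>)
       apply (use c tm tp' sg fr in \<open>simp add: I_def vs arr c_def[symmetric] abs_eq fc snoc ext_snoc nn frame_def seg_def\<close>)
      apply (rule wp_Seq, rule wp_Store, simp, simp)
       apply (use TH in \<open>simp add: vs arr c_def[symmetric]\<close>)
      apply (rule wp_Seq, rule wp_Store, simp, simp)
       apply (use TH in \<open>simp add: vs arr c_def[symmetric]\<close>)
      apply (rule wp_Seq, rule wp_Store, simp, simp)
       apply (use h fc in \<open>simp add: vs arr c_def[symmetric] abs_eq\<close>)
      apply (rule wp_Assign, simp)
       apply (use h len in \<open>simp add: tp'\<close>)
      apply (rule wp_Assign, simp)
       apply (use dH in \<open>simp add: c_def\<close>)
      apply (use c tm tp' sg fr h in \<open>simp add: I_def vs arr c_def[symmetric] abs_eq fc snoc ext_snoc nn\<close>)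
      apply (rule conjI)
       apply (simp add: frame_def)
      apply (simp add: seg_append)
      apply (simp add: seg_def T)
      done
  next
    fix t' s' assume I: "I t' s'" and e: "evl s' (Bin Less (Var vC) (Const (d + 1))) = 0"
    then have c: "vars s' vC = d + 1" by (auto simp: I_def)
    have "nat (d + 1 - lo) \<le> nat (2 * d + 1)" using lo by simp
    then show "Suc t' \<le> t + 16 * nat (2 * d + 1) + 1 \<and>
      frame {vC, vWT, vTL} {aTOT, aCOD, aWT} tp s s' \<and>
      vars s' vTL = tp + int (length (ext f \<tau> p [lo..d] (y, m))) \<and>
      seg s' tp (ext f \<tau> p [lo..d] (y, m))"
      using I c by (simp add: I_def)
  qed
qed

lemma wp_item_loop:
  assumes inp: "inp s" and p: "p < n"
    and v: "vars s vHD = h" "vars s vTL = h + int (length ys)" "vars s vEND = h + int (length ys)"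
      "vars s vP = int p" "vars s vLO = lo" "vars s vW0 = w0" "vars s vW1 = w1" "vars s vTAU = \<tau>"
    and f: "f = (\<lambda>c. w0 + w1 * \<bar>c\<bar>)" "\<And>c. \<bar>c\<bar> \<le> d \<Longrightarrow> 0 \<le> f c \<and> f c \<le> d"
    and ys: "\<And>y m. (y, m) \<in> set ys \<Longrightarrow> y p = 0 \<and> small d y \<and> 0 \<le> m \<and> m + d \<le> H"
    and zs: "zs = concat (map (ext f \<tau> p [lo..d]) ys)"
    and h: "0 \<le> h" "seg s h ys" "h + int (length ys) + int (length zs) + 2 * d + 1 \<le> H"
    and lo: "- d \<le> lo" "lo \<le> d"
  shows "wp w H (item_loop d) (\<lambda>t' s'. t' \<le> t + length ys * (16 * nat (2 * d + 1) + 8) + 1 \<and>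
      frame {vC, vWT, vTL, vHD} {aTOT, aCOD, aWT} (h + int (length ys)) s s' \<and>
      vars s' vHD = h + int (length ys) \<and>
      vars s' vTL = h + int (length ys) + int (length zs) \<and>
      seg s' (h + int (length ys)) zs) t s"
proof -
  let ?k = "h + int (length ys)"
  let ?E = "\<lambda>i. concat (map (ext f \<tau> p [lo..d]) (take i ys))"
  define I where "I = (\<lambda>t' s'. \<exists>i \<le> length ys. vars s' vHD = h + int i \<and>
      t' \<le> t + i * (16 * nat (2 * d + 1) + 8) \<and>
      frame {vC, vWT, vTL, vHD} {aTOT, aCOD, aWT} ?k s s' \<and>
      vars s' vTL = ?k + int (length (?E i)) \<and> seg s' ?k (?E i))"
  define M where "M = (\<lambda>s :: state. nat (?k - vars s vHD))"
  show ?thesis unfolding item_loop_def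
  proof (rule wp_While[where I = I and m = M])
    show "exp_ok H (Bin Less (Var vHD) (Var vEND))" by simp
    show "I t s" using v by (auto simp: I_def frame_refl intro!: exI[of _ 0])
  next
    fix t' s' assume I: "I t' s'" and e: "evl s' (Bin Less (Var vHD) (Var vEND)) \<noteq> 0"
    obtain i where i: "i \<le> length ys" "vars s' vHD = h + int i"
      "t' \<le> t + i * (16 * nat (2 * d + 1) + 8)"
      and fr: "frame {vC, vWT, vTL, vHD} {aTOT, aCOD, aWT} ?k s s'"
      and TP: "vars s' vTL = ?k + int (length (?E i))" and sg: "seg s' ?k (?E i)"
      using I by (auto simp: I_def)
    have vs: "vars s' vEND = ?k" "vars s' vP = int p" "vars s' vLO = lo" "vars s' vW0 = w0"
      "vars s' vW1 = w1" "vars s' vTAU = \<tau>" using frame_var[OF fr] v by auto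
    have il: "i < length ys" using e i vs by (simp split: if_splits)
    obtain y m where ym: "ys ! i = (y, m)" by force
    then have Y: "y p = 0" "small d y" "0 \<le> m" "m + d \<le> H"
      using ys[of y m] il nth_mem[of i ys] by auto
    have E: "?E (Suc i) = ?E i @ ext f \<tau> p [lo..d] (y, m)"
      using il ym by (simp add: take_Suc_conv_app_nth)
    have len: "length (?E i) \<le> length zs"
    proof -
      have "zs = ?E i @ concat (map (ext f \<tau> p [lo..d]) (drop i ys))"
        unfolding zs concat_append[symmetric] map_append[symmetric] by simp
      then have "length zs = length (?E i) + length (concat (map (ext f \<tau> p [lo..d]) (drop i ys)))"
        by (metis length_append)
      then show ?thesis by linarith
    qed
    let ?s = "set_var vC lo s'"
    have inp': "inp ?s" using inp_frame[OF inp fr] by (simp add: inp_def)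
    have sg1: "seg ?s (h + int i) [(y, m)]"
      using h(2) ym il frame_arr[OF fr] by (auto simp: seg_def)
    have dl: "wp w H (digit_loop d) (\<lambda>t'' s''. t'' \<le> Suc (Suc (Suc t')) + 16 * nat (2 * d + 1) + 1 \<and>
      frame {vC, vWT, vTL} {aTOT, aCOD, aWT} (?k + int (length (?E i))) ?s s'' \<and>
      vars s'' vTL = ?k + int (length (?E i)) + int (length (ext f \<tau> p [lo..d] (y, m))) \<and>
      seg s'' (?k + int (length (?E i))) (ext f \<tau> p [lo..d] (y, m))) (Suc (Suc (Suc t'))) ?s"
      by (rule wp_digit_loop[OF inp' p Y(1,2) _ _ _ _ _ _ _ f _ _ sg1 _ Y(3,4) lo])
        (use i il TP vs h len in auto)
    show "wp w H (Assign vC (Var vLO);; digit_loop d;; Assign vHD (Var vHD \<oplus> Const 1))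
      (\<lambda>t'' s''. I (Suc t'') s'' \<and> M s'' < M s') (Suc t') s'"
      apply (rule wp_Seq, rule wp_Assign, simp)
       apply (use lo H_b in \<open>simp add: vs\<close>)
      apply (rule wp_Seq)
      apply (simp add: vs)
      apply (rule wp_mono[OF dl], elim conjE)
      subgoal premises prems for t'' s''
      proof (rule wp_Assign)
        note fr' = prems(2)
        have hd: "vars s'' vHD = h + int i" using frame_var[OF fr'] i by simp
        have "frame {vC, vWT, vTL, vHD} {aTOT, aCOD, aWT} ?k s' s''"
          using fr' by (auto simp: frame_def)
        then have F: "frame {vC, vWT, vTL, vHD} {aTOT, aCOD, aWT} ?k s s''"
          using frame_trans[OF fr] by blast
        have sg': "seg s'' ?k (?E (Suc i))"
          unfolding E seg_append
        proof
          have "seg ?s ?k (?E i)" using sg by (simp add: seg_def)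
          from seg_frame[OF this fr'] show "seg s'' ?k (?E i)" by simp
        qed (use prems(4) in simp)
        show "exp_ok H (Var vHD \<oplus> Const 1)" by simp
        show "\<bar>evl s'' (Var vHD \<oplus> Const 1)\<bar> \<le> H" using h il d_pos by (simp add: hd)
        let ?s' = "set_var vHD (evl s'' (Var vHD \<oplus> Const 1)) s''"
        have "I (Suc (Suc (Suc t''))) ?s'" unfolding I_def
        proof (intro exI[of _ "Suc i"] conjI)
          show "Suc i \<le> length ys" using il by simp
          show "vars ?s' vHD = h + int (Suc i)" by (simp add: hd)
          show "Suc (Suc (Suc t'')) \<le> t + Suc i * (16 * nat (2 * d + 1) + 8)"
            using prems(1) i(3) by simp
          show "frame {vC, vWT, vTL, vHD} {aTOT, aCOD, aWT} ?k s ?s'"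
            using F by (simp add: frame_def)
          show "vars ?s' vTL = ?k + int (length (?E (Suc i)))" using prems(3) by (simp add: E)
          show "seg ?s' ?k (?E (Suc i))" using sg' by (simp add: seg_def)
        qed
        then show "I (Suc (Suc (Suc t''))) ?s' \<and> M ?s' < M s'"
          using il i by (simp add: M_def hd)
      qed
      done
  next
    fix t' s' assume I: "I t' s'" and e: "evl s' (Bin Less (Var vHD) (Var vEND)) = 0"
    then obtain i where i: "i \<le> length ys" "vars s' vHD = h + int i"
      "t' \<le> t + i * (16 * nat (2 * d + 1) + 8)"
      and fr: "frame {vC, vWT, vTL, vHD} {aTOT, aCOD, aWT} ?k s s'"
      and TP: "vars s' vTL = ?k + int (length (?E i))" and sg: "seg s' ?k (?E i)"
      by (auto simp: I_def)
    have "vars s' vEND = ?k" using frame_var[OF fr] v by auto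
    then have "i = length ys" using e i by (simp split: if_splits)
    then show "Suc t' \<le> t + length ys * (16 * nat (2 * d + 1) + 8) + 1 \<and>
      frame {vC, vWT, vTL, vHD} {aTOT, aCOD, aWT} ?k s s' \<and>
      vars s' vHD = ?k \<and> vars s' vTL = ?k + int (length zs) \<and> seg s' ?k zs"
      using i fr TP sg zs by simp
  qed
qed

definition positions :: "nat \<Rightarrow> nat \<Rightarrow> nat set" where
  "positions pos l = (\<lambda>k. (pos + k) mod n) ` {..<l}"

lemma positions_Suc: "positions pos (Suc l) = insert ((pos + l) mod n) (positions pos l)"
  by (simp add: positions_def lessThan_Suc)

lemma positions_new:
  assumes "l < n"
  shows "(pos + l) mod n \<notin> positions pos l"
proof
  assume "(pos + l) mod n \<in> positions pos l"
  then obtain k where "k < l" "(pos + l) mod n = (pos + k) mod n" by (auto simp: positions_def)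
  then show False using mod_add_left_cancel[of pos l n k] assms by simp
qed

lemma lev_props:
  assumes f: "\<And>c. \<bar>c\<bar> \<le> d \<Longrightarrow> 0 \<le> f c \<and> f c \<le> d" and lo: "- d \<le> lo"
    and "l \<le> n" "(y, m) \<in> set (lev n [lo..d] f \<tau> pos l)"
  shows "small d y \<and> (\<forall>p. p \<notin> positions pos l \<longrightarrow> y p = 0) \<and> (\<forall>p \<in> positions pos l. lo \<le> y p) \<and>
    0 \<le> m \<and> m \<le> d * int l"
  using assms(3,4)
proof (induction l arbitrary: y m)
  case 0
  then show ?case using d_pos by (simp add: small_def positions_def)
next
  case (Suc l)
  from Suc.prems obtain y' m' c where *: "(y', m') \<in> set (lev n [lo..d] f \<tau> pos l)"
    "y = y'((pos + l) mod n := c)" "m = m' + f c" "lo \<le> c" "c \<le> d"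
    unfolding lev.simps set_concat set_map ext_def by fastforce
  have IH: "small d y'" "\<forall>p. p \<notin> positions pos l \<longrightarrow> y' p = 0"
    "\<forall>p \<in> positions pos l. lo \<le> y' p" "0 \<le> m'" "m' \<le> d * int l"
    using Suc.IH[OF _ *(1)] Suc.prems by auto
  have "\<bar>c\<bar> \<le> d" using * lo by auto
  then show ?case using IH * f[of c] positions_new[of l pos] Suc.prems(1)
    by (auto simp: small_def positions_Suc algebra_simps)
qed

text \<open>A level is read like a queue from \<open>vHD\<close> to \<open>vEND\<close> while the
  next one is written behind it. All levels stay in memory, whence the space of
  \<open>len + 1\<close> lists of length \<open>B\<close>; only the last one is handed on.\<close>

lemma wp_level_loop:
  assumes inp: "inp s" and len: "len \<le> n"
    and v: "vars s vHD = h" "vars s vTL = h + 1" "vars s vLEV = 0" "vars s vLEN = int len"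
      "vars s vPOS = int pos" "vars s vLO = lo" "vars s vW0 = w0" "vars s vW1 = w1" "vars s vTAU = \<tau>"
    and f: "f = (\<lambda>c. w0 + w1 * \<bar>c\<bar>)" "\<And>c. \<bar>c\<bar> \<le> d \<Longrightarrow> 0 \<le> f c \<and> f c \<le> d"
    and B: "\<And>l. l \<le> len \<Longrightarrow> length (lev n [lo..d] f \<tau> pos l) \<le> B"
    and h: "0 \<le> h" "seg s h [(\<lambda>_. 0, 0)]" "h + int (len + 1) * int B + 2 * d + 1 \<le> H"
    and lo: "- d \<le> lo" "lo \<le> d"
  shows "wp w H (level_loop d) (\<lambda>t' s'. t' \<le> t + len * (B * (16 * nat (2 * d + 1) + 8) + 12) + 1 \<and>
      frame {vC, vWT, vTL, vHD, vP, vEND, vLEV} {aTOT, aCOD, aWT} (h + 1) s s' \<and>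
      vars s' vTL \<le> h + int (len + 1) * int B \<and> h \<le> vars s' vHD \<and>
      vars s' vTL = vars s' vHD + int (length (lev n [lo..d] f \<tau> pos len)) \<and>
      seg s' (vars s' vHD) (lev n [lo..d] f \<tau> pos len)) t s"
proof -
  let ?L = "lev n [lo..d] f \<tau> pos"
  let ?N = "16 * nat (2 * d + 1) + 8"
  let ?V = "{vC, vWT, vTL, vHD, vP, vEND, vLEV}"
  define I where "I = (\<lambda>t' s'. \<exists>l \<le> len. vars s' vLEV = int l \<and>
      t' \<le> t + l * (B * ?N + 12) \<and>
      frame ?V {aTOT, aCOD, aWT} (h + 1) s s' \<and>
      h \<le> vars s' vHD \<and> vars s' vHD \<le> h + int l * int B \<and>
      vars s' vTL = vars s' vHD + int (length (?L l)) \<and> h + 1 \<le> vars s' vTL \<and>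
      seg s' (vars s' vHD) (?L l))"
  define M where "M = (\<lambda>s :: state. nat (int len - vars s vLEV))"
  show ?thesis unfolding level_loop_def
  proof (rule wp_While[where I = I and m = M])
    show "exp_ok H (Bin Less (Var vLEV) (Var vLEN))" by simp
    show "I t s" using v h by (auto simp: I_def frame_refl intro!: exI[of _ 0])
  next
    fix t' s' assume I: "I t' s'" and e: "evl s' (Bin Less (Var vLEV) (Var vLEN)) \<noteq> 0"
    obtain l where l: "l \<le> len" "vars s' vLEV = int l" "t' \<le> t + l * (B * ?N + 12)"
      and fr: "frame ?V {aTOT, aCOD, aWT} (h + 1) s s'"
      and hd: "h \<le> vars s' vHD" "vars s' vHD \<le> h + int l * int B"
      and TP: "vars s' vTL = vars s' vHD + int (length (?L l))" "h + 1 \<le> vars s' vTL"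
      and sg: "seg s' (vars s' vHD) (?L l)"
      using I by (auto simp: I_def)
    define h' where "h' = vars s' vHD"
    have vs: "vars s' vLEN = int len" "vars s' vPOS = int pos" "vars s' vLO = lo"
      "vars s' vW0 = w0" "vars s' vW1 = w1" "vars s' vTAU = \<tau>" using frame_var[OF fr] v by auto
    have ll: "l < len" using e l vs by (simp split: if_splits)
    let ?p = "(pos + l) mod n"
    have p: "?p < n" using ll len by (intro mod_less_divisor) linarith
    have inp': "inp s'" using inp_frame[OF inp fr] by simp
    then have N: "vars s' vN = int n" by (simp add: inp_def)
    have pe: "(int pos + int l) mod int n = int ?p" by (simp add: zmod_int)
    have nH: "int n \<le> H" using n_le_H by simp
    have dn: "d * int l + d \<le> H"
    proof -
      have "d * (int l + 1) \<le> d * (2 * int n + 2)" using ll len d_pos by (intro mult_left_mono) auto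
      then show ?thesis using H_dn by (simp add: algebra_simps)
    qed
    have ys: "y ?p = 0 \<and> small d y \<and> 0 \<le> m \<and> m + d \<le> H" if "(y, m) \<in> set (?L l)" for y m
      using lev_props[OF f(2) lo(1) _ that] positions_new[of l pos] ll len dn by fastforce
    let ?s = "set_var vEND (vars s' vTL) (set_var vP (int ?p) s')"
    have inp2: "inp ?s" using inp' by (simp add: inp_def)
    have sg2: "seg ?s h' (?L l)" using sg by (simp add: seg_def h'_def)
    have l1: "length (?L l) \<le> B" "length (?L (Suc l)) \<le> B" using B ll by (auto simp del: lev.simps)
    \<comment> \<open>Room for the l earlier levels, for the level being read and for the one being
      written.\<close>
    have "int l * int B + 2 * int B \<le> int (len + 1) * int B"
      unfolding distrib_right[symmetric] using ll by (intro mult_right_mono) auto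
    then have bnd: "h' + int (length (?L l)) + int (length (?L (Suc l))) + 2 * d + 1 \<le> H"
      using hd h(3) l1 by (simp add: h'_def del: lev.simps)
    have il: "wp w H (item_loop d) (\<lambda>t'' s''.
      t'' \<le> Suc (Suc (Suc (Suc (Suc t')))) + length (?L l) * ?N + 1 \<and>
      frame {vC, vWT, vTL, vHD} {aTOT, aCOD, aWT} (h' + int (length (?L l))) ?s s'' \<and>
      vars s'' vHD = h' + int (length (?L l)) \<and>
      vars s'' vTL = h' + int (length (?L l)) + int (length (?L (Suc l))) \<and>
      seg s'' (h' + int (length (?L l))) (?L (Suc l))) (Suc (Suc (Suc (Suc (Suc t'))))) ?s"
      by (rule wp_item_loop[OF inp2 p _ _ _ _ _ _ _ _ f ys _ _ sg2 _ lo])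
        (use vs TP hd h(1) bnd in \<open>auto simp: h'_def\<close>)
    show "wp w H (Assign vP (Bin Mod (Var vPOS \<oplus> Var vLEV) (Var vN));; Assign vEND (Var vTL);;
       item_loop d;; Assign vLEV (Var vLEV \<oplus> Const 1))
      (\<lambda>t'' s''. I (Suc t'') s'' \<and> M s'' < M s') (Suc t') s'"
      apply (rule wp_Seq, rule wp_Assign, simp)
       apply (use p nH in \<open>simp add: vs l N pe\<close>)
      apply (rule wp_Seq, rule wp_Assign, simp)
       apply (use bnd hd h(1) d_pos TP in \<open>simp add: h'_def del: lev.simps\<close>)
      apply (rule wp_Seq)
      apply (simp add: vs l N pe)
      apply (rule wp_mono[OF il], elim conjE)
      subgoal premises prems for t'' s''
      proof (rule wp_Assign)
        note fr' = prems(2)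
        have lv: "vars s'' vLEV = int l" using frame_var[OF fr'] l by simp
        have "frame ?V {aTOT, aCOD, aWT} (h + 1) s' s''"
          using fr' TP by (auto simp: frame_def h'_def)
        then have F: "frame ?V {aTOT, aCOD, aWT} (h + 1) s s''"
          using frame_trans[OF fr] by blast
        show "exp_ok H (Var vLEV \<oplus> Const 1)" by simp
        show "\<bar>evl s'' (Var vLEV \<oplus> Const 1)\<bar> \<le> H" using ll len nH by (simp add: lv)
        let ?s' = "set_var vLEV (evl s'' (Var vLEV \<oplus> Const 1)) s''"
        have "I (Suc (Suc (Suc t''))) ?s'" unfolding I_def
        proof (intro exI[of _ "Suc l"] conjI)
          show "Suc l \<le> len" using ll by simp
          show "vars ?s' vLEV = int (Suc l)" by (simp add: lv)
          have "length (?L l) * ?N \<le> B * ?N" using l1 by (intro mult_right_mono) auto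
          then show "Suc (Suc (Suc t'')) \<le> t + Suc l * (B * ?N + 12)"
            unfolding mult_Suc using prems(1) l(3) by linarith
          show "frame ?V {aTOT, aCOD, aWT} (h + 1) s ?s'"
            using F by (simp add: frame_def)
          show "vars ?s' vTL = vars ?s' vHD + int (length (?L (Suc l)))"
            using prems(3,4) by (simp del: lev.simps)
          show "seg ?s' (vars ?s' vHD) (?L (Suc l))"
            using prems(3,5) by (simp add: seg_def del: lev.simps)
          show "h \<le> vars ?s' vHD" using prems(3) hd by (simp add: h'_def)
          show "vars ?s' vHD \<le> h + int (Suc l) * int B"
            using prems(3) hd l1 by (simp add: h'_def algebra_simps)
          show "h + 1 \<le> vars ?s' vTL" using prems(4) TP by (simp add: h'_def)
        qed
        then show "I (Suc (Suc (Suc t''))) ?s' \<and> M ?s' < M s'"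
          using ll l by (simp add: M_def lv)
      qed
      done
  next
    fix t' s' assume I: "I t' s'" and e: "evl s' (Bin Less (Var vLEV) (Var vLEN)) = 0"
    obtain l where l: "l \<le> len" "vars s' vLEV = int l" "t' \<le> t + l * (B * ?N + 12)"
      and fr: "frame ?V {aTOT, aCOD, aWT} (h + 1) s s'"
      and hd: "h \<le> vars s' vHD" "vars s' vHD \<le> h + int l * int B"
      and TP: "vars s' vTL = vars s' vHD + int (length (?L l))" "h + 1 \<le> vars s' vTL"
      and sg: "seg s' (vars s' vHD) (?L l)"
      using I by (auto simp: I_def)
    have "vars s' vLEN = int len" using frame_var[OF fr] v by auto
    then have "l = len" using e l by (simp split: if_splits)
    moreover have "int (length (?L len)) \<le> int B" using B by simp
    moreover have "int (len + 1) * int B = int len * int B + int B" by (simp add: algebra_simps)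
    ultimately show "Suc t' \<le> t + len * (B * ?N + 12) + 1 \<and>
      frame ?V {aTOT, aCOD, aWT} (h + 1) s s' \<and>
      vars s' vTL \<le> h + int (len + 1) * int B \<and> h \<le> vars s' vHD \<and>
      vars s' vTL = vars s' vHD + int (length (?L len)) \<and> seg s' (vars s' vHD) (?L len)"
      using l fr hd TP sg by (auto simp del: lev.simps)
  qed
qed

abbreviation (input) "build_vars \<equiv> {vC, vWT, vTL, vHD, vP, vEND, vLEV}"
abbreviation (input) "build_arrs \<equiv> {aTOT, aCOD, aWT}"

lemma wp_build:
  assumes inp: "inp s" and len: "len \<le> n"
    and v: "vars s vTL = h" "vars s vLEN = int len"
      "vars s vPOS = int pos" "vars s vLO = lo" "vars s vW0 = w0" "vars s vW1 = w1" "vars s vTAU = \<tau>"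
    and f: "f = (\<lambda>c. w0 + w1 * \<bar>c\<bar>)" "\<And>c. \<bar>c\<bar> \<le> d \<Longrightarrow> 0 \<le> f c \<and> f c \<le> d"
    and B: "\<And>l. l \<le> len \<Longrightarrow> length (lev n [lo..d] f \<tau> pos l) \<le> B"
    and h: "0 \<le> h" "h + int (len + 1) * int B + 2 * d + 1 \<le> H"
    and lo: "- d \<le> lo" "lo \<le> d"
  shows "wp w H (build d) (\<lambda>t' s'. t' \<le> t + len * (B * (16 * nat (2 * d + 1) + 8) + 12) + 13 \<and>
      frame build_vars build_arrs h s s' \<and>
      vars s' vTL \<le> h + int (len + 1) * int B \<and> h \<le> vars s' vHD \<and>
      vars s' vTL = vars s' vHD + int (length (lev n [lo..d] f \<tau> pos len)) \<and>
      seg s' (vars s' vHD) (lev n [lo..d] f \<tau> pos len)) t s"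
proof -
  let ?s = "set_var vLEV 0 (set_var vTL (h + 1) (set_var vHD h
    (set_arr aWT h 0 (set_arr aCOD h 0 (set_arr aTOT h 0 s)))))"
  let ?t = "Suc (Suc (Suc (Suc (Suc (Suc (Suc (Suc (Suc (Suc (Suc (Suc t)))))))))))"
  have 0: "inp ?s" using inp by (simp add: inp_def)
  have 1: "seg ?s h [(\<lambda>_. 0, 0)]" by (simp add: seg_def tot_def cod_def)
  have ll: "wp w H (level_loop d) (\<lambda>t' s'. t' \<le> ?t + len * (B * (16 * nat (2 * d + 1) + 8) + 12) + 1 \<and>
      frame build_vars {aTOT, aCOD, aWT} (h + 1) ?s s' \<and>
      vars s' vTL \<le> h + int (len + 1) * int B \<and> h \<le> vars s' vHD \<and>
      vars s' vTL = vars s' vHD + int (length (lev n [lo..d] f \<tau> pos len)) \<and>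
      seg s' (vars s' vHD) (lev n [lo..d] f \<tau> pos len)) ?t ?s"
    by (rule wp_level_loop[OF 0 len _ _ _ _ _ _ _ _ _ f B _ 1 _ lo]) (use v h in auto)
  have "0 \<le> int (len + 1) * int B" by simp
  then have hH: "h + 1 \<le> H" using h d_pos by linarith
  show ?thesis unfolding build_def
    apply (rule wp_Seq, rule wp_Store, simp, simp, simp)
    apply (rule wp_Seq, rule wp_Store, simp, simp, simp)
    apply (rule wp_Seq, rule wp_Store, simp, simp, simp)
    apply (rule wp_Seq, rule wp_Assign, simp)
     apply (use h hH in \<open>simp add: v\<close>)
    apply (rule wp_Seq, rule wp_Assign, simp)
     apply (use h hH in \<open>simp add: v\<close>)
    apply (rule wp_Seq, rule wp_Assign, simp, simp)
    apply (simp add: v)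
    apply (rule wp_mono[OF ll])
    apply (auto simp: frame_def)
    done
qed

end

section \<open>Meeting in the middle\<close>

definition insert_loop :: com where
  "insert_loop = While (Bin Less (Var vI) (Var vT1))
     (Assign vQ (Bin Div (Bin Mod (Var vA \<otimes> Elem aTOT (Var vI)) (Var vK \<otimes> Var vL)) (Var vL)
         \<otimes> Var vNR \<oplus> Var vRUN);;
      Store aNEXT (Var vI) (Elem aHEAD (Var vQ));;
      Store aHEAD (Var vQ) (Var vI \<oplus> Const 1);;
      Assign vI (Var vI \<oplus> Const 1))"

text \<open>Codes are linear, so two candidates of equal sum with codes \<open>vZ\<close> and
  \<open>vY\<close> yield a solution with code \<open>vZ\<close> - \<open>vY\<close>. At sum 0 the
  candidate is compared with the zero vector instead. Setting \<open>vCNT\<close> to the limit after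
  a success blocks all later walks of this run.\<close>

definition walk_loop :: com where
  "walk_loop = While (Bin Less (Const 0) (Var vPTR) \<otimes> Bin Less (Var vCNT) (Var vLIM))
     (Assign vCNT (Var vCNT \<oplus> Const 1);;
      Assign vTOT (Elem aTOT (Var vPTR \<ominus> Const 1) \<oplus> Elem aTOT (Var vI));;
      Assign vZ (Elem aCOD (Var vPTR \<ominus> Const 1) \<oplus> Elem aCOD (Var vI));;
      Assign vY (Elem aTAB (Var vTOT \<otimes> Var vNR \<oplus> Var vRUN));;
      Cond ((Const 1 \<ominus> Bin Eq (Var vZ) (Var vY)) \<otimes>
            (Bin Eq (Var vTOT) (Const 0) \<oplus> (Const 1 \<ominus> Bin Eq (Var vY) (Const 0))))
        (Assign vOUT (Var vZ \<ominus> Var vY);;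
         Assign vFLAG (Const 1);;
         Assign vCNT (Var vLIM))
        (Store aTAB (Var vTOT \<otimes> Var vNR \<oplus> Var vRUN) (Var vZ));;
      Assign vPTR (Elem aNEXT (Var vPTR \<ominus> Const 1)))"

definition scan_loop :: com where
  "scan_loop = While (Bin Less (Var vI) (Var vTL))
     (Assign vQ (Bin Div (Bin Mod (Var vA \<otimes> Elem aTOT (Var vI) \<oplus> Var vR) (Var vK \<otimes> Var vL)) (Var vL));;
      Assign vPTR (Elem aHEAD (Bin Mod (Const 0 \<ominus> Var vQ) (Var vK) \<otimes> Var vNR \<oplus> Var vRUN));;
      walk_loop;;
      Assign vPTR (Elem aHEAD (Bin Mod (Const (-1) \<ominus> Var vQ) (Var vK) \<otimes> Var vNR \<oplus> Var vRUN));;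
      walk_loop;;
      Assign vI (Var vI \<oplus> Const 1))"

text \<open>The residues modulo \<open>K * L\<close> form \<open>K\<close> blocks of length
  \<open>L\<close>, and the key is the number of the block. A vector lies in the bucket that is
  searched if its own residue is in block 0.\<close>

definition key :: "int list \<Rightarrow> int \<Rightarrow> int \<Rightarrow> int \<Rightarrow> int \<Rightarrow> vec \<Rightarrow> int" where
  "key x K L a r y = ((a * tot x y + r) mod (K * L)) div L"

definition add :: "vec \<Rightarrow> vec \<Rightarrow> vec" where
  "add v u = (\<lambda>p. u p + v p)"

text \<open>
  If \<open>(a * t\<^sub>u + (a * t\<^sub>v + r)) mod (K * L) < L\<close> then the keys of \<open>u\<close> and \<open>v\<close> sum to \<open>0\<close> or
  \<open>-1\<close> modulo \<open>K\<close>, depending on the carry; hence the two lookups.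
\<close>

definition cands_of :: "int list \<Rightarrow> int \<Rightarrow> int \<Rightarrow> int \<Rightarrow> int \<Rightarrow> vec list \<Rightarrow> vec \<Rightarrow> vec list" where
  "cands_of x K L a r us v =
     (let B = \<lambda>q. rev (filter (\<lambda>u. key x K L a 0 u = q) us); q = key x K L a r v
      in map (add v) (B ((0 - q) mod K)) @ map (add v) (B ((-1 - q) mod K)))"

definition cands :: "int list \<Rightarrow> int \<Rightarrow> int \<Rightarrow> int \<Rightarrow> int \<Rightarrow> vec list \<Rightarrow> vec list \<Rightarrow> vec list" where
  "cands x K L a r us vs = concat (map (cands_of x K L a r us) vs)"

text \<open>A coarser version of \<open>frame\<close> for the hash table and the table of sums,
  which are written at scattered indices.\<close>

definition keep :: "nat set \<Rightarrow> nat set \<Rightarrow> state \<Rightarrow> state \<Rightarrow> bool" where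
  "keep V A s s' \<longleftrightarrow> (\<forall>v. v \<notin> V \<longrightarrow> vars s' v = vars s v) \<and> (\<forall>a. a \<notin> A \<longrightarrow> arrs s' a = arrs s a)"

lemma keep_refl: "keep V A s s" by (simp add: keep_def)

lemma keep_trans: "keep V A s s' \<Longrightarrow> keep V A s' s'' \<Longrightarrow> keep V A s s''"
  by (auto simp: keep_def)

lemma keep_mono: "keep V A s s' \<Longrightarrow> V \<subseteq> V' \<Longrightarrow> A \<subseteq> A' \<Longrightarrow> keep V' A' s s'"
  by (fastforce simp: keep_def)

lemma frame_keep: "frame V A k s s' \<Longrightarrow> keep V A s s'"
  by (auto simp: frame_def keep_def)

lemma keep_var: "keep V A s s' \<Longrightarrow> v \<notin> V \<Longrightarrow> vars s' v = vars s v"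
  by (simp add: keep_def)

lemma keep_arr: "keep V A s s' \<Longrightarrow> a \<notin> A \<Longrightarrow> arrs s' a = arrs s a"
  by (simp add: keep_def)

lemma tot_add: "tot x (add v u) = tot x u + tot x v"
  by (simp add: tot_def add_def algebra_simps sum.distrib)

lemma cod_add: "cod d n (add v u) = cod d n u + cod d n v"
  by (simp add: cod_def add_def algebra_simps sum.distrib)

lemma tot_diff: "tot x (\<lambda>p. y p - z p) = tot x y - tot x z"
  by (simp add: tot_def algebra_simps sum_subtractf)

lemma cod_diff: "cod d n (\<lambda>p. y p - z p) = cod d n y - cod d n z"
  by (simp add: cod_def algebra_simps sum_subtractf)

text \<open>A nonzero top digit would outweigh all lower digits together, by
  \<open>abs_cod_less\<close>. Codes hence tell a small vector from zero, and this is all that is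
  ever asked of them.\<close>

lemma cod_eq_0:
  assumes "small d y" "0 \<le> d" "cod d n y = 0" "p < n"
  shows "y p = 0"
  using assms(3,4)
proof (induction n)
  case (Suc n)
  have "2 * \<bar>cod d n y\<bar> < (2 * d + 1) ^ n" using abs_cod_less assms by blast
  moreover have "cod d n y = - (y n * (2 * d + 1) ^ n)" using Suc.prems by (simp add: cod_def)
  ultimately have "2 * \<bar>y n\<bar> * (2 * d + 1) ^ n < 1 * (2 * d + 1) ^ n"
    using assms(2) by (simp add: abs_mult)
  then have "2 * \<bar>y n\<bar> < 1" using assms(2) mult_less_cancel_right_pos[of "(2 * d + 1) ^ n"] by simp
  then have "y n = 0" by simp
  then show ?case using Suc by (auto simp: cod_def less_Suc_eq)
qed simp

text \<open>Shows that the index classes of different runs, and the cells of one class, do not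
  interfere.\<close>

lemma slot_eq:
  fixes m :: int
  assumes "0 \<le> i" "i < m" "0 \<le> j" "j < m"
  shows "q * m + i = q' * m + j \<longleftrightarrow> q = q' \<and> i = j"
proof
  assume "q * m + i = q' * m + j"
  then have "(q * m + i) mod m = (q' * m + j) mod m" "(q * m + i) div m = (q' * m + j) div m" by auto
  then show "q = q' \<and> i = j" using assms by auto
qed auto

section \<open>Buckets as linked lists\<close>

context alg
begin

lemma inp_keep:
  assumes "inp s" "keep V A s s'" "vN \<notin> V" "aX \<notin> A" "aPW \<notin> A"
  shows "inp s'"
  using assms by (auto simp: inp_def keep_def)

lemma seg_keep:
  assumes "seg s k zs" "keep V A s s'" "aTOT \<notin> A" "aCOD \<notin> A" "aWT \<notin> A"
  shows "seg s' k zs"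
  using assms by (auto simp: seg_def keep_def)

text \<open>The bound \<open>k\<close> drops at every link, so all cells of the list lie strictly
  below \<open>k\<close>. Writing a new node at index \<open>k\<close> or above therefore cannot
  damage an existing list.\<close>

primrec chain :: "state \<Rightarrow> int \<Rightarrow> int \<Rightarrow> vec list \<Rightarrow> bool" where
  "chain s k p [] \<longleftrightarrow> p = 0"
| "chain s k p (u # us) \<longleftrightarrow> 0 < p \<and> p \<le> k \<and> arrs s aTOT (p - 1) = tot x u \<and>
     arrs s aCOD (p - 1) = cod d n u \<and> chain s (p - 1) (arrs s aNEXT (p - 1)) us"

lemma chain_cong:
  assumes "\<And>i. i < k \<Longrightarrow> arrs s' aTOT i = arrs s aTOT i \<and> arrs s' aCOD i = arrs s aCOD i \<and>
      arrs s' aNEXT i = arrs s aNEXT i"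
  shows "chain s k p us \<longleftrightarrow> chain s' k p us"
  using assms by (induction us arbitrary: k p) auto

lemma chain_mono: "chain s k p us \<Longrightarrow> k \<le> k' \<Longrightarrow> chain s k' p us"
  by (cases us) auto

lemma key_bounds:
  assumes "0 < K" "0 < L"
  shows "0 \<le> key x K L a r y" "key x K L a r y < K"
proof -
  let ?m = "(a * tot x y + r) mod (K * L)"
  have "L * (?m div L) \<le> ?m" using assms by (simp add: minus_mod_eq_mult_div[symmetric])
  also have "\<dots> < L * K" using assms by (simp add: mult.commute)
  finally show "key x K L a r y < K" using assms by (simp add: key_def)
  show "0 \<le> key x K L a r y"
    using assms by (simp add: key_def pos_imp_zdiv_nonneg_iff)
qed

text \<open>New nodes are put in front of their list, so a bucket is traversed in the reverse order
  of insertion; this is the origin of \<open>rev\<close> here and in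
  \<open>cands_of\<close>.\<close>

lemma wp_insert_loop:
  assumes v: "vars s vI = h" "vars s vT1 = h + int (length zs)" "vars s vA = a" "vars s vK = K"
      "vars s vL = L" "vars s vNR = NR" "vars s vRUN = slot"
    and h: "0 \<le> h" "seg s h zs" "h + int (length zs) \<le> H"
    and KL: "0 < K" "0 < L" "0 \<le> slot" "slot < NR" "K * NR \<le> H"
    and fresh: "\<And>q. arrs s aHEAD (q * NR + slot) = 0"
  shows "wp w H insert_loop (\<lambda>t' s'. t' \<le> t + length zs * 12 + 1 \<and>
      keep {vI, vQ} {aNEXT, aHEAD} s s' \<and>
      (\<forall>j. j mod NR \<noteq> slot \<longrightarrow> arrs s' aHEAD j = arrs s aHEAD j) \<and>
      (\<forall>q. chain s' (h + int (length zs)) (arrs s' aHEAD (q * NR + slot))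
         (rev (filter (\<lambda>u. key x K L a 0 u = q) (map fst zs))))) t s"
proof -
  let ?F = "\<lambda>q i. rev (filter (\<lambda>u. key x K L a 0 u = q) (map fst (take i zs)))"
  define I where "I = (\<lambda>t' s'. \<exists>i \<le> length zs. vars s' vI = h + int i \<and> t' \<le> t + i * 12 \<and>
      keep {vI, vQ} {aNEXT, aHEAD} s s' \<and>
      (\<forall>j. j mod NR \<noteq> slot \<longrightarrow> arrs s' aHEAD j = arrs s aHEAD j) \<and>
      (\<forall>q. chain s' (h + int i) (arrs s' aHEAD (q * NR + slot)) (?F q i)))"
  define M where "M = (\<lambda>s :: state. nat (h + int (length zs) - vars s vI))"
  show ?thesis unfolding insert_loop_def
  proof (rule wp_While[where I = I and m = M])
    show "exp_ok H (Bin Less (Var vI) (Var vT1))" by simp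
    show "I t s" using v fresh by (auto simp: I_def keep_refl intro!: exI[of _ 0])
  next
    fix t' s' assume I: "I t' s'" and e: "evl s' (Bin Less (Var vI) (Var vT1)) \<noteq> 0"
    obtain i where i: "i \<le> length zs" "vars s' vI = h + int i" "t' \<le> t + i * 12"
      and kp: "keep {vI, vQ} {aNEXT, aHEAD} s s'"
      and oth: "\<forall>j. j mod NR \<noteq> slot \<longrightarrow> arrs s' aHEAD j = arrs s aHEAD j"
      and ch: "\<forall>q. chain s' (h + int i) (arrs s' aHEAD (q * NR + slot)) (?F q i)"
      using I by (auto simp: I_def)
    have vs: "vars s' vT1 = h + int (length zs)" "vars s' vA = a" "vars s' vK = K"
      "vars s' vL = L" "vars s' vNR = NR" "vars s' vRUN = slot" using keep_var[OF kp] v by auto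
    have il: "i < length zs" using e i vs by (simp split: if_splits)
    define u where "u = fst (zs ! i)"
    define q where "q = key x K L a 0 u"
    have arr: "arrs s' aTOT (h + int i) = tot x u" "arrs s' aCOD (h + int i) = cod d n u"
      using keep_arr[OF kp] h il by (auto simp: seg_def u_def)
    have qe: "a * tot x u mod (K * L) div L = q" by (simp add: q_def key_def)
    have qb: "0 \<le> q" "q < K" using key_bounds[OF KL(1,2)] by (auto simp: q_def)
    have "q * NR + slot < (q + 1) * NR" using KL by (simp add: algebra_simps)
    also have "\<dots> \<le> K * NR" using qb KL by (intro mult_right_mono) auto
    finally have qH: "\<bar>q * NR + slot\<bar> \<le> H" using KL qb by simp
    have F: "?F q' (Suc i) = (if q' = q then u # ?F q' i else ?F q' i)" for q'
      using il by (auto simp: take_Suc_conv_app_nth u_def q_def)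
    let ?h = "arrs s' aHEAD (q * NR + slot)"
    let ?s = "set_var vI (h + int i + 1) (set_arr aHEAD (q * NR + slot) (h + int i + 1)
       (set_arr aNEXT (h + int i) ?h (set_var vQ (q * NR + slot) s')))"
    have fin: "I (Suc (Suc (Suc (Suc (Suc (Suc (Suc (Suc (Suc t'))))))))) ?s" unfolding I_def
    proof (intro exI[of _ "Suc i"] conjI allI impI)
      show "Suc i \<le> length zs" using il by simp
      show "vars ?s vI = h + int (Suc i)" by simp
      show "Suc (Suc (Suc (Suc (Suc (Suc (Suc (Suc (Suc t')))))))) \<le> t + Suc i * 12" using i by simp
      show "keep {vI, vQ} {aNEXT, aHEAD} s ?s" using kp by (auto simp: keep_def fun_eq_iff)
    next
      fix j assume "j mod NR \<noteq> slot"
      then show "arrs ?s aHEAD j = arrs s aHEAD j" using oth KL by auto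
    next
      fix q'
      have old: "chain ?s (h + int i) (arrs s' aHEAD (q' * NR + slot)) (?F q' i)"
        using ch by (subst chain_cong[symmetric, of _ ?s s']) auto
      show "chain ?s (h + int (Suc i)) (arrs ?s aHEAD (q' * NR + slot)) (?F q' (Suc i))"
      proof (cases "q' = q")
        case True
        then show ?thesis using old h arr by (simp add: F)
      next
        case False
        then have "arrs ?s aHEAD (q' * NR + slot) = arrs s' aHEAD (q' * NR + slot)"
          using KL by (simp add: slot_eq)
        then show ?thesis using False chain_mono[OF old] by (simp add: F)
      qed
    qed
    have M: "M ?s < M s'" using il i by (simp add: M_def)
    show "wp w H (Assign vQ (Bin Div (Bin Mod (Var vA \<otimes> Elem aTOT (Var vI)) (Var vK \<otimes> Var vL)) (Var vL)
         \<otimes> Var vNR \<oplus> Var vRUN);;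
      Store aNEXT (Var vI) (Elem aHEAD (Var vQ));;
      Store aHEAD (Var vQ) (Var vI \<oplus> Const 1);;
      Assign vI (Var vI \<oplus> Const 1))
      (\<lambda>t'' s''. I (Suc t'') s'' \<and> M s'' < M s') (Suc t') s'"
      apply (rule wp_bounded)
      apply (rule wp_Seq, rule wp_Assign, simp)
       apply (use qH in \<open>simp add: vs arr i qe\<close>)
      apply (rule wp_Seq, rule wp_Store, simp, simp)
       apply (simp add: bounded_state_def)
      apply (rule wp_Seq, rule wp_Store, simp, simp)
       apply (use h il in \<open>simp add: i\<close>)
      apply (rule wp_Assign, simp)
       apply (use h il in \<open>simp add: i\<close>)
      apply (use fin M in \<open>simp add: vs arr i qe del: chain.simps\<close>)
      done
  next
    fix t' s' assume I: "I t' s'" and e: "evl s' (Bin Less (Var vI) (Var vT1)) = 0"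
    obtain i where i: "i \<le> length zs" "vars s' vI = h + int i" "t' \<le> t + i * 12"
      and kp: "keep {vI, vQ} {aNEXT, aHEAD} s s'"
      and oth: "\<forall>j. j mod NR \<noteq> slot \<longrightarrow> arrs s' aHEAD j = arrs s aHEAD j"
      and ch: "\<forall>q. chain s' (h + int i) (arrs s' aHEAD (q * NR + slot)) (?F q i)"
      using I by (auto simp: I_def)
    have "vars s' vT1 = h + int (length zs)" using keep_var[OF kp] v by auto
    then have "i = length zs" using e i by (simp split: if_splits)
    then show "Suc t' \<le> t + length zs * 12 + 1 \<and> keep {vI, vQ} {aNEXT, aHEAD} s s' \<and>
      (\<forall>j. j mod NR \<noteq> slot \<longrightarrow> arrs s' aHEAD j = arrs s aHEAD j) \<and>
      (\<forall>q. chain s' (h + int (length zs)) (arrs s' aHEAD (q * NR + slot))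
         (rev (filter (\<lambda>u. key x K L a 0 u = q) (map fst zs))))"
      using i kp oth ch by simp
  qed
qed

section \<open>The table of sums\<close>

definition good :: "int \<Rightarrow> bool" where
  "good z \<longleftrightarrow> (\<exists>g. small d g \<and> tot x g = 0 \<and> (\<exists>p<n. g p \<noteq> 0) \<and> z = cod d n g)"

text \<open>The property that turns the difference of two colliding candidates into a vector over
  {-d..d}. Sum 0 is exempt, because there a nonzero candidate is itself a solution and no difference
  is formed.\<close>

definition compat :: "vec set \<Rightarrow> bool" where
  "compat U \<longleftrightarrow> (\<forall>y \<in> U. small d y) \<and>
     (\<forall>y \<in> U. \<forall>z \<in> U. tot x y = tot x z \<longrightarrow> tot x y \<noteq> 0 \<longrightarrow> small d (\<lambda>p. y p - z p))"

lemma goodI: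
  assumes "small d g" "tot x g = 0" "cod d n g \<noteq> 0"
  shows "good (cod d n g)"
proof -
  have "\<exists>p<n. g p \<noteq> 0"
  proof (rule ccontr)
    assume "\<not> ?thesis"
    then have "cod d n g = 0" by (simp add: cod_def)
    with assms show False by simp
  qed
  then show ?thesis using assms unfolding good_def by blast
qed

lemma good_le_H: "good z \<Longrightarrow> \<bar>z\<bar> \<le> H"
  using cod_le_H by (auto simp: good_def)

text \<open>
  An empty cell contains \<open>0\<close>, which is also the code of the zero vector. The cell of total \<open>0\<close> is
  thus preloaded with the zero vector, and no other total is that of the zero vector.
\<close>

definition table :: "int \<Rightarrow> int \<Rightarrow> state \<Rightarrow> vec set \<Rightarrow> bool" where
  "table NR slot s P \<longleftrightarrow>
     (\<forall>y \<in> P. arrs s aTAB (tot x y * NR + slot) = cod d n y) \<and>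
     (\<forall>t. arrs s aTAB (t * NR + slot) \<noteq> 0 \<longrightarrow>
        t \<noteq> 0 \<and> (\<exists>y \<in> P. tot x y = t \<and> cod d n y = arrs s aTAB (t * NR + slot)))"

text \<open>Either the table describes exactly the candidates counted so far, cut off at the limit,
  or a solution is known and the counter has been raised to the limit. In the second case nothing is
  claimed about the table.\<close>

definition status :: "int \<Rightarrow> int \<Rightarrow> nat \<Rightarrow> vec list \<Rightarrow> state \<Rightarrow> bool" where
  "status NR slot lm full s \<longleftrightarrow>
     (vars s vCNT = int (min lm (length full)) \<and> table NR slot s (set (take lm full))) \<or>
     (vars s vCNT = int lm \<and> vars s vFLAG \<noteq> 0)"

abbreviation (input) "walk_vars \<equiv> {vCNT, vTOT, vZ, vY, vOUT, vFLAG, vPTR}"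

text \<open>Time is charged to the counter: every round takes at most 24 steps and raises
  \<open>vCNT\<close> by at least 1. All walks of a run together thus cost 24 \<open>lm\<close>
  steps plus a constant per walk, however the candidates are spread over the buckets.\<close>

lemma wp_walk_loop:
  assumes v: "vars s vLIM = int lm" "vars s vNR = NR" "vars s vRUN = slot" "vars s vI = i"
      "arrs s aTOT i = tot x v" "arrs s aCOD i = cod d n v"
    and slot: "0 \<le> slot" "slot < NR" and lm: "int lm \<le> H"
    and ch: "chain s k (vars s vPTR) us"
    and U: "compat U" "set full \<subseteq> U" "add v ` set us \<subseteq> U"
    and st: "status NR slot lm full s" "vars s vFLAG \<noteq> 0 \<longrightarrow> good (vars s vOUT)"
  shows "wp w H walk_loop (\<lambda>t' s'. keep walk_vars {aTAB} s s' \<and>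
      int t' \<le> int t + 24 * (vars s' vCNT - vars s vCNT) + 1 \<and>
      vars s vCNT \<le> vars s' vCNT \<and>
      (\<forall>j. j mod NR \<noteq> slot \<longrightarrow> arrs s' aTAB j = arrs s aTAB j) \<and>
      (vars s vFLAG \<noteq> 0 \<longrightarrow> vars s' vFLAG \<noteq> 0) \<and>
      status NR slot lm (full @ map (add v) us) s' \<and>
      (vars s' vFLAG \<noteq> 0 \<longrightarrow> good (vars s' vOUT))) t s"
proof -
  let ?cond = "Bin Less (Const 0) (Var vPTR) \<otimes> Bin Less (Var vCNT) (Var vLIM)"
  define J where "J = (\<lambda>t' s'. keep walk_vars {aTAB} s s' \<and>
      int t' \<le> int t + 24 * (vars s' vCNT - vars s vCNT) \<and>
      vars s vCNT \<le> vars s' vCNT \<and>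
      (\<forall>j. j mod NR \<noteq> slot \<longrightarrow> arrs s' aTAB j = arrs s aTAB j) \<and>
      (vars s vFLAG \<noteq> 0 \<longrightarrow> vars s' vFLAG \<noteq> 0) \<and>
      (vars s' vFLAG \<noteq> 0 \<longrightarrow> good (vars s' vOUT)))"
  define I where "I = (\<lambda>t' s'. J t' s' \<and> (\<exists>dn rest k. us = dn @ rest \<and>
      chain s' k (vars s' vPTR) rest \<and> status NR slot lm (full @ map (add v) dn) s'))"
  define M where "M = (\<lambda>s :: state. nat (int lm - vars s vCNT))"
  show ?thesis unfolding walk_loop_def
  proof (rule wp_While[where I = I and m = M])
    show "exp_ok H ?cond" by simp
    have "J t s" using st by (simp add: J_def keep_refl)
    moreover have "us = [] @ us" "status NR slot lm (full @ map (add v) []) s" using st by auto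
    ultimately show "I t s" unfolding I_def using ch by blast
  next
    fix t' s' assume I: "I t' s'" and e: "evl s' ?cond \<noteq> 0"
    then have J: "J t' s'" by (simp add: I_def)
    obtain dn rest0 k where us0: "us = dn @ rest0"
      and ch0: "chain s' k (vars s' vPTR) rest0" and st': "status NR slot lm (full @ map (add v) dn) s'"
      using I by (auto simp: I_def)
    have kp: "keep walk_vars {aTAB} s s'" using J by (simp add: J_def)
    have vs: "vars s' vLIM = int lm" "vars s' vNR = NR" "vars s' vRUN = slot" "vars s' vI = i"
      "arrs s' aTOT i = tot x v" "arrs s' aCOD i = cod d n v"
      using keep_var[OF kp] keep_arr[OF kp] v by auto
    define c where "c = vars s' vCNT"
    define p where "p = vars s' vPTR"
    have cp: "0 < p" "c < int lm" using e vs by (auto simp: c_def p_def split: if_splits)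
    then obtain u rest where rest0: "rest0 = u # rest" using ch0 by (cases rest0) (auto simp: p_def)
    have arr: "arrs s' aTOT (p - 1) = tot x u" "arrs s' aCOD (p - 1) = cod d n u"
      and chr: "chain s' (p - 1) (arrs s' aNEXT (p - 1)) rest"
      using ch0 rest0 by (auto simp: p_def)
    define y where "y = add v u"
    let ?full = "full @ map (add v) dn"
    have ty: "tot x u + tot x v = tot x y" and cy: "cod d n u + cod d n v = cod d n y"
      by (auto simp: y_def tot_add cod_add)
    have yU: "y \<in> U" and fU: "set ?full \<subseteq> U" using U us0 rest0 by (auto simp: y_def)
    have ysm: "small d y" using yU U(1) by (auto simp: compat_def)
    have yH: "\<bar>tot x y\<bar> \<le> H" "\<bar>cod d n y\<bar> \<le> H" using tot_le_H cod_le_H ysm by auto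
    have c0: "c = int (min lm (length ?full))" and tab: "table NR slot s' (set (take lm ?full))"
      using st' cp by (auto simp: status_def c_def)
    have lenf: "length ?full < lm" and cl: "c = int (length ?full)" using c0 cp by auto
    have tab': "table NR slot s' (set ?full)" using tab lenf by simp
    define Y where "Y = arrs s' aTAB (tot x y * NR + slot)"
    have ptrH: "\<bar>arrs s' aNEXT (p - 1)\<bar> \<le> H" if "bounded_state H s'" using that by (simp add: bounded_state_def)
    have us': "us = (dn @ [u]) @ rest" using us0 rest0 by simp
    have J': "int t' \<le> int t + 24 * (c - vars s vCNT)" "vars s vCNT \<le> c"
      "\<forall>j. j mod NR \<noteq> slot \<longrightarrow> arrs s' aTAB j = arrs s aTAB j"
      "vars s vFLAG \<noteq> 0 \<longrightarrow> vars s' vFLAG \<noteq> 0" "vars s' vFLAG \<noteq> 0 \<longrightarrow> good (vars s' vOUT)"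
      using J by (auto simp: J_def c_def)
    have found: "good (cod d n y - Y)" if "cod d n y \<noteq> Y" "tot x y = 0 \<or> Y \<noteq> 0"
    proof (cases "Y = 0")
      case True
      then show ?thesis using that goodI[of y] ysm by simp
    next
      case False
      then obtain z where z: "z \<in> set ?full" "tot x z = tot x y" "cod d n z = Y" "tot x y \<noteq> 0"
        using tab' unfolding table_def Y_def by blast
      have "small d (\<lambda>p. y p - z p)" using U(1) yU z fU unfolding compat_def by fastforce
      from goodI[OF this] show ?thesis using z that by (simp add: tot_diff cod_diff)
    qed
    let ?t = "Suc (Suc (Suc (Suc (Suc (Suc (Suc (Suc (Suc (Suc t')))))))))"
    let ?s0 = "set_var vY Y (set_var vZ (cod d n y) (set_var vTOT (tot x y) (set_var vCNT (c + 1) s')))"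
    let ?s1 = "set_var vPTR (arrs s' aNEXT (p - 1)) (set_var vCNT (int lm) (set_var vFLAG 1
       (set_var vOUT (cod d n y - Y) ?s0)))"
    let ?s2 = "set_var vPTR (arrs s' aNEXT (p - 1)) (set_arr aTAB (tot x y * NR + slot) (cod d n y) ?s0)"
    have fin1: "I t1 ?s1" if "cod d n y \<noteq> Y" "tot x y = 0 \<or> Y \<noteq> 0" "t1 \<le> t' + 24" for t1
      unfolding I_def
    proof
      show "J t1 ?s1" unfolding J_def
      proof (intro conjI)
        show "keep walk_vars {aTAB} s ?s1" using kp by (auto simp: keep_def)
        show "int t1 \<le> int t + 24 * (vars ?s1 vCNT - vars s vCNT)" using J' that(3) cp by simp
      qed (use J' cp found that in auto)
      have "chain ?s1 (p - 1) (vars ?s1 vPTR) rest"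
        using chr by (subst chain_cong[symmetric, of _ ?s1 s']) auto
      moreover have "status NR slot lm (full @ map (add v) (dn @ [u])) ?s1"
        by (simp add: status_def)
      ultimately show "\<exists>dn rest k. us = dn @ rest \<and> chain ?s1 k (vars ?s1 vPTR) rest \<and>
        status NR slot lm (full @ map (add v) dn) ?s1" using us' by blast
    qed
    have fin2: "I t1 ?s2" if "\<not> (cod d n y \<noteq> Y \<and> (tot x y = 0 \<or> Y \<noteq> 0))" "t1 \<le> t' + 24" for t1
      unfolding I_def
    proof
      show "J t1 ?s2" unfolding J_def
      proof (intro conjI)
        show "keep walk_vars {aTAB} s ?s2" using kp by (auto simp: keep_def fun_eq_iff)
        show "int t1 \<le> int t + 24 * (vars ?s2 vCNT - vars s vCNT)" using J' that(2) cp by simp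
        show "\<forall>j. j mod NR \<noteq> slot \<longrightarrow> arrs ?s2 aTAB j = arrs s aTAB j" using J' slot by auto
      qed (use J' cp found that in auto)
      have ch2: "chain ?s2 (p - 1) (vars ?s2 vPTR) rest"
        using chr by (subst chain_cong[symmetric, of _ ?s2 s']) auto
      have cell: "arrs ?s2 aTAB (\<theta> * NR + slot) =
          (if \<theta> = tot x y then cod d n y else arrs s' aTAB (\<theta> * NR + slot))" for \<theta>
        using slot_eq[OF slot slot, of \<theta> "tot x y"] by simp
      have "table NR slot ?s2 (set ?full \<union> {y})"
        unfolding table_def cell
      proof (intro conjI ballI allI impI)
        fix z assume z: "z \<in> set ?full \<union> {y}"
        show "(if tot x z = tot x y then cod d n y else arrs s' aTAB (tot x z * NR + slot)) = cod d n z"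
        proof (cases "z = y")
          case False
          then have zc: "arrs s' aTAB (tot x z * NR + slot) = cod d n z"
            using z tab' by (auto simp: table_def)
          show ?thesis
          proof (cases "tot x z = tot x y")
            case True
            then have "Y = cod d n z" using zc by (simp add: Y_def)
            \<comment> \<open>The write could lose \<open>z\<close> only if its code were 0 and
              hence looked like an empty cell. But then \<open>z\<close> vanishes on all positions
              and has sum 0, unlike \<open>y\<close>.\<close>
            moreover have "cod d n z = 0" if "cod d n z \<noteq> cod d n y" "tot x y \<noteq> 0" 
              using \<open>Y = cod d n z\<close> that \<open>\<not> (cod d n y \<noteq> Y \<and> (tot x y = 0 \<or> Y \<noteq> 0))\<close> by auto
            moreover have "tot x z = 0" if "cod d n z = 0"
            proof -
              have zs: "small d z" using z fU yU U(1) by (auto simp: compat_def)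
              show ?thesis
                using cod_eq_0[OF zs _ that] d_pos by (simp add: tot_def)
            qed
            ultimately show ?thesis
              using True \<open>\<not> (cod d n y \<noteq> Y \<and> (tot x y = 0 \<or> Y \<noteq> 0))\<close> by auto
          qed (use zc in simp)
        qed simp
      next
        fix \<theta> assume nz: "(if \<theta> = tot x y then cod d n y else arrs s' aTAB (\<theta> * NR + slot)) \<noteq> 0"
        \<comment> \<open>The cell of sum 0 never holds a nonzero code, so a candidate of sum 0 with
          nonzero code would have been reported as a solution.\<close>
        have cy0: "cod d n y \<noteq> 0 \<Longrightarrow> tot x y \<noteq> 0"
          using that tab' unfolding table_def Y_def by metis
        show "\<theta> \<noteq> 0" using nz cy0 tab' unfolding table_def by (metis)
        show "\<exists>z\<in>set ?full \<union> {y}. tot x z = \<theta> \<and> cod d n z =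
          (if \<theta> = tot x y then cod d n y else arrs s' aTAB (\<theta> * NR + slot))"
        proof (cases "\<theta> = tot x y")
          case False
          then show ?thesis using nz tab' unfolding table_def by (metis UnCI)
        qed auto
      qed
      moreover have "take lm (full @ map (add v) (dn @ [u])) = full @ map (add v) (dn @ [u])"
        using lenf by simp
      moreover have "set (full @ map (add v) (dn @ [u])) = set ?full \<union> {y}" by (auto simp: y_def)
      ultimately have "status NR slot lm (full @ map (add v) (dn @ [u])) ?s2"
        using lenf cl unfolding status_def by (auto simp: y_def)
      then show "\<exists>dn rest k. us = dn @ rest \<and> chain ?s2 k (vars ?s2 vPTR) rest \<and>
        status NR slot lm (full @ map (add v) dn) ?s2" using us' ch2 by blast
    qed
    have M1: "M ?s1 < M s'" "M ?s2 < M s'" using cp by (auto simp: M_def c_def)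
    have YH: "\<bar>Y\<bar> \<le> H" if "bounded_state H s'" using that by (simp add: bounded_state_def Y_def)
    have gH: "\<bar>cod d n y - Y\<bar> \<le> H" if "cod d n y \<noteq> Y" "tot x y = 0 \<or> Y \<noteq> 0"
      using found good_le_H that by blast
    have ob: "of_bool a + (1 - of_bool b) = (0 :: int) \<longleftrightarrow> \<not> a \<and> b" for a b by simp
    have cH: "\<bar>c + 1\<bar> \<le> H" using cp cl lm by simp
    show "wp w H (Assign vCNT (Var vCNT \<oplus> Const 1);;
      Assign vTOT (Elem aTOT (Var vPTR \<ominus> Const 1) \<oplus> Elem aTOT (Var vI));;
      Assign vZ (Elem aCOD (Var vPTR \<ominus> Const 1) \<oplus> Elem aCOD (Var vI));;
      Assign vY (Elem aTAB (Var vTOT \<otimes> Var vNR \<oplus> Var vRUN));;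
      Cond ((Const 1 \<ominus> Bin Eq (Var vZ) (Var vY)) \<otimes>
            (Bin Eq (Var vTOT) (Const 0) \<oplus> (Const 1 \<ominus> Bin Eq (Var vY) (Const 0))))
        (Assign vOUT (Var vZ \<ominus> Var vY);;
         Assign vFLAG (Const 1);;
         Assign vCNT (Var vLIM))
        (Store aTAB (Var vTOT \<otimes> Var vNR \<oplus> Var vRUN) (Var vZ));;
      Assign vPTR (Elem aNEXT (Var vPTR \<ominus> Const 1)))
      (\<lambda>t'' s''. I (Suc t'') s'' \<and> M s'' < M s') (Suc t') s'"
      apply (rule wp_bounded)
      apply (rule wp_Seq, rule wp_Assign, simp)
       apply (use cH in \<open>simp add: c_def\<close>)
      apply (rule wp_Seq, rule wp_Assign, simp)
       apply (use yH in \<open>simp add: p_def[symmetric] vs arr ty\<close>)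
      apply (rule wp_Seq, rule wp_Assign, simp)
       apply (use yH in \<open>simp add: p_def[symmetric] vs arr cy\<close>)
      apply (rule wp_Seq, rule wp_Assign, simp)
       apply (use YH in \<open>simp add: p_def[symmetric] vs arr ty Y_def\<close>)
      apply (rule wp_Seq, rule wp_Cond, simp)
       apply (rule wp_Seq, rule wp_Assign, simp)
        apply (use gH in \<open>auto simp: p_def[symmetric] vs arr ty cy ob Y_def[symmetric]\<close>)[1]
       apply (rule wp_Seq, rule wp_Assign, simp, simp)
       apply (rule wp_Assign, simp)
        apply (use lm in \<open>simp add: vs\<close>)
       apply (rule wp_Assign, simp)
        apply (use ptrH in \<open>simp add: p_def[symmetric]\<close>)
       apply (use fin1 M1 in \<open>auto simp: p_def[symmetric] c_def[symmetric] vs arr ty cy ob Y_def[symmetric]\<close>)[1]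
      apply (rule wp_Store, simp, simp)
       apply (use yH in \<open>simp add: p_def[symmetric] vs arr cy\<close>)
      apply (rule wp_Assign, simp)
       apply (use ptrH in \<open>simp add: p_def[symmetric]\<close>)
      apply (use fin2 M1 in \<open>auto simp: p_def[symmetric] c_def[symmetric] vs arr ty cy ob Y_def[symmetric]\<close>)[1]
      done
  next
    fix t' s' assume I: "I t' s'" and e: "evl s' ?cond = 0"
    have J: "J t' s'" using I by (simp add: I_def)
    obtain dn rest k where us: "us = dn @ rest"
      and ch': "chain s' k (vars s' vPTR) rest" and st': "status NR slot lm (full @ map (add v) dn) s'"
      using I by (auto simp: I_def)
    have "vars s' vLIM = int lm" using keep_var[of walk_vars "{aTAB}" s s'] J v by (simp add: J_def)
    then have "vars s' vPTR \<le> 0 \<or> int lm \<le> vars s' vCNT" using e by (auto split: if_splits)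
    then have "status NR slot lm (full @ map (add v) us) s'"
    proof
      assume "vars s' vPTR \<le> 0"
      then have "rest = []" using ch' by (cases rest) auto
      then show ?thesis using st' us by simp
    next
      \<comment> \<open>The walk was cut off by the limit: the first \<open>lm\<close> candidates
        have been processed, and appending the remaining ones does not change this prefix.\<close>
      assume "int lm \<le> vars s' vCNT"
      moreover have "status NR slot lm (full @ map (add v) us) s'"
        if "vars s' vCNT = int (min lm (length (full @ map (add v) dn)))"
          "table NR slot s' (set (take lm (full @ map (add v) dn)))"
      proof -
        have "lm \<le> length (full @ map (add v) dn)"
          using that(1) \<open>int lm \<le> vars s' vCNT\<close> by linarith
        moreover from this have "take lm (full @ map (add v) us) = take lm (full @ map (add v) dn)"
          by (simp add: us)
        moreover have "min lm (length (full @ map (add v) us)) = min lm (length (full @ map (add v) dn))"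
          using calculation(1) by (simp add: us)
        ultimately show ?thesis using that unfolding status_def by presburger
      qed
      ultimately show ?thesis using st' unfolding status_def by blast
    qed
    then show "keep walk_vars {aTAB} s s' \<and>
      int (Suc t') \<le> int t + 24 * (vars s' vCNT - vars s vCNT) + 1 \<and>
      vars s vCNT \<le> vars s' vCNT \<and>
      (\<forall>j. j mod NR \<noteq> slot \<longrightarrow> arrs s' aTAB j = arrs s aTAB j) \<and>
      (vars s vFLAG \<noteq> 0 \<longrightarrow> vars s' vFLAG \<noteq> 0) \<and>
      status NR slot lm (full @ map (add v) us) s' \<and>
      (vars s' vFLAG \<noteq> 0 \<longrightarrow> good (vars s' vOUT))"
      using J by (simp add: J_def)
  qed
qed

end

section \<open>One complete run\<close>

definition engine :: "int \<Rightarrow> com" where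
  "engine d =
     (Assign vCNT (Const 0);;
      Assign vLEN (Bin Div (Var vN) (Const 2));;
      build d;;
      Assign vS1 (Var vHD);;
      Assign vT1 (Var vTL);;
      Assign vPOS (Var vPOS \<oplus> Var vLEN);;
      Assign vLEN (Var vN \<ominus> Var vLEN);;
      build d;;
      Assign vI (Var vS1);;
      insert_loop;;
      Assign vI (Var vHD);;
      scan_loop)"

abbreviation (input) "scan_vars \<equiv> {vCNT, vTOT, vZ, vY, vOUT, vFLAG, vPTR, vI, vQ}"
abbreviation (input) "engine_vars \<equiv> {vCNT, vTOT, vZ, vY, vOUT, vFLAG, vPTR, vI, vQ,
  vC, vWT, vTL, vHD, vP, vEND, vLEV, vLEN, vPOS, vS1, vT1}"
abbreviation (input) "engine_arrs \<equiv> {aTOT, aCOD, aWT, aNEXT, aHEAD, aTAB}"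

context alg
begin

lemma status_CNT: "status NR slot lm full s \<Longrightarrow> vars s vCNT \<le> int lm"
  by (auto simp: status_def)

lemma wp_scan_loop:
  assumes v: "vars s vI = h" "vars s vTL = h + int (length zs)" "vars s vA = a" "vars s vK = K"
      "vars s vL = L" "vars s vR = r" "vars s vNR = NR" "vars s vRUN = slot" "vars s vLIM = int lm"
      "vars s vCNT = 0"
    and h: "0 \<le> h" "seg s h zs" "h + int (length zs) \<le> H" "vs = map fst zs"
    and KL: "0 < K" "0 < L" "0 \<le> slot" "slot < NR" "K \<le> H" and lm: "int lm \<le> H"
    and ch: "\<And>q. chain s k (arrs s aHEAD (q * NR + slot)) (rev (filter (\<lambda>u. key x K L a 0 u = q) us))"
    and U: "compat U" "set (cands x K L a r us vs) \<subseteq> U"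
    and fresh: "\<And>t. arrs s aTAB (t * NR + slot) = 0"
    and st: "vars s vFLAG \<noteq> 0 \<longrightarrow> good (vars s vOUT)"
  shows "wp w H scan_loop (\<lambda>t' s'. keep scan_vars {aTAB} s s' \<and>
      t' \<le> t + 24 * lm + length zs * 24 + 1 \<and>
      (\<forall>j. j mod NR \<noteq> slot \<longrightarrow> arrs s' aTAB j = arrs s aTAB j) \<and>
      (vars s vFLAG \<noteq> 0 \<longrightarrow> vars s' vFLAG \<noteq> 0) \<and>
      status NR slot lm (cands x K L a r us vs) s' \<and>
      (vars s' vFLAG \<noteq> 0 \<longrightarrow> good (vars s' vOUT))) t s"
proof -
  let ?F = "\<lambda>i. cands x K L a r us (take i vs)"
  define I where "I = (\<lambda>t' s'. \<exists>i \<le> length zs. vars s' vI = h + int i \<and>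
      int t' \<le> int t + 24 * vars s' vCNT + int i * 24 \<and>
      keep scan_vars {aTAB} s s' \<and>
      (\<forall>j. j mod NR \<noteq> slot \<longrightarrow> arrs s' aTAB j = arrs s aTAB j) \<and>
      (vars s vFLAG \<noteq> 0 \<longrightarrow> vars s' vFLAG \<noteq> 0) \<and>
      status NR slot lm (?F i) s' \<and>
      (vars s' vFLAG \<noteq> 0 \<longrightarrow> good (vars s' vOUT)))"
  define M where "M = (\<lambda>s :: state. nat (h + int (length zs) - vars s vI))"
  show ?thesis unfolding scan_loop_def
  proof (rule wp_While[where I = I and m = M])
    show "exp_ok H (Bin Less (Var vI) (Var vTL))" by simp
    have "status NR slot lm [] s" using v fresh by (simp add: status_def table_def)
    then show "I t s" using v st
      by (auto simp: I_def keep_refl cands_def intro!: exI[of _ 0])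
  next
    fix t' s' assume I: "I t' s'" and e: "evl s' (Bin Less (Var vI) (Var vTL)) \<noteq> 0"
    obtain i where i: "i \<le> length zs" "vars s' vI = h + int i"
      "int t' \<le> int t + 24 * vars s' vCNT + int i * 24"
      and kp: "keep scan_vars {aTAB} s s'"
      and oth: "\<forall>j. j mod NR \<noteq> slot \<longrightarrow> arrs s' aTAB j = arrs s aTAB j"
      and fl: "vars s vFLAG \<noteq> 0 \<longrightarrow> vars s' vFLAG \<noteq> 0"
      and stt: "status NR slot lm (?F i) s'"
      and gd: "vars s' vFLAG \<noteq> 0 \<longrightarrow> good (vars s' vOUT)"
      using I by (auto simp: I_def)
    have vs': "vars s' vTL = h + int (length zs)" "vars s' vA = a" "vars s' vK = K"
      "vars s' vL = L" "vars s' vR = r" "vars s' vNR = NR" "vars s' vRUN = slot" "vars s' vLIM = int lm"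
      using keep_var[OF kp] v by auto
    have il: "i < length zs" using e i vs' by (simp split: if_splits)
    define z where "z = fst (zs ! i)"
    define q where "q = key x K L a r z"
    define B where "B = (\<lambda>q. rev (filter (\<lambda>u. key x K L a 0 u = q) us))"
    have ar: "arrs s' aTOT (h + int i) = tot x z" "arrs s' aCOD (h + int i) = cod d n z"
      using keep_arr[OF kp] h il by (auto simp: seg_def z_def)
    have hd: "arrs s' aHEAD = arrs s aHEAD" using keep_arr[OF kp] by simp
    have qe: "(a * tot x z + r) mod (K * L) div L = q" by (simp add: q_def key_def)
    have qb: "0 \<le> q" "q < K" using key_bounds[OF KL(1,2)] by (auto simp: q_def)
    have F: "?F (Suc i) = (?F i @ map (add z) (B ((0 - q) mod K))) @ map (add z) (B ((-1 - q) mod K))"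
      using il h by (simp add: cands_def cands_of_def Let_def take_Suc_conv_app_nth z_def q_def B_def)
    have "set (?F (Suc i)) \<subseteq> set (cands x K L a r us vs)"
      unfolding cands_def by (auto dest: in_set_takeD)
    then have FU: "set (?F (Suc i)) \<subseteq> U" using U by blast
    define s1 where "s1 = set_var vPTR (arrs s aHEAD ((- q) mod K * NR + slot)) (set_var vQ q s')"
    let ?t1 = "Suc (Suc (Suc (Suc (Suc t'))))"
    have chs: "chain s2 k (arrs s aHEAD (q' * NR + slot)) (B q')"
      if "\<And>a. a \<noteq> aTAB \<Longrightarrow> arrs s2 a = arrs s a" for s2 q'
      using ch[of q'] unfolding B_def by (subst chain_cong[symmetric, of k s2 s]) (auto simp: that)
    have A1: "arrs s1 a' = arrs s a'" if "a' \<noteq> aTAB" for a'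
      using keep_arr[OF kp] that by (simp add: s1_def)
    have w1: "wp w H walk_loop (\<lambda>t2 s2. keep walk_vars {aTAB} s1 s2 \<and>
      int t2 \<le> int ?t1 + 24 * (vars s2 vCNT - vars s1 vCNT) + 1 \<and>
      vars s1 vCNT \<le> vars s2 vCNT \<and>
      (\<forall>j. j mod NR \<noteq> slot \<longrightarrow> arrs s2 aTAB j = arrs s1 aTAB j) \<and>
      (vars s1 vFLAG \<noteq> 0 \<longrightarrow> vars s2 vFLAG \<noteq> 0) \<and>
      status NR slot lm (?F i @ map (add z) (B ((0 - q) mod K))) s2 \<and>
      (vars s2 vFLAG \<noteq> 0 \<longrightarrow> good (vars s2 vOUT))) ?t1 s1"
    proof (rule wp_walk_loop[OF _ _ _ _ _ _ KL(3,4) lm _ U(1)])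
      show "chain s1 k (vars s1 vPTR) (B ((0 - q) mod K))"
        using chs[of s1 "(0 - q) mod K"] A1 by (simp add: s1_def)
      show "status NR slot lm (?F i) s1" using stt by (simp add: s1_def status_def table_def)
      show "set (?F i) \<subseteq> U" "add z ` set (B ((0 - q) mod K)) \<subseteq> U" using FU unfolding F by auto
    qed (use vs' i ar gd in \<open>auto simp: s1_def\<close>)
    show "wp w H (Assign vQ (Bin Div (Bin Mod (Var vA \<otimes> Elem aTOT (Var vI) \<oplus> Var vR) (Var vK \<otimes> Var vL)) (Var vL));;
      Assign vPTR (Elem aHEAD (Bin Mod (Const 0 \<ominus> Var vQ) (Var vK) \<otimes> Var vNR \<oplus> Var vRUN));;
      walk_loop;;
      Assign vPTR (Elem aHEAD (Bin Mod (Const (-1) \<ominus> Var vQ) (Var vK) \<otimes> Var vNR \<oplus> Var vRUN));;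
      walk_loop;;
      Assign vI (Var vI \<oplus> Const 1))
      (\<lambda>t'' s''. I (Suc t'') s'' \<and> M s'' < M s') (Suc t') s'"
      apply (rule wp_bounded)
      apply (rule wp_Seq, rule wp_Assign, simp)
       apply (use qb KL in \<open>simp add: vs' ar i qe\<close>)
      apply (rule wp_Seq, rule wp_Assign, simp)
       apply (simp add: bounded_state_def)
      apply (rule wp_Seq)
      apply (simp add: vs' ar i qe hd s1_def[symmetric])
      apply (rule wp_mono[OF w1], elim conjE)
      subgoal premises pr1 for t2 s2
      proof -
        note k2 = pr1(2)
        have kp2: "keep scan_vars {aTAB} s s2"
          using keep_mono[OF k2, of scan_vars "{aTAB}"] kp
          by (auto simp: keep_def s1_def)
        have vs2: "vars s2 vTL = h + int (length zs)" "vars s2 vA = a" "vars s2 vK = K"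
          "vars s2 vL = L" "vars s2 vR = r" "vars s2 vNR = NR" "vars s2 vRUN = slot" "vars s2 vLIM = int lm"
          using keep_var[OF kp2] v by auto
        have vs2': "vars s2 vI = h + int i" "vars s2 vQ = q" using keep_var[OF k2] i by (auto simp: s1_def)
        have hd2: "arrs s2 aHEAD = arrs s aHEAD" using keep_arr[OF kp2] by simp
        have ar2: "arrs s2 aTOT (h + int i) = tot x z" "arrs s2 aCOD (h + int i) = cod d n z"
          using keep_arr[OF kp2] h il by (auto simp: seg_def z_def)
        define s3 where "s3 = set_var vPTR (arrs s aHEAD ((-1 - q) mod K * NR + slot)) s2"
        let ?t3 = "Suc (Suc (Suc t2))"
        have A3: "arrs s3 a' = arrs s a'" if "a' \<noteq> aTAB" for a'
          using keep_arr[OF kp2] that by (simp add: s3_def)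
        have w3: "wp w H walk_loop (\<lambda>t4 s4. keep walk_vars {aTAB} s3 s4 \<and>
          int t4 \<le> int ?t3 + 24 * (vars s4 vCNT - vars s3 vCNT) + 1 \<and>
          vars s3 vCNT \<le> vars s4 vCNT \<and>
          (\<forall>j. j mod NR \<noteq> slot \<longrightarrow> arrs s4 aTAB j = arrs s3 aTAB j) \<and>
          (vars s3 vFLAG \<noteq> 0 \<longrightarrow> vars s4 vFLAG \<noteq> 0) \<and>
          status NR slot lm ((?F i @ map (add z) (B ((0 - q) mod K))) @
            map (add z) (B ((-1 - q) mod K))) s4 \<and>
          (vars s4 vFLAG \<noteq> 0 \<longrightarrow> good (vars s4 vOUT))) ?t3 s3"
        proof (rule wp_walk_loop[OF _ _ _ _ _ _ KL(3,4) lm _ U(1)])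
          show "chain s3 k (vars s3 vPTR) (B ((-1 - q) mod K))"
            using chs[of s3 "(-1 - q) mod K"] A3 by (simp add: s3_def)
          show "status NR slot lm (?F i @ map (add z) (B ((0 - q) mod K))) s3"
            using pr1(7) by (simp add: s3_def status_def table_def)
          show "set (?F i @ map (add z) (B ((0 - q) mod K))) \<subseteq> U"
            "add z ` set (B ((-1 - q) mod K)) \<subseteq> U" using FU unfolding F by auto
        qed (use vs2 vs2' ar2 pr1 in \<open>auto simp: s3_def\<close>)
        show ?thesis
          apply (rule wp_bounded)
          apply (rule wp_Seq, rule wp_Assign, simp)
           apply (simp add: bounded_state_def)
          apply (rule wp_Seq)
          apply (simp add: vs2 vs2' hd2 s3_def[symmetric])
          apply (rule wp_mono[OF w3], elim conjE)
          subgoal premises pr3 for t4 s4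
          proof (rule wp_Assign)
            note k4 = pr3(2)
            have kp4: "keep scan_vars {aTAB} s s4"
              using keep_mono[OF k4, of scan_vars "{aTAB}"] kp2
              by (auto simp: keep_def s3_def)
            have i4: "vars s4 vI = h + int i" using keep_var[OF k4] vs2' by (auto simp: s3_def)
            show "exp_ok H (Var vI \<oplus> Const 1)" by simp
            show "\<bar>evl s4 (Var vI \<oplus> Const 1)\<bar> \<le> H" using h il by (simp add: i4)
            let ?s = "set_var vI (evl s4 (Var vI \<oplus> Const 1)) s4"
            have "I (Suc (Suc (Suc t4))) ?s" unfolding I_def
            proof (intro exI[of _ "Suc i"] conjI)
              show "Suc i \<le> length zs" using il by simp
              show "vars ?s vI = h + int (Suc i)" by (simp add: i4)
              show "int (Suc (Suc (Suc t4))) \<le> int t + 24 * vars ?s vCNT + int (Suc i) * 24"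
                using i(3) pr1(3) pr3(3) by (simp add: s1_def s3_def)
              show "keep scan_vars {aTAB} s ?s" using kp4 by (simp add: keep_def)
              show "\<forall>j. j mod NR \<noteq> slot \<longrightarrow> arrs ?s aTAB j = arrs s aTAB j"
                using oth pr1(5) pr3(5) by (simp add: s1_def s3_def)
              show "vars s vFLAG \<noteq> 0 \<longrightarrow> vars ?s vFLAG \<noteq> 0"
                using fl pr1(6) pr3(6) by (simp add: s1_def s3_def)
              show "status NR slot lm (?F (Suc i)) ?s"
                unfolding F using pr3(7) by (simp add: status_def table_def)
              show "vars ?s vFLAG \<noteq> 0 \<longrightarrow> good (vars ?s vOUT)" using pr3(8) by simp
            qed
            then show "I (Suc (Suc (Suc t4))) ?s \<and> M ?s < M s'"
              using il i i4 by (simp add: M_def)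
          qed
          done
      qed
      done
  next
    fix t' s' assume I: "I t' s'" and e: "evl s' (Bin Less (Var vI) (Var vTL)) = 0"
    obtain i where i: "i \<le> length zs" "vars s' vI = h + int i"
      "int t' \<le> int t + 24 * vars s' vCNT + int i * 24"
      and kp: "keep scan_vars {aTAB} s s'"
      and oth: "\<forall>j. j mod NR \<noteq> slot \<longrightarrow> arrs s' aTAB j = arrs s aTAB j"
      and fl: "vars s vFLAG \<noteq> 0 \<longrightarrow> vars s' vFLAG \<noteq> 0"
      and stt: "status NR slot lm (?F i) s'"
      and gd: "vars s' vFLAG \<noteq> 0 \<longrightarrow> good (vars s' vOUT)"
      using I by (auto simp: I_def)
    have "vars s' vTL = h + int (length zs)" using keep_var[OF kp] v by auto
    then have il: "i = length zs" using e i by (simp split: if_splits)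
    have "int (Suc t') \<le> int (t + 24 * lm + length zs * 24 + 1)"
      using i(3) status_CNT[OF stt] il by simp
    then have "Suc t' \<le> t + 24 * lm + length zs * 24 + 1" by linarith
    then show "keep scan_vars {aTAB} s s' \<and> Suc t' \<le> t + 24 * lm + length zs * 24 + 1 \<and>
      (\<forall>j. j mod NR \<noteq> slot \<longrightarrow> arrs s' aTAB j = arrs s aTAB j) \<and>
      (vars s vFLAG \<noteq> 0 \<longrightarrow> vars s' vFLAG \<noteq> 0) \<and>
      status NR slot lm (cands x K L a r us vs) s' \<and>
      (vars s' vFLAG \<noteq> 0 \<longrightarrow> good (vars s' vOUT))"
      using kp oth fl stt gd il h by simp
  qed
qed

definition engine_time :: "nat \<Rightarrow> nat \<Rightarrow> nat" where
  "engine_time B lm = 2 * (n * (B * (16 * nat (2 * d + 1) + 8) + 12)) + 40 * B + 24 * lm + 80"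

lemma wp_engine:
  assumes inp: "inp s" and v: "vars s vTL = h" "vars s vPOS = int pos" "vars s vLO = lo"
      "vars s vW0 = w0" "vars s vW1 = w1" "vars s vTAU = \<tau>"
      "vars s vA = a" "vars s vK = K" "vars s vL = L" "vars s vR = r" "vars s vNR = NR"
      "vars s vRUN = slot" "vars s vLIM = int lm"
    and f: "f = (\<lambda>c. w0 + w1 * \<bar>c\<bar>)" "\<And>c. \<bar>c\<bar> \<le> d \<Longrightarrow> 0 \<le> f c \<and> f c \<le> d"
    and B: "\<And>l pos. l \<le> n - n div 2 \<Longrightarrow> length (lev n [lo..d] f \<tau> pos l) \<le> B"
    and h: "0 \<le> h" "h + 2 * (int n + 1) * int B + 2 * d + 1 \<le> H"
    and pos: "pos \<le> n" and lo: "- d \<le> lo" "lo \<le> d"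
    and KL: "0 < K" "0 < L" "0 \<le> slot" "slot < NR" "K * NR \<le> H" and lm: "int lm \<le> H"
    and us: "us = map fst (lev n [lo..d] f \<tau> pos (n div 2))"
    and vs: "vs = map fst (lev n [lo..d] f \<tau> (pos + n div 2) (n - n div 2))"
    and U: "compat U" "set (cands x K L a r us vs) \<subseteq> U"
    and fresh: "\<And>t. arrs s aTAB (t * NR + slot) = 0" "\<And>q. arrs s aHEAD (q * NR + slot) = 0"
    and st: "vars s vFLAG \<noteq> 0 \<longrightarrow> good (vars s vOUT)"
  shows "wp w H (engine d) (\<lambda>t' s'. keep engine_vars engine_arrs s s' \<and>
      t' \<le> t + engine_time B lm \<and>
      0 \<le> vars s' vTL \<and> vars s' vTL \<le> h + 2 * (int n + 1) * int B \<and>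
      (\<forall>j. j mod NR \<noteq> slot \<longrightarrow> arrs s' aTAB j = arrs s aTAB j \<and> arrs s' aHEAD j = arrs s aHEAD j) \<and>
      (vars s vFLAG \<noteq> 0 \<longrightarrow> vars s' vFLAG \<noteq> 0) \<and>
      status NR slot lm (cands x K L a r us vs) s' \<and>
      (vars s' vFLAG \<noteq> 0 \<longrightarrow> good (vars s' vOUT))) t s"
    (is "wp w H (engine d) ?Q t s")
proof -
  let ?N = "16 * nat (2 * d + 1) + 8"
  let ?l1 = "n div 2" and ?l2 = "n - n div 2"
  define zs1 where "zs1 = lev n [lo..d] f \<tau> pos ?l1"
  define zs2 where "zs2 = lev n [lo..d] f \<tau> (pos + ?l1) ?l2"
  have l12: "?l1 \<le> ?l2" by linarith
  have lens: "length zs1 \<le> B" "length zs2 \<le> B" using B l12 by (auto simp: zs1_def zs2_def)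
  have bb: "int (?l1 + 1) * int B \<le> (int n + 1) * int B" "int (?l2 + 1) * int B \<le> (int n + 1) * int B"
    by (intro mult_right_mono; simp)+
  have B0: "0 \<le> (int n + 1) * int B" by simp
  have h2: "h + 2 * ((int n + 1) * int B) + 2 * d + 1 \<le> H" using h by (simp add: algebra_simps)
  have nH: "2 * int n \<le> H" using n_le_H by simp
  have "K * 1 \<le> K * NR" using KL by (intro mult_left_mono) auto
  then have KH: "K \<le> H" using KL(5) by linarith
  have hb1: "h + int (?l1 + 1) * int B + 2 * d + 1 \<le> H" using h2 bb B0 by linarith
  define s1 where "s1 = set_var vLEN (int n div 2) (set_var vCNT 0 s)"
  have l1i: "int n div 2 = int ?l1" and l2i: "int n - int n div 2 = int ?l2"
    by (simp_all add: zdiv_int of_nat_diff)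
  let ?t1 = "Suc (Suc (Suc (Suc t)))"
  have i1: "inp s1" using inp by (simp add: inp_def s1_def)
  have N: "vars s vN = int n" using inp by (simp add: inp_def)
  have b1: "wp w H (build d) (\<lambda>t' s'. t' \<le> ?t1 + ?l1 * (B * ?N + 12) + 13 \<and>
      frame build_vars build_arrs h s1 s' \<and>
      vars s' vTL \<le> h + int (?l1 + 1) * int B \<and> h \<le> vars s' vHD \<and>
      vars s' vTL = vars s' vHD + int (length zs1) \<and>
      seg s' (vars s' vHD) zs1) ?t1 s1"
    unfolding zs1_def
    by (rule wp_build[OF i1 _ _ _ _ _ _ _ _ f _ _ hb1 lo])
      (use v h B l12 in \<open>auto simp: s1_def l1i simp del: of_nat_div\<close>)
  define Q where "Q = ?Q"
  have "wp w H (engine d) Q t s" unfolding engine_def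
    apply (rule wp_Seq, rule wp_Assign, simp, simp)
    apply (rule wp_Seq, rule wp_Assign, simp)
     apply (use nH in \<open>simp add: N\<close>)
    apply (rule wp_Seq)
    apply (simp add: N s1_def[symmetric])
    apply (rule wp_mono[OF b1], elim conjE)
    subgoal premises p1 for ta sa
    proof -
      note fr1 = p1(2)
      define h1 where "h1 = vars sa vHD"
      define h1e where "h1e = vars sa vTL"
      have h1: "h \<le> h1" "h1e = h1 + int (length zs1)" "h1e \<le> h + (int n + 1) * int B"
        using p1 bb by (auto simp: h1_def h1e_def)
      have va: "vars sa vN = int n" "vars sa vPOS = int pos" "vars sa vLEN = int n div 2"
        using frame_var[OF fr1] N v by (auto simp: s1_def)
      define s2 where "s2 = set_var vLEN (int n - int n div 2) (set_var vPOS (int pos + int n div 2)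
         (set_var vT1 h1e (set_var vS1 h1 sa)))"
      have kpa: "keep engine_vars engine_arrs s s2"
        using frame_keep[OF fr1] by (auto simp: keep_def s2_def s1_def)
      have i2: "inp s2" by (rule inp_keep[OF inp kpa]) auto
      have v2: "vars s2 vLO = lo" "vars s2 vW0 = w0" "vars s2 vW1 = w1" "vars s2 vTAU = \<tau>"
        using keep_var[OF kpa] v by auto
      have h1H: "0 \<le> h1" "h1e \<le> H" "h1 \<le> H" "0 \<le> h1e" using h1 h h2 B0 d_pos by linarith+
      have hb2: "h1e + int (?l2 + 1) * int B + 2 * d + 1 \<le> H" using h1 h2 bb B0 by linarith
      let ?t2 = "Suc (Suc (Suc (Suc (Suc (Suc (Suc (Suc (Suc ta))))))))"
      have b2: "wp w H (build d) (\<lambda>t' s'. t' \<le> ?t2 + ?l2 * (B * ?N + 12) + 13 \<and>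
          frame build_vars build_arrs h1e s2 s' \<and>
          vars s' vTL \<le> h1e + int (?l2 + 1) * int B \<and> h1e \<le> vars s' vHD \<and>
          vars s' vTL = vars s' vHD + int (length zs2) \<and>
          seg s' (vars s' vHD) zs2) ?t2 s2"
        unfolding zs2_def
        by (rule wp_build[OF i2 _ _ _ _ v2 f B _ hb2 lo])
          (use h1H in \<open>auto simp: s2_def h1e_def l1i l2i simp del: of_nat_div\<close>)
      have pH: "\<bar>int pos + int n div 2\<bar> \<le> H" "\<bar>int n - int n div 2\<bar> \<le> H"
        using pos nH by auto
      have sg1: "seg s2 h1 zs1" using p1 by (simp add: s2_def h1_def seg_def)
      show ?thesis
        apply (rule wp_Seq, rule wp_Assign, simp)
         apply (use h1H in \<open>simp add: h1_def\<close>)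
        apply (rule wp_Seq, rule wp_Assign, simp)
         apply (use h1H in \<open>simp add: h1e_def\<close>)
        apply (rule wp_Seq, rule wp_Assign, simp)
         apply (use pH in \<open>simp add: va\<close>)
        apply (rule wp_Seq, rule wp_Assign, simp)
         apply (use pH in \<open>simp add: va\<close>)
        apply (rule wp_Seq)
        apply (simp add: va h1_def[symmetric] h1e_def[symmetric] s2_def[symmetric])
        apply (rule wp_mono[OF b2], elim conjE)
        subgoal premises p2 for tb sb
        proof -
          note fr2 = p2(2)
          have kpb: "keep engine_vars engine_arrs s sb"
            by (rule keep_trans[OF kpa keep_mono[OF frame_keep[OF fr2]]]) auto
          define h3 where "h3 = vars sb vHD"
          have h3: "h1e \<le> h3" "vars sb vTL = h3 + int (length zs2)"
            "h3 + int (length zs2) \<le> h + 2 * ((int n + 1) * int B)"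
            using p2 h1 bb by (auto simp: h3_def)
          have h3H: "0 \<le> h3" "h3 + int (length zs2) \<le> H" "h3 \<le> H" using h3 h1H h2 d_pos by linarith+
          have sgb: "seg sb h1 zs1" by (rule seg_frame[OF sg1 fr2]) (simp add: h1)
          have vb: "vars sb vS1 = h1" "vars sb vT1 = h1e"
            using frame_var[OF fr2] by (auto simp: s2_def)
          have vb': "vars sb vA = a" "vars sb vK = K" "vars sb vL = L" "vars sb vR = r"
            "vars sb vNR = NR" "vars sb vRUN = slot" "vars sb vLIM = int lm"
            using keep_var[OF kpb] v by auto
          have arb: "arrs sb aTAB = arrs s aTAB" "arrs sb aHEAD = arrs s aHEAD"
            using frame_keep[OF fr2] frame_keep[OF fr1] by (auto simp: keep_def s1_def s2_def)
          have flb: "vars sb vFLAG = vars s vFLAG" "vars sb vOUT = vars s vOUT" "vars sb vCNT = 0"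
            using frame_keep[OF fr2] frame_keep[OF fr1] by (auto simp: keep_def s1_def s2_def)
          define s3 where "s3 = set_var vI h1 sb"
          let ?t3 = "Suc (Suc (Suc tb))"
          have w3: "wp w H insert_loop (\<lambda>t' s'. t' \<le> ?t3 + length zs1 * 12 + 1 \<and>
              keep {vI, vQ} {aNEXT, aHEAD} s3 s' \<and>
              (\<forall>j. j mod NR \<noteq> slot \<longrightarrow> arrs s' aHEAD j = arrs s3 aHEAD j) \<and>
              (\<forall>q. chain s' (h1 + int (length zs1)) (arrs s' aHEAD (q * NR + slot))
                 (rev (filter (\<lambda>u. key x K L a 0 u = q) (map fst zs1))))) ?t3 s3"
            by (rule wp_insert_loop[OF _ _ _ _ _ _ _ _ _ _ KL])
              (use vb vb' h1 h1H sgb arb fresh in \<open>auto simp: s3_def seg_def\<close>)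
          show ?thesis
            apply (rule wp_Seq, rule wp_Assign, simp)
             apply (use h1H in \<open>simp add: vb\<close>)
            apply (rule wp_Seq)
            apply (simp add: vb s3_def[symmetric])
            apply (rule wp_mono[OF w3], elim conjE)
            subgoal premises p3 for tc sc
            proof -
              note k3 = p3(2)
              have kpc: "keep engine_vars engine_arrs s sc"
                by (rule keep_trans[OF kpb]) (use k3 in \<open>auto simp: keep_def s3_def\<close>)
              have vc: "vars sc vHD = h3" "vars sc vTL = h3 + int (length zs2)"
                "vars sc vFLAG = vars s vFLAG" "vars sc vOUT = vars s vOUT" "vars sc vCNT = 0"
                using keep_var[OF k3] h3 flb by (auto simp: s3_def h3_def)
              have vc': "vars sc vA = a" "vars sc vK = K" "vars sc vL = L" "vars sc vR = r"
                "vars sc vNR = NR" "vars sc vRUN = slot" "vars sc vLIM = int lm"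
                using keep_var[OF kpc] v by auto
              have tabc: "arrs sc aTAB = arrs s aTAB" using keep_arr[OF k3] arb by (simp add: s3_def)
              have sgc: "seg sc h3 zs2"
                by (rule seg_keep[OF _ k3]) (use p2 in \<open>auto simp: s3_def seg_def h3_def\<close>)
              define s4 where "s4 = set_var vI h3 sc"
              let ?t4 = "Suc (Suc (Suc tc))"
              have w4: "wp w H scan_loop (\<lambda>t' s'. keep scan_vars {aTAB} s4 s' \<and>
                  t' \<le> ?t4 + 24 * lm + length zs2 * 24 + 1 \<and>
                  (\<forall>j. j mod NR \<noteq> slot \<longrightarrow> arrs s' aTAB j = arrs s4 aTAB j) \<and>
                  (vars s4 vFLAG \<noteq> 0 \<longrightarrow> vars s' vFLAG \<noteq> 0) \<and>
                  status NR slot lm (cands x K L a r us vs) s' \<and>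
                  (vars s' vFLAG \<noteq> 0 \<longrightarrow> good (vars s' vOUT))) ?t4 s4"
              proof (rule wp_scan_loop[OF _ _ _ _ _ _ _ _ _ _ _ _ _ _ KL(1-4) KH lm _ U])
                show "seg s4 h3 zs2" using sgc by (simp add: s4_def seg_def)
                show "chain s4 (h1 + int (length zs1)) (arrs s4 aHEAD (q * NR + slot))
                   (rev (filter (\<lambda>u. key x K L a 0 u = q) us))" for q
                  using p3(4) unfolding us zs1_def[symmetric]
                  by (subst chain_cong[symmetric, of _ s4 sc]) (auto simp: s4_def)
              qed (use vc vc' h3 h3H fresh st tabc vs in \<open>auto simp: s4_def zs2_def\<close>)
              show ?thesis
                apply (rule wp_Seq, rule wp_Assign, simp)
                 apply (use h3H in \<open>simp add: vc\<close>)
                apply (simp add: vc s4_def[symmetric])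
                apply (rule wp_mono[OF w4], elim conjE)
                subgoal premises p4 for te se
                  unfolding Q_def
                proof (intro conjI)
                  note k4 = p4(1)
                  show "keep engine_vars engine_arrs s se"
                    by (rule keep_trans[OF kpc]) (use k4 in \<open>auto simp: keep_def s4_def\<close>)
                  have e1: "length zs1 * 12 \<le> 12 * B" "length zs2 * 24 \<le> 24 * B" using lens by auto
                  have e2: "?l1 * (B * ?N + 12) \<le> n * (B * ?N + 12)"
                    "?l2 * (B * ?N + 12) \<le> n * (B * ?N + 12)" by (intro mult_right_mono; simp)+
                  have "te \<le> t + 2 * (n * (B * ?N + 12)) + 40 * B + 24 * lm + 80"
                    using p1(1) p2(1) p3(1) p4(2) e1 e2 by linarith
                  then show "te \<le> t + engine_time B lm" by (simp add: engine_time_def)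
                  have TLe: "vars se vTL = h3 + int (length zs2)"
                    using keep_var[OF k4] vc by (simp add: s4_def)
                  show "0 \<le> vars se vTL" using h3H by (simp add: TLe)
                  show "vars se vTL \<le> h + 2 * (int n + 1) * int B"
                    using h3(3) by (simp add: TLe algebra_simps)
                  show "\<forall>j. j mod NR \<noteq> slot \<longrightarrow> arrs se aTAB j = arrs s aTAB j \<and>
                      arrs se aHEAD j = arrs s aHEAD j"
                    using p4(3) p3(3) tabc arb keep_arr[OF k4] by (auto simp: s4_def s3_def)
                  show "vars s vFLAG \<noteq> 0 \<longrightarrow> vars se vFLAG \<noteq> 0"
                    using p4(4) vc by (simp add: s4_def)
                  show "status NR slot lm (cands x K L a r us vs) se" by (rule p4(5))
                  show "vars se vFLAG \<noteq> 0 \<longrightarrow> good (vars se vOUT)" by (rule p4(6))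
                qed
                done
            qed
            done
        qed
        done
    qed
    done
  then show ?thesis by (simp only: Q_def)
qed

end

section \<open>The runs of the search\<close>

text \<open>In a run below 2 n, \<open>vRUN\<close> div 2 is the rotation and the parity selects the
  weight |c| or d - |c|. With \<open>vA\<close> = 2, \<open>vR\<close> = 0, \<open>vL\<close> = 1
  and \<open>vK\<close> = 2 \<open>vB1\<close> the bucket is the set of vectors of sum exactly 0,
  see \<open>low_key\<close>. The last run searches a random bucket of {0..d}^n, where weights are
  switched off.\<close>

definition set_params :: "int \<Rightarrow> int \<Rightarrow> int \<Rightarrow> int \<Rightarrow> com" where
  "set_params d q A1 A2 = Cond (Bin Less (Var vRUN) (Const 2 \<otimes> Var vN))
     (Assign vLO (Const (- d));;
      Assign vA (Const 2);;
      Assign vR (Const 0);;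
      Assign vL (Const 1);;
      Assign vK (Const 2 \<otimes> Var vB1);;
      Assign vPOS (Bin Div (Var vRUN) (Const 2));;
      Cond (Bin Mod (Var vRUN) (Const 2))
        (Assign vW0 (Const 0);;
         Assign vW1 (Const 1);;
         Assign vTAU (Bin Div (Const A1 \<otimes> Var vN) (Const (2 * q)) \<oplus> Const (2 * d + 1)))
        (Assign vW0 (Const d);;
         Assign vW1 (Const (- 1));;
         Assign vTAU (Bin Div (Const A2 \<otimes> Var vN) (Const (2 * q)) \<oplus> Const (2 * d + 1))))
     (Assign vLO (Const 0);;
      Assign vA (Var vA3);;
      Assign vR (Var vR3);;
      Assign vL (Var vL3);;
      Assign vK (Var vK3);;
      Assign vPOS (Const 0);;
      Assign vW0 (Const 0);;
      Assign vW1 (Const 0);;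
      Assign vTAU (Const 0))"

definition main_loop :: "int \<Rightarrow> int \<Rightarrow> int \<Rightarrow> int \<Rightarrow> com" where
  "main_loop d q A1 A2 = While (Bin Less (Var vRUN) (Var vNR))
     (set_params d q A1 A2;;
      engine d;;
      Assign vRUN (Var vRUN \<oplus> Const 1))"

text \<open>Half of the admissible total weight A n / q, as each list covers half of the positions.
  The slack 2 d + 1 pays for the inexact rotation, for odd n and for the rounding of the
  quotient.\<close>

definition threshold :: "int \<Rightarrow> int \<Rightarrow> nat \<Rightarrow> int \<Rightarrow> int" where
  "threshold d q n A = (A * int n) div (2 * q) + (2 * d + 1)"

abbreviation (input) "param_vars \<equiv> {vLO, vA, vR, vL, vK, vPOS, vW0, vW1, vTAU}"

lemma cands_mem:
  "y \<in> set (cands x K L a r us vs) \<longleftrightarrow> (\<exists>u \<in> set us. \<exists>v \<in> set vs. y = add v u \<and>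
     (key x K L a 0 u = (0 - key x K L a r v) mod K \<or> key x K L a 0 u = (-1 - key x K L a r v) mod K))"
  by (auto simp: cands_def cands_of_def Let_def)

locale runs = alg +
  fixes q A1 A2 B1 K3 L3 a3 r3 :: int and lm B :: nat
  assumes B1: "B1 = d * (\<Sum>i<length x. \<bar>x ! i\<bar>) + 1"
    and KL3: "0 < K3" "0 < L3" "K3 * (2 * int (length x) + 1) \<le> H" "L3 \<le> H"
      "\<bar>a3\<bar> \<le> H" "\<bar>r3\<bar> \<le> H"
    and B1_H: "2 * B1 * (2 * int (length x) + 1) \<le> H"
    and lm: "int lm \<le> H"
    and cbnd: "0 < q" "2 * q \<le> H" "0 \<le> A1" "A1 \<le> H" "0 \<le> A2" "A2 \<le> H"
      "threshold d q (length x) A1 \<le> H" "threshold d q (length x) A2 \<le> H"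
    and TL_H: "(2 * int (length x) + 1) * (2 * (int (length x) + 1) * int B) + 2 * d + 1 \<le> H"
    and B_low: "\<And>l pos. l \<le> length x - length x div 2 \<Longrightarrow>
      length (lev (length x) [-d..d] (\<lambda>c. \<bar>c\<bar>) (threshold d q (length x) A1) pos l) \<le> B"
    and B_high: "\<And>l pos. l \<le> length x - length x div 2 \<Longrightarrow>
      length (lev (length x) [-d..d] (\<lambda>c. d - \<bar>c\<bar>) (threshold d q (length x) A2) pos l) \<le> B"
    and B_box: "\<And>l pos. l \<le> length x - length x div 2 \<Longrightarrow>
      length (lev (length x) [0..d] (\<lambda>c. 0) 0 pos l) \<le> B"
begin

abbreviation (input) "NR \<equiv> 2 * int n + 1"

definition lo_of :: "nat \<Rightarrow> int" where "lo_of \<rho> = (if \<rho> < 2 * n then - d else 0)"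
definition w0_of :: "nat \<Rightarrow> int" where "w0_of \<rho> = (if \<rho> < 2 * n then if odd \<rho> then 0 else d else 0)"
definition w1_of :: "nat \<Rightarrow> int" where "w1_of \<rho> = (if \<rho> < 2 * n then if odd \<rho> then 1 else - 1 else 0)"
definition tau_of :: "nat \<Rightarrow> int" where
  "tau_of \<rho> = (if \<rho> < 2 * n then threshold d q n (if odd \<rho> then A1 else A2) else 0)"
definition pos_of :: "nat \<Rightarrow> nat" where "pos_of \<rho> = (if \<rho> < 2 * n then \<rho> div 2 else 0)"
definition a_of :: "nat \<Rightarrow> int" where "a_of \<rho> = (if \<rho> < 2 * n then 2 else a3)"
definition r_of :: "nat \<Rightarrow> int" where "r_of \<rho> = (if \<rho> < 2 * n then 0 else r3)"
definition K_of :: "nat \<Rightarrow> int" where "K_of \<rho> = (if \<rho> < 2 * n then 2 * B1 else K3)"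
definition L_of :: "nat \<Rightarrow> int" where "L_of \<rho> = (if \<rho> < 2 * n then 1 else L3)"

definition half_list :: "nat \<Rightarrow> nat \<Rightarrow> nat \<Rightarrow> vec list" where
  "half_list \<rho> off l =
     map fst (lev n [lo_of \<rho>..d] (\<lambda>c. w0_of \<rho> + w1_of \<rho> * \<bar>c\<bar>) (tau_of \<rho>) (pos_of \<rho> + off) l)"

definition run_cands :: "nat \<Rightarrow> vec list" where
  "run_cands \<rho> = cands x (K_of \<rho>) (L_of \<rho>) (a_of \<rho>) (r_of \<rho>)
     (half_list \<rho> 0 (n div 2)) (half_list \<rho> (n div 2) (n - n div 2))"

text \<open>What an unsuccessful run certifies about the candidates it has seen. It speaks of codes
  because the machine compares only these.\<close>

definition no_collision :: "vec set \<Rightarrow> bool" where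
  "no_collision P \<longleftrightarrow> (\<forall>y \<in> P. \<forall>z \<in> P. tot x y = tot x z \<longrightarrow> cod d n y = cod d n z) \<and>
     (\<forall>y \<in> P. tot x y = 0 \<longrightarrow> cod d n y = 0)"

definition consts_in :: "state \<Rightarrow> bool" where
  "consts_in s \<longleftrightarrow> vars s vNR = NR \<and> vars s vLIM = int lm \<and> vars s vB1 = B1 \<and>
     vars s vA3 = a3 \<and> vars s vR3 = r3 \<and> vars s vK3 = K3 \<and> vars s vL3 = L3"

lemma wp_set_params:
  assumes inp: "inp s" and c: "consts_in s" and r: "vars s vRUN = int \<rho>" "\<rho> < 2 * n + 1"
  shows "wp w H (set_params d q A1 A2) (\<lambda>t' s'. keep param_vars {} s s' \<and> t' \<le> t + 30 \<and>
     vars s' vLO = lo_of \<rho> \<and> vars s' vA = a_of \<rho> \<and> vars s' vR = r_of \<rho> \<and> vars s' vL = L_of \<rho> \<and>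
     vars s' vK = K_of \<rho> \<and> vars s' vPOS = int (pos_of \<rho>) \<and> vars s' vW0 = w0_of \<rho> \<and>
     vars s' vW1 = w1_of \<rho> \<and> vars s' vTAU = tau_of \<rho>) t s"
    (is "wp w H _ ?Q t s")
proof -
  define Q where "Q = ?Q"
  have N: "vars s vN = int n" using inp by (simp add: inp_def)
  have B1p: "0 < B1"
    using d_pos by (simp add: B1 add_pos_nonneg add_nonneg_pos sum_nonneg)
  have cs: "vars s vB1 = B1" "vars s vA3 = a3" "vars s vR3 = r3" "vars s vK3 = K3" "vars s vL3 = L3"
    using c by (auto simp: consts_in_def)
  have le: "y * 1 \<le> y * NR" if "0 < y" for y :: int
    using that by (intro mult_left_mono) auto
  have H': "2 * B1 \<le> H" "K3 \<le> H" "L3 \<le> H" "d \<le> H" "2 * d + 1 \<le> H"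
    using le[of "2 * B1"] le[of K3] B1_H KL3 B1p H_b d_pos by linarith+
  have rH: "int \<rho> \<le> H" using n_le_H r by linarith
  have th: "0 \<le> threshold d q n A" if "0 \<le> A" for A
    using that cbnd d_pos by (simp add: threshold_def pos_imp_zdiv_nonneg_iff)
  have even_odd: "int \<rho> mod 2 = of_bool (odd \<rho>)" by (simp add: mod_2_eq_odd)
  have "wp w H (set_params d q A1 A2) Q t s" unfolding set_params_def
  proof (rule wp_Cond)
    show "exp_ok H (Bin Less (Var vRUN) (Const 2 \<otimes> Var vN))" by simp
  next
    assume "evl s (Bin Less (Var vRUN) (Const 2 \<otimes> Var vN)) \<noteq> 0"
    then have lt: "\<rho> < 2 * n" by (simp add: r N split: if_splits)
    show "wp w H (Assign vLO (Const (- d));; Assign vA (Const 2);; Assign vR (Const 0);;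
      Assign vL (Const 1);; Assign vK (Const 2 \<otimes> Var vB1);;
      Assign vPOS (Bin Div (Var vRUN) (Const 2));;
      Cond (Bin Mod (Var vRUN) (Const 2))
        (Assign vW0 (Const 0);; Assign vW1 (Const 1);;
         Assign vTAU (Bin Div (Const A1 \<otimes> Var vN) (Const (2 * q)) \<oplus> Const (2 * d + 1)))
        (Assign vW0 (Const d);; Assign vW1 (Const (- 1));;
         Assign vTAU (Bin Div (Const A2 \<otimes> Var vN) (Const (2 * q)) \<oplus> Const (2 * d + 1)))) Q (Suc t) s"
      apply (rule wp_Seq, rule wp_Assign)
        apply (use H' d_pos in \<open>simp add: exp_ok_def\<close>)
       apply (use H' d_pos in simp)
      apply (rule wp_Seq, rule wp_Assign, simp, simp)
      apply (rule wp_Seq, rule wp_Assign, simp, simp)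
      apply (rule wp_Seq, rule wp_Assign, simp, simp)
      apply (rule wp_Seq, rule wp_Assign, simp)
       apply (use H' B1p in \<open>simp add: cs\<close>)
      apply (rule wp_Seq, rule wp_Assign, simp)
       apply (use rH in \<open>simp add: r\<close>)
      apply (rule wp_Cond, simp)
       apply (rule wp_Seq, rule wp_Assign, simp, simp)
       apply (rule wp_Seq, rule wp_Assign, simp, simp)
       apply (rule wp_Assign)
         apply (use cbnd H' d_pos in \<open>simp add: exp_ok_def\<close>)
        apply (use th[of A1] cbnd in \<open>simp add: N threshold_def\<close>)
       apply (use lt in \<open>simp add: Q_def keep_def lo_of_def w0_of_def w1_of_def tau_of_def pos_of_def
           a_of_def r_of_def K_of_def L_of_def r N cs threshold_def even_odd zdiv_int\<close>)
      apply (rule wp_Seq, rule wp_Assign)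
        apply (use H' d_pos in \<open>simp add: exp_ok_def\<close>)
       apply (use H' d_pos in simp)
      apply (rule wp_Seq, rule wp_Assign, simp, simp)
      apply (rule wp_Assign)
        apply (use cbnd H' d_pos in \<open>simp add: exp_ok_def\<close>)
       apply (use th[of A2] cbnd in \<open>simp add: N threshold_def\<close>)
      apply (use lt in \<open>simp add: Q_def keep_def lo_of_def w0_of_def w1_of_def tau_of_def pos_of_def
           a_of_def r_of_def K_of_def L_of_def r N cs threshold_def even_odd zdiv_int\<close>)
      done
  next
    assume "evl s (Bin Less (Var vRUN) (Const 2 \<otimes> Var vN)) = 0"
    then have lt: "\<not> \<rho> < 2 * n" by (simp add: r N split: if_splits)
    show "wp w H (Assign vLO (Const 0);; Assign vA (Var vA3);; Assign vR (Var vR3);;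
      Assign vL (Var vL3);; Assign vK (Var vK3);; Assign vPOS (Const 0);; Assign vW0 (Const 0);;
      Assign vW1 (Const 0);; Assign vTAU (Const 0)) Q (Suc t) s"
      apply (rule wp_Seq, rule wp_Assign, simp, simp)
      apply (rule wp_Seq, rule wp_Assign, simp)
       apply (use KL3 in \<open>simp add: cs\<close>)
      apply (rule wp_Seq, rule wp_Assign, simp)
       apply (use KL3 in \<open>simp add: cs\<close>)
      apply (rule wp_Seq, rule wp_Assign, simp)
       apply (use KL3 in \<open>simp add: cs\<close>)
      apply (rule wp_Seq, rule wp_Assign, simp)
       apply (use KL3 H' in \<open>simp add: cs\<close>)
      apply (rule wp_Seq, rule wp_Assign, simp, simp)
      apply (rule wp_Seq, rule wp_Assign, simp, simp)
      apply (rule wp_Seq, rule wp_Assign, simp, simp)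
      apply (rule wp_Assign, simp, simp)
      apply (use lt in \<open>simp add: Q_def keep_def lo_of_def w0_of_def w1_of_def tau_of_def pos_of_def
           a_of_def r_of_def K_of_def L_of_def r N cs\<close>)
      done
  qed
  then show ?thesis by (simp only: Q_def)
qed

lemma B1_pos: "0 < B1"
  using d_pos by (simp add: B1 add_nonneg_pos sum_nonneg)

lemma weight_bounds:
  assumes "\<bar>c\<bar> \<le> d"
  shows "0 \<le> w0_of \<rho> + w1_of \<rho> * \<bar>c\<bar> \<and> w0_of \<rho> + w1_of \<rho> * \<bar>c\<bar> \<le> d"
  using assms d_pos by (auto simp: w0_of_def w1_of_def)

lemma lo_bounds: "- d \<le> lo_of \<rho>" "lo_of \<rho> \<le> d"
  using d_pos by (auto simp: lo_of_def)

lemma half_list_props: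
  assumes "u \<in> set (half_list \<rho> off l)" "l \<le> n"
  shows "small d u" "\<And>p. p \<notin> positions (pos_of \<rho> + off) l \<Longrightarrow> u p = 0"
    "\<And>p. p \<in> positions (pos_of \<rho> + off) l \<Longrightarrow> lo_of \<rho> \<le> u p"
proof -
  obtain m where m: "(u, m) \<in> set (lev n [lo_of \<rho>..d] (\<lambda>c. w0_of \<rho> + w1_of \<rho> * \<bar>c\<bar>) (tau_of \<rho>)
      (pos_of \<rho> + off) l)"
    using assms(1) by (auto simp: half_list_def)
  show "small d u" "\<And>p. p \<notin> positions (pos_of \<rho> + off) l \<Longrightarrow> u p = 0"
    "\<And>p. p \<in> positions (pos_of \<rho> + off) l \<Longrightarrow> lo_of \<rho> \<le> u p"
    using lev_props[OF weight_bounds lo_bounds(1) assms(2) m] by auto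
qed

lemma positions_disjoint:
  assumes "p \<in> positions pos (n div 2)" "p \<in> positions (pos + n div 2) (n - n div 2)"
  shows False
proof -
  obtain i j where "i < n div 2" "j < n - n div 2" "(pos + i) mod n = (pos + (n div 2 + j)) mod n"
    using assms by (auto simp: positions_def add.assoc)
  moreover from this have "n div 2 + j < n" "i < n" by linarith+
  ultimately show False using mod_add_left_cancel[of pos i n "n div 2 + j"] by simp
qed

lemma add_small:
  assumes "u \<in> set (half_list \<rho> 0 (n div 2))" "v \<in> set (half_list \<rho> (n div 2) (n - n div 2))"
  shows "small d (add v u)" "lo_of \<rho> = 0 \<Longrightarrow> 0 \<le> add v u p"
proof -
  have u: "small d u" "\<And>p. p \<notin> positions (pos_of \<rho>) (n div 2) \<Longrightarrow> u p = 0"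
    "\<And>p. p \<in> positions (pos_of \<rho>) (n div 2) \<Longrightarrow> lo_of \<rho> \<le> u p"
    using half_list_props[OF assms(1)] by auto
  have v: "small d v" "\<And>p. p \<notin> positions (pos_of \<rho> + n div 2) (n - n div 2) \<Longrightarrow> v p = 0"
    "\<And>p. p \<in> positions (pos_of \<rho> + n div 2) (n - n div 2) \<Longrightarrow> lo_of \<rho> \<le> v p"
    using half_list_props[OF assms(2)] by auto
  have "\<bar>u p + v p\<bar> \<le> d" for p
    using u(1) v(1) u(2)[of p] v(2)[of p] positions_disjoint[of p "pos_of \<rho>"]
    by (cases "p \<in> positions (pos_of \<rho>) (n div 2)";
        cases "p \<in> positions (pos_of \<rho> + n div 2) (n - n div 2)") (auto simp: small_def)
  then show "small d (add v u)" by (simp add: small_def add_def)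
  show "0 \<le> add v u p" if "lo_of \<rho> = 0"
    using u(2,3)[of p] v(2,3)[of p] that
    by (cases "p \<in> positions (pos_of \<rho>) (n div 2)";
        cases "p \<in> positions (pos_of \<rho> + n div 2) (n - n div 2)") (auto simp: add_def)
qed

text \<open>The modulus and the doubled sums are even, so the lookup for the carry, e = -1, never
  succeeds. For e = 0 the sum is a multiple of \<open>B1\<close>, which exceeds its absolute value.
  Doubling \<open>a\<close> is thus a way to run an exact search on the code for hashing.\<close>

lemma low_key:
  assumes "key x (2 * B1) 1 2 0 u = (e - key x (2 * B1) 1 2 0 v) mod (2 * B1)" "e \<in> {0, - 1}"
    "small d (add v u)"
  shows "tot x (add v u) = 0"
proof -
  have "(2 * tot x u) mod (2 * B1) = (e - (2 * tot x v) mod (2 * B1)) mod (2 * B1)"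
    using assms(1) by (simp add: key_def del: mod_mult_mult1)
  then have "(2 * tot x u) mod (2 * B1) = (e - 2 * tot x v) mod (2 * B1)"
    by (simp only: mod_diff_right_eq)
  then have "2 * B1 dvd 2 * tot x u - (e - 2 * tot x v)" by (simp only: mod_eq_dvd_iff)
  then have dv: "2 * B1 dvd 2 * tot x (add v u) - e" by (simp add: tot_add algebra_simps)
  have "2 dvd 2 * tot x (add v u) - e" using dv by (rule dvd_mult_left)
  then have "e = 0" using assms(2) by auto
  then have "B1 dvd tot x (add v u)" using dv by simp
  moreover have "\<bar>tot x (add v u)\<bar> < B1" using abs_tot_le[OF assms(3), of x] by (simp add: B1)
  ultimately show ?thesis using zdvd_imp_le[of B1 "\<bar>tot x (add v u)\<bar>"] by fastforce
qed

lemma run_cands_low: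
  assumes "\<rho> < 2 * n" "y \<in> set (run_cands \<rho>)"
  shows "small d y \<and> tot x y = 0"
  using assms add_small[of _ \<rho>] low_key[of _ 0] low_key[of _ "- 1"]
  unfolding run_cands_def cands_mem K_of_def L_of_def a_of_def r_of_def by auto

lemma run_cands_box:
  assumes "\<rho> = 2 * n" "y \<in> set (run_cands \<rho>)"
  shows "small d y \<and> (\<forall>p. 0 \<le> y p)"
  using assms add_small[of _ \<rho>] unfolding run_cands_def cands_mem by (auto simp: lo_of_def)

text \<open>In the first 2 n runs every candidate has sum 0. In the last run the entries of both
  vectors lie in {0..d}, so those of the difference stay within d.\<close>

lemma run_cands_compat:
  assumes "\<rho> \<le> 2 * n"
  shows "compat (set (run_cands \<rho>))"
proof (cases "\<rho> < 2 * n")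
  case True
  then show ?thesis using run_cands_low by (auto simp: compat_def)
next
  case False
  then have r: "\<rho> = 2 * n" using assms by simp
  have "\<bar>y p - z p\<bar> \<le> d" if "y \<in> set (run_cands \<rho>)" "z \<in> set (run_cands \<rho>)" for y z p
  proof -
    have "0 \<le> y p" "0 \<le> z p" "\<bar>y p\<bar> \<le> d" "\<bar>z p\<bar> \<le> d"
      using run_cands_box[OF r that(1)] run_cands_box[OF r that(2)] by (auto simp: small_def)
    then show ?thesis by linarith
  qed
  then have "small d (\<lambda>p. y p - z p)" if "y \<in> set (run_cands \<rho>)" "z \<in> set (run_cands \<rho>)" for y z
    using that by (simp add: small_def)
  then show ?thesis using run_cands_box[OF r] unfolding compat_def by blast
qed

lemma half_list_length:
  assumes "\<rho> \<le> 2 * n" "l \<le> n - n div 2"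
  shows "length (lev n [lo_of \<rho>..d] (\<lambda>c. w0_of \<rho> + w1_of \<rho> * \<bar>c\<bar>) (tau_of \<rho>) pos l) \<le> B"
  using B_low[OF assms(2)] B_high[OF assms(2)] B_box[OF assms(2)]
  by (auto simp: lo_of_def w0_of_def w1_of_def tau_of_def)

lemma status_no_collision:
  assumes "status NR' slot l full s" "vars s vFLAG = 0"
  shows "no_collision (set (take l full))"
  using assms unfolding status_def no_collision_def table_def by metis

text \<open>Nothing is cleared between runs. The lists move on by at most \<open>?S\<close> cells
  per run, and run \<rho> uses the index class \<rho> modulo \<open>NR\<close> of the two tables,
  which earlier runs have left at zero.\<close>

lemma wp_main_loop:
  assumes inp: "inp s" and c: "consts_in s" and v: "vars s vRUN = 0" "vars s vTL = 0" "vars s vFLAG = 0"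
    and fresh: "\<And>j. arrs s aTAB j = 0" "\<And>j. arrs s aHEAD j = 0"
  shows "wp w H (main_loop d q A1 A2) (\<lambda>t' s'. inp s' \<and>
     t' \<le> t + (2 * n + 1) * (engine_time B lm + 40) + 1 \<and>
     (vars s' vFLAG \<noteq> 0 \<longrightarrow> good (vars s' vOUT)) \<and>
     (vars s' vFLAG = 0 \<longrightarrow> (\<forall>\<rho> \<le> 2 * n. no_collision (set (take lm (run_cands \<rho>)))))) t s"
    (is "wp w H _ ?Q t s")
proof -
  define Q where "Q = ?Q"
  let ?S = "2 * (int n + 1) * int B"
  define I where "I = (\<lambda>t' s'. inp s' \<and> consts_in s' \<and> (\<exists>\<rho> \<le> 2 * n + 1. vars s' vRUN = int \<rho> \<and>
     t' \<le> t + \<rho> * (engine_time B lm + 40) \<and>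
     0 \<le> vars s' vTL \<and> vars s' vTL \<le> int \<rho> * ?S \<and>
     (\<forall>j. j mod NR \<ge> int \<rho> \<longrightarrow> arrs s' aTAB j = 0 \<and> arrs s' aHEAD j = 0) \<and>
     (vars s' vFLAG \<noteq> 0 \<longrightarrow> good (vars s' vOUT)) \<and>
     (vars s' vFLAG = 0 \<longrightarrow> (\<forall>\<rho>' < \<rho>. no_collision (set (take lm (run_cands \<rho>')))))))"
  define M where "M = (\<lambda>s :: state. nat (NR - vars s vRUN))"
  have "wp w H (main_loop d q A1 A2) Q t s" unfolding main_loop_def
  proof (rule wp_While[where I = I and m = M])
    show "exp_ok H (Bin Less (Var vRUN) (Var vNR))" by simp
    show "I t s" using inp c v fresh by (auto simp: I_def intro!: exI[of _ 0])
  next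
    fix t' s' assume I: "I t' s'" and e: "evl s' (Bin Less (Var vRUN) (Var vNR)) \<noteq> 0"
    have i': "inp s'" and c': "consts_in s'" using I by (auto simp: I_def)
    obtain \<rho> where r: "\<rho> \<le> 2 * n + 1" "vars s' vRUN = int \<rho>"
      and tm: "t' \<le> t + \<rho> * (engine_time B lm + 40)"
      and TL: "0 \<le> vars s' vTL" "vars s' vTL \<le> int \<rho> * ?S"
      and fr: "\<And>j. j mod NR \<ge> int \<rho> \<Longrightarrow> arrs s' aTAB j = 0 \<and> arrs s' aHEAD j = 0"
      and gd: "vars s' vFLAG \<noteq> 0 \<longrightarrow> good (vars s' vOUT)"
      and nc: "vars s' vFLAG = 0 \<longrightarrow> (\<forall>\<rho>' < \<rho>. no_collision (set (take lm (run_cands \<rho>'))))"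
      using I by (auto simp: I_def)
    have NRv: "vars s' vNR = NR" using c' by (simp add: consts_in_def)
    have rl: "\<rho> < 2 * n + 1" using e r NRv by (simp split: if_splits)
    then have rl': "\<rho> \<le> 2 * n" by simp
    have S0: "0 \<le> ?S" by simp
    have "int (Suc \<rho>) * ?S \<le> NR * ?S" using rl S0 by (intro mult_right_mono) auto
    then have TLH: "vars s' vTL + 2 * (int n + 1) * int B + 2 * d + 1 \<le> H"
      using TL TL_H by (simp add: distrib_right)
    have KNR: "K_of \<rho> * NR \<le> H" using KL3 B1_H by (simp add: K_of_def)
    have rH: "\<bar>int \<rho> + 1\<bar> \<le> H" using n_le_H rl by linarith
    show "wp w H (set_params d q A1 A2;; engine d;; Assign vRUN (Var vRUN \<oplus> Const 1))
      (\<lambda>t'' s''. I (Suc t'') s'' \<and> M s'' < M s') (Suc t') s'"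
      apply (rule wp_Seq)
      apply (rule wp_mono[OF wp_set_params[OF i' c' r(2) rl]], elim conjE)
      subgoal premises p1 for t1 s1
      proof -
        note k1 = p1(1)
        have i1: "inp s1" by (rule inp_keep[OF i' k1]) auto
        have v1: "vars s1 vTL = vars s' vTL" "vars s1 vNR = NR" "vars s1 vRUN = int \<rho>"
          "vars s1 vLIM = int lm" "vars s1 vFLAG = vars s' vFLAG" "vars s1 vOUT = vars s' vOUT"
          using keep_var[OF k1] r NRv c' by (auto simp: consts_in_def)
        have a1: "arrs s1 = arrs s'" using k1 by (auto simp: keep_def)
        have slot: "(j * NR + int \<rho>) mod NR = int \<rho>" for j using rl by simp
        have eng: "wp w H (engine d) (\<lambda>t' s'. keep engine_vars engine_arrs s1 s' \<and>
          t' \<le> Suc t1 + engine_time B lm \<and>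
          0 \<le> vars s' vTL \<and> vars s' vTL \<le> vars s1 vTL + 2 * (int n + 1) * int B \<and>
          (\<forall>j. j mod NR \<noteq> int \<rho> \<longrightarrow> arrs s' aTAB j = arrs s1 aTAB j \<and> arrs s' aHEAD j = arrs s1 aHEAD j) \<and>
          (vars s1 vFLAG \<noteq> 0 \<longrightarrow> vars s' vFLAG \<noteq> 0) \<and>
          status NR (int \<rho>) lm (run_cands \<rho>) s' \<and>
          (vars s' vFLAG \<noteq> 0 \<longrightarrow> good (vars s' vOUT))) (Suc t1) s1"
          unfolding run_cands_def
        proof (rule wp_engine[OF i1 refl p1(8,3,9,10,11,4,7,6,5) v1(2-4) refl weight_bounds])
          show "half_list \<rho> 0 (n div 2) = map fst (lev n [lo_of \<rho>..d]
            (\<lambda>c. w0_of \<rho> + w1_of \<rho> * \<bar>c\<bar>) (tau_of \<rho>) (pos_of \<rho>) (n div 2))"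
            by (simp add: half_list_def)
          show "half_list \<rho> (n div 2) (n - n div 2) = map fst (lev n [lo_of \<rho>..d]
            (\<lambda>c. w0_of \<rho> + w1_of \<rho> * \<bar>c\<bar>) (tau_of \<rho>) (pos_of \<rho> + n div 2) (n - n div 2))"
            by (simp add: half_list_def)
          show "compat (set (run_cands \<rho>))" using run_cands_compat rl' by blast
          show "set (cands x (K_of \<rho>) (L_of \<rho>) (a_of \<rho>) (r_of \<rho>) (half_list \<rho> 0 (n div 2))
            (half_list \<rho> (n div 2) (n - n div 2))) \<subseteq> set (run_cands \<rho>)"
            by (simp add: run_cands_def)
          show "pos_of \<rho> \<le> n" by (auto simp: pos_of_def)
          show "0 < K_of \<rho>" "0 < L_of \<rho>" using B1_pos KL3 by (auto simp: K_of_def L_of_def)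
        qed (use half_list_length[OF rl'] TL TLH v1 lo_bounds KNR rl lm fr slot a1 gd in auto)
        show ?thesis
          apply (rule wp_Seq)
          apply (rule wp_mono[OF eng], elim conjE)
          subgoal premises p2 for t2 s2
          proof (rule wp_Assign)
            note k2 = p2(1)
            have kk: "keep (param_vars \<union> engine_vars) engine_arrs s' s2"
              by (rule keep_trans[OF keep_mono[OF k1] keep_mono[OF k2]]) auto
            have R2: "vars s2 vRUN = int \<rho>" using keep_var[OF kk] r by simp
            show "exp_ok H (Var vRUN \<oplus> Const 1)" by simp
            show "\<bar>evl s2 (Var vRUN \<oplus> Const 1)\<bar> \<le> H" using rH by (simp add: R2)
            let ?s = "set_var vRUN (evl s2 (Var vRUN \<oplus> Const 1)) s2"
            have "I (Suc (Suc (Suc t2))) ?s" unfolding I_def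
            proof (intro conjI exI[of _ "Suc \<rho>"])
              have "inp s2" by (rule inp_keep[OF i' kk]) auto
              then show "inp ?s" by (simp add: inp_def)
              show "consts_in ?s" using c' keep_var[OF kk] by (simp add: consts_in_def)
              show "Suc \<rho> \<le> 2 * n + 1" using rl by simp
              show "vars ?s vRUN = int (Suc \<rho>)" by (simp add: R2)
              show "Suc (Suc (Suc t2)) \<le> t + Suc \<rho> * (engine_time B lm + 40)"
                unfolding mult_Suc using tm p1(2) p2(2) by linarith
              show "0 \<le> vars ?s vTL" using p2(3) by simp
              have "vars s2 vTL \<le> int \<rho> * ?S + ?S" using p2(4) TL v1(1) by linarith
              then show "vars ?s vTL \<le> int (Suc \<rho>) * ?S" by (simp add: algebra_simps)
              show "\<forall>j. j mod NR \<ge> int (Suc \<rho>) \<longrightarrow> arrs ?s aTAB j = 0 \<and> arrs ?s aHEAD j = 0"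
                using p2(5) fr a1 by auto
              show "vars ?s vFLAG \<noteq> 0 \<longrightarrow> good (vars ?s vOUT)" using p2(8) by simp
              show "vars ?s vFLAG = 0 \<longrightarrow> (\<forall>\<rho>'<Suc \<rho>. no_collision (set (take lm (run_cands \<rho>'))))"
                using nc p2(6) status_no_collision[OF p2(7)] v1(5) by (auto simp: less_Suc_eq)
            qed
            then show "I (Suc (Suc (Suc t2))) ?s \<and> M ?s < M s'" using rl r by (simp add: M_def R2)
          qed
          done
      qed
      done
  next
    fix t' s' assume I: "I t' s'" and e: "evl s' (Bin Less (Var vRUN) (Var vNR)) = 0"
    have i': "inp s'" and c': "consts_in s'" using I by (auto simp: I_def)
    obtain \<rho> where r: "\<rho> \<le> 2 * n + 1" "vars s' vRUN = int \<rho>"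
      and tm: "t' \<le> t + \<rho> * (engine_time B lm + 40)"
      and gd: "vars s' vFLAG \<noteq> 0 \<longrightarrow> good (vars s' vOUT)"
      and nc: "vars s' vFLAG = 0 \<longrightarrow> (\<forall>\<rho>' < \<rho>. no_collision (set (take lm (run_cands \<rho>'))))"
      using I by (auto simp: I_def)
    have "vars s' vNR = NR" using c' by (simp add: consts_in_def)
    then have "\<rho> = 2 * n + 1" using e r by (simp split: if_splits)
    then show "Q (Suc t') s'" using i' tm gd nc unfolding Q_def by auto
  qed
  then show ?thesis by (simp only: Q_def)
qed

end

section \<open>The program\<close>

definition init_loop :: "int \<Rightarrow> com" where
  "init_loop d = While (Bin Less (Var vI) (Var vN))
     (Assign vX (Var vX \<oplus> abs_exp (Elem aX (Var vI)));;
      Store aPW (Var vI) (Var vPW);;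
      Assign vPW (Var vPW \<otimes> Const (2 * d + 1));;
      Assign vDN (Var vDN \<otimes> Const (d + 1));;
      Assign vI (Var vI \<oplus> Const 1))"

definition power_loop :: "int \<Rightarrow> int \<Rightarrow> int \<Rightarrow> com" where
  "power_loop q c1 c2 = While (Bin Less (Var vI) (Bin Div (Var vN) (Const q)))
     (Assign vK3 (Var vK3 \<otimes> Const c1);;
      Assign vLIM (Var vLIM \<otimes> Const c2);;
      Assign vI (Var vI \<oplus> Const 1))"

definition init :: "int \<Rightarrow> int \<Rightarrow> int \<Rightarrow> int \<Rightarrow> com" where
  "init d q c1 c2 =
     (Assign vPW (Const 1);;
      Assign vDN (Const 1);;
      init_loop d;;
      Assign vI (Const 0);;
      Assign vK3 (Const (d + 1));;
      Assign vLIM (Const 1);;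
      power_loop q c1 c2;;
      Assign vLIM (Var vLIM \<oplus> Const 1);;
      Assign vB1 (Const d \<otimes> Var vX \<oplus> Const 1);;
      Assign vL3 (Var vB1 \<otimes> Var vDN);;
      Assign vNR (Const 2 \<otimes> Var vN \<oplus> Const 1))"

text \<open>Reads off the balanced digits of the code, lowest first; adding d beforehand shifts them
  to the range of \<open>Mod\<close>.\<close>

definition write_output :: "int \<Rightarrow> com" where
  "write_output d =
     (Assign vI (Const 0);;
      While (Bin Less (Var vI) (Var vN))
        (Assign vC (Bin Mod (Var vOUT \<oplus> Const d) (Const (2 * d + 1)) \<ominus> Const d);;
         Store aOUT (Var vI) (Var vC);;
         Assign vOUT (Bin Div (Var vOUT \<oplus> Const d) (Const (2 * d + 1)));;
         Assign vI (Var vI \<oplus> Const 1)))"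

definition program :: "int \<Rightarrow> int \<Rightarrow> int \<Rightarrow> int \<Rightarrow> int \<Rightarrow> int \<Rightarrow> com" where
  "program d q A1 A2 c1 c2 =
     (init d q c1 c2;;
      Rand vA3 (Var vK3 \<otimes> Var vL3);;
      Rand vR3 (Var vK3 \<otimes> Var vL3);;
      main_loop d q A1 A2;;
      write_output d)"

lemma cod_Suc_shift: "cod d (Suc m) g = g 0 + (2 * d + 1) * cod d m (\<lambda>p. g (Suc p))"
  unfolding cod_def sum.lessThan_Suc_shift by (simp add: sum_distrib_left algebra_simps)

lemma steps_Rand:
  assumes "eval_exp w s e = Some m"
  shows "steps w (Suc (Suc t)) (Seq (Rand v e) c, s) =
    bind_spmf (spmf_of_set {0..<m}) (\<lambda>i. steps w t (c, set_var v i s))"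
  using assms by (simp add: bind_map_spmf o_def set_var_def map_spmf_conv_bind_spmf)

context alg
begin

definition init_state :: "int \<Rightarrow> int \<Rightarrow> int \<Rightarrow> state \<Rightarrow> bool" where
  "init_state q c1 c2 s \<longleftrightarrow> inp s \<and>
     vars s vK3 = (d + 1) * c1 ^ (n div nat q) \<and> vars s vLIM = c2 ^ (n div nat q) + 1 \<and>
     vars s vB1 = d * (\<Sum>i<n. \<bar>x ! i\<bar>) + 1 \<and>
     vars s vL3 = (d * (\<Sum>i<n. \<bar>x ! i\<bar>) + 1) * (d + 1) ^ n \<and> vars s vNR = 2 * int n + 1 \<and>
     vars s vRUN = 0 \<and> vars s vTL = 0 \<and> vars s vFLAG = 0 \<and>
     (\<forall>j. arrs s aTAB j = 0) \<and> (\<forall>j. arrs s aHEAD j = 0)"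

lemma wp_init:
  assumes q: "0 < q" "q \<le> H" and c12: "1 \<le> c1" "1 \<le> c2" "c1 \<le> H" "c2 \<le> H"
    and b: "(d + 1) * c1 ^ (n div nat q) \<le> H" "c2 ^ (n div nat q) + 1 \<le> H"
      "(d * (\<Sum>i<n. \<bar>x ! i\<bar>) + 1) * (d + 1) ^ n \<le> H"
  shows "wp w H (init d q c1 c2) (\<lambda>t' s'. t' \<le> t + 24 * n + 40 \<and> init_state q c1 c2 s') t (input_state x)"
proof -
  let ?X = "\<Sum>i<n. \<bar>x ! i\<bar>"
  have nH: "int n + 1 \<le> H" "2 * int n + 1 \<le> H" using n_le_H by simp_all
  have X0: "0 \<le> ?X" by (simp add: sum_nonneg)
  have dn1: "1 \<le> (d + 1) ^ n" using d_pos by (simp add: one_le_power)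
  have dX: "0 \<le> d * ?X" using X0 d_pos by simp
  have BX: "d * ?X + 1 \<le> H" "(d + 1) ^ n \<le> H"
  proof -
    have "(d * ?X + 1) * 1 \<le> (d * ?X + 1) * (d + 1) ^ n" using dX dn1 by (intro mult_left_mono) auto
    from this b(3) have "(d * ?X + 1) * 1 \<le> H" by (rule order_trans)
    then show "d * ?X + 1 \<le> H" by simp
    have "1 * (d + 1) ^ n \<le> (d * ?X + 1) * (d + 1) ^ n" using dX dn1 by (intro mult_right_mono) auto
    from this b(3) have "1 * (d + 1) ^ n \<le> H" by (rule order_trans)
    then show "(d + 1) ^ n \<le> H" by simp
  qed
  have "1 * ?X \<le> d * ?X" using X0 d_pos by (intro mult_right_mono) auto
  then have XH: "?X \<le> H" using BX by linarith
  define base where "base = (\<lambda>s :: state. vars s vN = int n \<and> (\<forall>p<n. arrs s aX (int p) = x ! p) \<and>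
     vars s vRUN = 0 \<and> vars s vTL = 0 \<and> vars s vFLAG = 0 \<and>
     (\<forall>j. arrs s aTAB j = 0) \<and> (\<forall>j. arrs s aHEAD j = 0))"
  let ?s0 = "set_var vDN 1 (set_var vPW 1 (input_state x))"
  let ?t0 = "Suc (Suc (Suc (Suc t)))"
  have base0: "base (input_state x)" by (auto simp: base_def input_state_def)
  define P where "P = (\<lambda>i s :: state. (\<forall>p<i. arrs s aPW (int p) = (2 * d + 1) ^ p) \<and> vars s vI = int i \<and>
     vars s vX = (\<Sum>j<i. \<bar>x ! j\<bar>) \<and> vars s vPW = (2 * d + 1) ^ i \<and> vars s vDN = (d + 1) ^ i)"
  define I where "I = (\<lambda>t' s' :: state. base s' \<and> (\<exists>i \<le> n. P i s' \<and> t' \<le> ?t0 + i * 12))"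
  define M where "M = (\<lambda>s :: state. nat (int n - vars s vI))"
  have loop1: "wp w H (init_loop d) (\<lambda>t' s'. base s' \<and> P n s' \<and> t' \<le> ?t0 + n * 12 + 1) ?t0 ?s0"
    unfolding init_loop_def
  proof (rule wp_While[where I = I and m = M])
    show "exp_ok H (Bin Less (Var vI) (Var vN))" by simp
    have "P 0 ?s0" "base ?s0" using base0 by (simp_all add: P_def input_state_def base_def)
    then show "I ?t0 ?s0" by (auto simp: I_def)
  next
    fix t' s' assume I: "I t' s'" and e: "evl s' (Bin Less (Var vI) (Var vN)) \<noteq> 0"
    then obtain i where i: "i \<le> n" "P i s'" "t' \<le> ?t0 + i * 12" and bs: "base s'" by (auto simp: I_def)
    have vs: "vars s' vN = int n" "vars s' vI = int i" "vars s' vX = (\<Sum>j<i. \<bar>x ! j\<bar>)"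
      "vars s' vPW = (2 * d + 1) ^ i" "vars s' vDN = (d + 1) ^ i"
      using bs i by (auto simp: base_def P_def)
    have il: "i < n" using e vs by (simp split: if_splits)
    have xi: "arrs s' aX (int i) = x ! i" using bs il by (simp add: base_def)
    have pw: "(2 * d + 1) ^ j \<le> H" "0 \<le> (2 * d + 1) ^ j" if "j \<le> n" for j
    proof -
      have "(2 * d + 1) ^ j \<le> (2 * d + 1) ^ n" using that d_pos by (intro power_increasing) auto
      then show "(2 * d + 1) ^ j \<le> H" using H_cod by (rule order_trans)
    qed (use d_pos in simp)
    have dn: "(d + 1) ^ j \<le> H" "0 \<le> (d + 1) ^ j" if "j \<le> n" for j
    proof -
      have "(d + 1) ^ j \<le> (d + 1) ^ n" using that d_pos by (intro power_increasing) auto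
      then show "(d + 1) ^ j \<le> H" using BX(2) by (rule order_trans)
    qed (use d_pos in simp)
    have sx: "(\<Sum>j<i. \<bar>x ! j\<bar>) + \<bar>x ! i\<bar> \<le> H" "0 \<le> (\<Sum>j<i. \<bar>x ! j\<bar>)"
    proof -
      have "(\<Sum>j<Suc i. \<bar>x ! j\<bar>) \<le> ?X" using il by (intro sum_mono2) auto
      then show "(\<Sum>j<i. \<bar>x ! j\<bar>) + \<bar>x ! i\<bar> \<le> H" using XH by simp
    qed (simp add: sum_nonneg)
    have ab: "x ! i * (1 - 2 * of_bool (x ! i < 0)) = \<bar>x ! i\<bar>" by (simp add: abs_if)
    let ?s = "set_var vI (int i + 1) (set_var vDN ((d + 1) ^ i * (d + 1))
      (set_var vPW ((2 * d + 1) ^ i * (2 * d + 1)) (set_arr aPW (int i) ((2 * d + 1) ^ i)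
      (set_var vX ((\<Sum>j<i. \<bar>x ! j\<bar>) + \<bar>x ! i\<bar>) s'))))"
    have "P (Suc i) ?s" using i(2) by (auto simp: P_def less_Suc_eq)
    moreover have "base ?s" using bs by (simp add: base_def)
    ultimately have fin: "I t1 ?s \<and> M ?s < M s'" if "t1 \<le> t' + 12" for t1
      unfolding I_def M_def using il that i(3) vs by (auto intro!: exI[of _ "Suc i"])
    show "wp w H (Assign vX (Var vX \<oplus> abs_exp (Elem aX (Var vI)));; Store aPW (Var vI) (Var vPW);;
      Assign vPW (Var vPW \<otimes> Const (2 * d + 1));; Assign vDN (Var vDN \<otimes> Const (d + 1));;
      Assign vI (Var vI \<oplus> Const 1)) (\<lambda>t'' s''. I (Suc t'') s'' \<and> M s'' < M s') (Suc t') s'"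
      apply (rule wp_Seq, rule wp_Assign, simp)
       apply (use sx in \<open>simp add: vs xi ab\<close>)
      apply (rule wp_Seq, rule wp_Store, simp, simp)
       apply (use pw[of i] il d_pos in \<open>simp add: vs\<close>)
      apply (rule wp_Seq, rule wp_Assign)
        apply (use H_b d_pos in simp)
       apply (use pw[of "Suc i"] il d_pos in \<open>simp add: vs mult.commute\<close>)
      apply (rule wp_Seq, rule wp_Assign)
        apply (use H_b d_pos in simp)
       apply (use dn[of "Suc i"] il d_pos in \<open>simp add: vs mult.commute\<close>)
      apply (rule wp_Assign, simp)
       apply (use nH il in \<open>simp add: vs\<close>)
      apply (use fin fin[OF le_add1] in \<open>simp add: vs xi ab\<close>)
      done
  next
    fix t' s' assume I: "I t' s'" and e: "evl s' (Bin Less (Var vI) (Var vN)) = 0"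
    then obtain i where i: "i \<le> n" "P i s'" "t' \<le> ?t0 + i * 12" and bs: "base s'" by (auto simp: I_def)
    have "i = n" using e bs i by (simp add: base_def P_def split: if_splits)
    then show "base s' \<and> P n s' \<and> Suc t' \<le> ?t0 + n * 12 + 1" using i bs by simp
  qed
  let ?m = "n div nat q"
  have mq: "int n div q = int ?m" using q by (simp add: zdiv_int)
  have mn: "?m \<le> n" by simp
  define R where "R = (\<lambda>i s :: state. base s \<and> (\<forall>p<n. arrs s aPW (int p) = (2 * d + 1) ^ p) \<and>
     vars s vX = ?X \<and> vars s vDN = (d + 1) ^ n \<and>
     vars s vI = int i \<and> vars s vK3 = (d + 1) * c1 ^ i \<and> vars s vLIM = c2 ^ i)"
  have loop2: "wp w H (power_loop q c1 c2) (\<lambda>t' s'. R ?m s' \<and> t' \<le> t0 + ?m * 12 + 1) t0 s0"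
    if R0: "R 0 s0" for t0 s0
  proof -
    define I where "I = (\<lambda>t' s' :: state. (\<exists>i \<le> ?m. R i s' \<and> t' \<le> t0 + i * 12))"
    define M where "M = (\<lambda>s :: state. nat (int ?m - vars s vI))"
    show ?thesis unfolding power_loop_def
    proof (rule wp_While[where I = I and m = M])
      show "exp_ok H (Bin Less (Var vI) (Bin Div (Var vN) (Const q)))" using q by simp
      show "I t0 s0" using R0 by (auto simp: I_def intro!: exI[of _ 0])
    next
      fix t' s' assume I: "I t' s'" and e: "evl s' (Bin Less (Var vI) (Bin Div (Var vN) (Const q))) \<noteq> 0"
      then obtain i where i: "i \<le> ?m" "R i s'" "t' \<le> t0 + i * 12" by (auto simp: I_def)
      have vs: "vars s' vN = int n" "vars s' vI = int i" "vars s' vK3 = (d + 1) * c1 ^ i"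
        "vars s' vLIM = c2 ^ i" using i by (auto simp: R_def base_def)
      have il: "i < ?m" using e mq by (simp add: vs split: if_splits)
      have k: "(d + 1) * c1 ^ i * c1 \<le> H" "0 \<le> (d + 1) * c1 ^ i * c1"
      proof -
        have "c1 ^ Suc i \<le> c1 ^ ?m" using il c12 by (intro power_increasing) auto
        then have "(d + 1) * c1 ^ Suc i \<le> (d + 1) * c1 ^ ?m" using d_pos by (intro mult_left_mono) auto
        then show "(d + 1) * c1 ^ i * c1 \<le> H" using b by (simp add: ac_simps)
        show "0 \<le> (d + 1) * c1 ^ i * c1" using d_pos c12 by simp
      qed
      have "i < n" using il mn by (rule less_le_trans)
      then have iH: "int i + 1 \<le> H" using nH by linarith
      have l: "c2 ^ i * c2 \<le> H" "0 \<le> c2 ^ i * c2"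
      proof -
        have "c2 ^ Suc i \<le> c2 ^ ?m" using il c12 by (intro power_increasing) auto
        then show "c2 ^ i * c2 \<le> H" using b by (simp add: ac_simps)
        show "0 \<le> c2 ^ i * c2" using c12 by simp
      qed
      let ?s = "set_var vI (int i + 1) (set_var vLIM (c2 ^ i * c2) (set_var vK3 ((d + 1) * c1 ^ i * c1) s'))"
      have "R (Suc i) ?s" using i(2) by (auto simp: R_def base_def)
      then have fin: "I t1 ?s \<and> M ?s < M s'" if "t1 \<le> t' + 12" for t1
        unfolding I_def M_def using il that i(3) vs by (auto intro!: exI[of _ "Suc i"])
      show "wp w H (Assign vK3 (Var vK3 \<otimes> Const c1);; Assign vLIM (Var vLIM \<otimes> Const c2);;
        Assign vI (Var vI \<oplus> Const 1)) (\<lambda>t'' s''. I (Suc t'') s'' \<and> M s'' < M s') (Suc t') s'"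
        apply (rule wp_Seq, rule wp_Assign)
          apply (use c12 in simp)
         apply (use k in \<open>simp add: vs\<close>)
        apply (rule wp_Seq, rule wp_Assign)
          apply (use c12 in simp)
         apply (use l in \<open>simp add: vs\<close>)
        apply (rule wp_Assign, simp)
         apply (use iH in \<open>simp add: vs\<close>)
        apply (use fin fin[OF le_add1] in \<open>simp add: vs\<close>)
        done
    next
      fix t' s' assume I: "I t' s'" and e: "evl s' (Bin Less (Var vI) (Bin Div (Var vN) (Const q))) = 0"
      then obtain i where i: "i \<le> ?m" "R i s'" "t' \<le> t0 + i * 12" by (auto simp: I_def)
      have "i = ?m" using e i mq by (simp add: base_def R_def split: if_splits)
      then show "R ?m s' \<and> Suc t' \<le> t0 + ?m * 12 + 1" using i by simp
    qed
  qed
  define Q where "Q = (\<lambda>t' s' :: state. t' \<le> t + 24 * n + 40 \<and> init_state q c1 c2 s')"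
  have "wp w H (init d q c1 c2) Q t (input_state x)" unfolding init_def
    apply (rule wp_Seq, rule wp_Assign, simp, simp)
    apply (rule wp_Seq, rule wp_Assign, simp, simp)
    apply (rule wp_Seq)
    apply (simp only: evl.simps)
    apply (rule wp_mono[OF loop1], elim conjE)
    subgoal premises p1 for t1 s1
    proof -
      have R0: "R 0 (set_var vLIM 1 (set_var vK3 (d + 1) (set_var vI 0 s1)))"
        using p1 by (simp add: R_def P_def base_def)
      show ?thesis
        apply (rule wp_Seq, rule wp_Assign, simp, simp)
        apply (rule wp_Seq, rule wp_Assign)
          apply (use H_b d_pos in simp)
         apply (use H_b d_pos in simp)
        apply (rule wp_Seq, rule wp_Assign, simp, simp)
        apply (rule wp_Seq)
        apply (simp only: evl.simps)
        apply (rule wp_mono[OF loop2[OF R0]], elim conjE)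
        subgoal premises p2 for t2 s2
        proof -
          have vs: "vars s2 vN = int n" "vars s2 vX = ?X" "vars s2 vDN = (d + 1) ^ n"
            "vars s2 vLIM = c2 ^ ?m" using p2 by (auto simp: R_def base_def)
          have tt: "t2 \<le> t + 24 * n + 20"
            using p1(3) p2(2) mn by linarith
          have c20: "0 \<le> c2 ^ ?m" using c12 by simp
          let ?s = "set_var vNR (2 * int n + 1) (set_var vL3 ((d * ?X + 1) * (d + 1) ^ n)
             (set_var vB1 (d * ?X + 1) (set_var vLIM (c2 ^ ?m + 1) s2)))"
          have fin: "init_state q c1 c2 ?s"
            using p2(1) unfolding init_state_def R_def base_def inp_def by simp
          show ?thesis
            apply (rule wp_Seq, rule wp_Assign, simp)
             apply (use b c20 in \<open>simp add: vs\<close>)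
            apply (rule wp_Seq, rule wp_Assign)
              apply (use H_b d_pos in simp)
             apply (use BX dX in \<open>simp add: vs\<close>)
            apply (rule wp_Seq, rule wp_Assign, simp)
             apply (use b dX dn1 in \<open>simp add: vs\<close>)
            apply (rule wp_Assign, simp)
             apply (use nH in \<open>simp add: vs\<close>)
            apply (use fin tt in \<open>simp add: vs Q_def\<close>)
            done
        qed
        done
    qed
    done
  then show ?thesis by (simp only: Q_def)
qed

lemma wp_write_output:
  assumes inp: "inp s" and g: "vars s vFLAG \<noteq> 0 \<longrightarrow> small d g \<and> vars s vOUT = cod d n g"
  shows "wp w H (write_output d) (\<lambda>t' s'. t' \<le> t + 12 * n + 4 \<and> vars s' vFLAG = vars s vFLAG \<and>
     (vars s vFLAG \<noteq> 0 \<longrightarrow> (\<forall>p<n. arrs s' aOUT (int p) = g p))) t s"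
proof -
  have nH: "int n + 1 \<le> H" using n_le_H by simp
  let ?t0 = "Suc (Suc t)"
  define I where "I = (\<lambda>t' s' :: state. vars s' vN = int n \<and> vars s' vFLAG = vars s vFLAG \<and>
     (\<exists>i \<le> n. vars s' vI = int i \<and> t' \<le> ?t0 + i * 12 \<and> (vars s vFLAG \<noteq> 0 \<longrightarrow>
        (\<forall>p<i. arrs s' aOUT (int p) = g p) \<and> vars s' vOUT = cod d (n - i) (\<lambda>p. g (p + i)))))"
  define M where "M = (\<lambda>s :: state. nat (int n - vars s vI))"
  define Q where "Q = (\<lambda>t' s' :: state. t' \<le> t + 12 * n + 4 \<and> vars s' vFLAG = vars s vFLAG \<and>
     (vars s vFLAG \<noteq> 0 \<longrightarrow> (\<forall>p<n. arrs s' aOUT (int p) = g p)))"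
  have "wp w H (write_output d) Q t s" unfolding write_output_def
    apply (rule wp_Seq, rule wp_Assign, simp, simp)
  proof (rule wp_While[where I = I and m = M])
    show "exp_ok H (Bin Less (Var vI) (Var vN))" by simp
    show "I ?t0 (set_var vI (evl s (Const 0)) s)"
      using g inp by (auto simp: I_def inp_def intro!: exI[of _ 0])
  next
    fix t' s' assume I: "I t' s'" and e: "evl s' (Bin Less (Var vI) (Var vN)) \<noteq> 0"
    obtain i where i: "i \<le> n" "vars s' vI = int i" "t' \<le> ?t0 + i * 12"
      "vars s vFLAG \<noteq> 0 \<longrightarrow> (\<forall>p<i. arrs s' aOUT (int p) = g p) \<and>
         vars s' vOUT = cod d (n - i) (\<lambda>p. g (p + i))"
      and N: "vars s' vN = int n" "vars s' vFLAG = vars s vFLAG"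
      using I by (auto simp: I_def)
    have il: "i < n" using e i N by (simp split: if_splits)
    define z where "z = vars s' vOUT"
    let ?b = "2 * d + 1"
    have b: "0 < ?b" using d_pos by simp
    have "0 \<le> (z + d) mod ?b" "(z + d) mod ?b < ?b"
      using b by (rule pos_mod_sign, rule pos_mod_bound)
    then have cH: "\<bar>(z + d) mod ?b - d\<bar> \<le> H" using H_b by linarith
    \<comment> \<open>The loop is also executed when nothing was found, so the quotient has to fit
      into a word for every value of \<open>vOUT\<close>, not only for codes.\<close>
    have zH: "\<bar>(z + d) div ?b\<bar> \<le> H" if "bounded_state H s'"
    proof -
      have zb: "\<bar>z\<bar> \<le> H" using that by (simp add: z_def bounded_state_def)
      show ?thesis
      proof (cases "0 \<le> z")
        case True
        have "z + d < ?b * (z + 1)" using True d_pos by (simp add: algebra_simps add_strict_increasing)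
        moreover have "?b * ((z + d) div ?b) \<le> z + d"
          using pos_mod_sign[OF b, of "z + d"] mult_div_mod_eq[of ?b "z + d"] by linarith
        ultimately have "?b * ((z + d) div ?b) < ?b * (z + 1)" by linarith
        then have "(z + d) div ?b < z + 1" using b by (simp only: mult_less_cancel_left_pos)
        moreover have "0 \<le> (z + d) div ?b" using True d_pos by (simp add: pos_imp_zdiv_nonneg_iff)
        ultimately show ?thesis using zb by linarith
      next
        case False
        have "d * (2 * z + - 1) \<le> d * 0" using False d_pos by (intro mult_left_mono) auto
        then have "?b * z \<le> z + d" by (simp add: algebra_simps)
        then have "z \<le> (z + d) div ?b" using b by (simp add: zdiv_mono1[of "?b * z" "z + d" ?b, simplified])
        moreover have "(z + d) div ?b \<le> (0 + d) div ?b" using False b by (intro zdiv_mono1) auto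
        moreover have "(0 + d) div ?b = 0" using d_pos by simp
        ultimately show ?thesis using zb by linarith
      qed
    qed
    have dec: "(z + d) mod ?b - d = g i \<and> (z + d) div ?b = cod d (n - Suc i) (\<lambda>p. g (p + Suc i))"
      if "vars s vFLAG \<noteq> 0"
    proof -
      have "n - i = Suc (n - Suc i)" using il by simp
      then have "z = g i + ?b * cod d (n - Suc i) (\<lambda>p. g (p + Suc i))"
        using i(4) that cod_Suc_shift[of d "n - Suc i" "\<lambda>p. g (p + i)"] by (simp add: z_def)
      then have e: "z + d = (g i + d) + ?b * cod d (n - Suc i) (\<lambda>p. g (p + Suc i))" by simp
      have gi: "0 \<le> g i + d" "g i + d < ?b"
        using g that by (auto simp: small_def abs_le_iff dest!: spec[of _ i])
      have "(z + d) mod ?b = g i + d"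
        unfolding e mod_mult_self2 by (rule mod_pos_pos_trivial[OF gi])
      moreover have "(z + d) div ?b = cod d (n - Suc i) (\<lambda>p. g (p + Suc i))"
        unfolding e using b gi by (subst div_mult_self2) auto
      ultimately show ?thesis by simp
    qed
    let ?s = "set_var vI (int i + 1) (set_var vOUT ((z + d) div ?b)
       (set_arr aOUT (int i) ((z + d) mod ?b - d) (set_var vC ((z + d) mod ?b - d) s')))"
    have fin: "I t1 ?s \<and> M ?s < M s'" if "t1 \<le> t' + 12" for t1
      unfolding I_def M_def using il that i N dec
      by (auto simp: less_Suc_eq intro!: exI[of _ "Suc i"])
    show "wp w H (Assign vC (Bin Mod (Var vOUT \<oplus> Const d) (Const (2 * d + 1)) \<ominus> Const d);;
         Store aOUT (Var vI) (Var vC);;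
         Assign vOUT (Bin Div (Var vOUT \<oplus> Const d) (Const (2 * d + 1)));;
         Assign vI (Var vI \<oplus> Const 1)) (\<lambda>t'' s''. I (Suc t'') s'' \<and> M s'' < M s') (Suc t') s'"
      apply (rule wp_bounded)
      apply (rule wp_Seq, rule wp_Assign)
        apply (use H_b d_pos in simp)
       apply (use cH in \<open>simp add: z_def\<close>)
      apply (rule wp_Seq, rule wp_Store, simp, simp)
       apply (use cH in \<open>simp add: z_def\<close>)
      apply (rule wp_Seq, rule wp_Assign)
        apply (use H_b d_pos in simp)
       apply (use zH in \<open>simp add: z_def\<close>)
      apply (rule wp_Assign, simp)
       apply (use nH il in \<open>simp add: i\<close>)
      apply (use fin fin[OF le_add1] in \<open>simp add: i z_def\<close>)
      done
  next
    fix t' s' assume I: "I t' s'" and e: "evl s' (Bin Less (Var vI) (Var vN)) = 0"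
    then show "Q (Suc t') s'" unfolding I_def Q_def by (auto split: if_splits)
  qed
  then show ?thesis by (simp only: Q_def)
qed

end

section \<open>The program as a function of its two random draws\<close>

definition B1_val :: "int list \<Rightarrow> int \<Rightarrow> int" where
  "B1_val x d = d * (\<Sum>i<length x. \<bar>x ! i\<bar>) + 1"

text \<open>The number of buckets. An exponential with a rational rate is obtained as a power with
  exponent n div q: the constants \<open>c1\<close> and \<open>c2\<close> will be
  \<open>(d + 1) ^ p1\<close> and \<open>(d + 1) ^ p2\<close>, giving rates p1 / q and p2 /
  q.\<close>

definition K_val :: "int \<Rightarrow> int \<Rightarrow> int \<Rightarrow> nat \<Rightarrow> int" where
  "K_val d q c1 n = (d + 1) * c1 ^ (n div nat q)"

text \<open>The length of a block. Sums of box vectors differ by less than \<open>B1_val\<close>,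
  and hits are independent up to a relative error of about this difference over the block length,
  here at most (d + 1)^(-n).\<close>

definition L_val :: "int list \<Rightarrow> int \<Rightarrow> int" where
  "L_val x d = B1_val x d * (d + 1) ^ length x"

text \<open>The summand 1 makes the limit at least 2, so that in a weight-bounded run a nonzero
  vector of sum 0 is examined even if the zero vector comes first.\<close>

definition lim_val :: "int \<Rightarrow> int \<Rightarrow> nat \<Rightarrow> nat" where
  "lim_val q c2 n = nat (c2 ^ (n div nat q) + 1)"

definition program_time :: "int \<Rightarrow> nat \<Rightarrow> nat \<Rightarrow> nat \<Rightarrow> nat" where
  "program_time d n B lm = 36 * n + 60 +
     (2 * n + 1) * (2 * (n * (B * (16 * nat (2 * d + 1) + 8) + 12)) + 40 * B + 24 * lm + 120)"

locale balancing = alg +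
  fixes q A1 A2 c1 c2 :: int and B :: nat
  assumes c12: "1 \<le> c1" "1 \<le> c2" "c1 \<le> H" "c2 \<le> H"
    and KL: "K_val d q c1 (length x) * L_val x d \<le> H"
      "K_val d q c1 (length x) * (2 * int (length x) + 1) \<le> H"
    and B1_H: "2 * B1_val x d * (2 * int (length x) + 1) \<le> H"
    and lim_H: "c2 ^ (length x div nat q) + 1 \<le> H"
    and cbnd: "0 < q" "2 * q \<le> H" "0 \<le> A1" "A1 \<le> H" "0 \<le> A2" "A2 \<le> H"
      "threshold d q (length x) A1 \<le> H" "threshold d q (length x) A2 \<le> H"
    and TL_H: "(2 * int (length x) + 1) * (2 * (int (length x) + 1) * int B) + 2 * d + 1 \<le> H"
    and B_low: "\<And>l pos. l \<le> length x - length x div 2 \<Longrightarrow>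
      length (lev (length x) [-d..d] (\<lambda>c. \<bar>c\<bar>) (threshold d q (length x) A1) pos l) \<le> B"
    and B_high: "\<And>l pos. l \<le> length x - length x div 2 \<Longrightarrow>
      length (lev (length x) [-d..d] (\<lambda>c. d - \<bar>c\<bar>) (threshold d q (length x) A2) pos l) \<le> B"
    and B_box: "\<And>l pos. l \<le> length x - length x div 2 \<Longrightarrow>
      length (lev (length x) [0..d] (\<lambda>c. 0) 0 pos l) \<le> B"
begin

abbreviation "Q \<equiv> K_val d q c1 n * L_val x d"
abbreviation "lm \<equiv> lim_val q c2 n"

lemma B1_val_pos: "0 < B1_val x d"
  using d_pos by (simp add: B1_val_def add_nonneg_pos sum_nonneg)

lemma KL_pos: "0 < K_val d q c1 n" "0 < L_val x d"
  using d_pos c12 B1_val_pos by (auto simp: K_val_def L_val_def)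

lemma KL_H: "K_val d q c1 n \<le> H" "L_val x d \<le> H"
proof -
  have "K_val d q c1 n * 1 \<le> Q" using KL_pos by (intro mult_left_mono) auto
  then show "K_val d q c1 n \<le> H" using KL(1) by linarith
  have "1 * L_val x d \<le> Q" using KL_pos by (intro mult_right_mono) auto
  then show "L_val x d \<le> H" using KL(1) by linarith
qed

lemma int_lm: "int lm = c2 ^ (n div nat q) + 1"
proof -
  have "1 \<le> c2 ^ (n div nat q)" using c12 by (simp add: one_le_power)
  then show ?thesis by (simp add: lim_val_def)
qed

lemma runs:
  assumes "a \<in> {0..<Q}" "r \<in> {0..<Q}"
  shows "runs w H x d q A1 A2 (B1_val x d) (K_val d q c1 n) (L_val x d) a r lm B"
proof -
  have ar: "\<bar>a\<bar> \<le> H" "\<bar>r\<bar> \<le> H" using assms KL(1) by simp_all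
  have lmH: "int lm \<le> H" using int_lm lim_H by simp
  show ?thesis
    by unfold_locales (fact B1_val_def lmH KL_pos KL KL_H ar B1_H cbnd TL_H B_low B_high B_box)+
qed

text \<open>Bridges machine and probability: it depends on the two draws alone, and an unsuccessful
  run of the program implies it.\<close>

definition no_hit :: "int \<Rightarrow> int \<Rightarrow> bool" where
  "no_hit a r \<longleftrightarrow> (\<forall>\<rho> \<le> 2 * n. runs.no_collision x d (set (take lm
     (runs.run_cands x d q A1 A2 (B1_val x d) (K_val d q c1 n) (L_val x d) a r \<rho>))))"

lemma wp_main:
  assumes ar: "a \<in> {0..<Q}" "r \<in> {0..<Q}" and s: "init_state q c1 c2 s"
  shows "wp w H (main_loop d q A1 A2;; write_output d) (\<lambda>t' s'.
     t' \<le> t + (2 * n + 1) * (engine_time B lm + 40) + 12 * n + 6 \<and>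
     (\<forall>c. result_of n s' = Some c \<longrightarrow> is_solution {-d..d} x c) \<and>
     (result_of n s' = None \<longrightarrow> no_hit a r)) t (set_var vR3 r (set_var vA3 a s))"
proof -
  interpret runs w H x d q A1 A2 "B1_val x d" "K_val d q c1 n" "L_val x d" a r lm B
    by (rule runs[OF ar])
  let ?s = "set_var vR3 r (set_var vA3 a s)"
  have 1: "wp w H (main_loop d q A1 A2) (\<lambda>t' s'. inp s' \<and>
     t' \<le> t + (2 * n + 1) * (engine_time B lm + 40) + 1 \<and>
     (vars s' vFLAG \<noteq> 0 \<longrightarrow> good (vars s' vOUT)) \<and>
     (vars s' vFLAG = 0 \<longrightarrow> (\<forall>\<rho> \<le> 2 * n. no_collision (set (take lm (run_cands \<rho>)))))) t ?s"
  proof (rule wp_main_loop)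
    show "consts_in ?s" unfolding consts_in_def using s int_lm
      by (simp add: init_state_def B1_val_def K_val_def L_val_def)
    show "inp ?s" using s by (simp add: init_state_def inp_def)
  qed (use s in \<open>auto simp: init_state_def\<close>)
  show ?thesis
    apply (rule wp_Seq)
    apply (rule wp_mono[OF 1], elim conjE)
    subgoal premises p for t1 s1
    proof (cases "vars s1 vFLAG = 0")
      case True
      show ?thesis
        apply (rule wp_mono[OF wp_write_output[OF p(1)]])
        using True p(2,4) by (auto simp: result_of_def no_hit_def)
    next
      case False
      then obtain g where g: "small d g" "tot x g = 0" "\<exists>p<n. g p \<noteq> 0" "vars s1 vOUT = cod d n g"
        using p(3) by (auto simp: good_def)
      have sol: "is_solution {-d..d} x (map g [0..<n])"
        using g by (auto simp: is_solution_def tot_def small_def abs_le_iff minus_le_iff)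
      show ?thesis
        apply (rule wp_mono[OF wp_write_output[OF p(1), of g]])
         apply (use g in simp)
        subgoal for t2 s2
        proof -
          assume a: "t2 \<le> Suc t1 + 12 * n + 4 \<and> vars s2 vFLAG = vars s1 vFLAG \<and>
            (vars s1 vFLAG \<noteq> 0 \<longrightarrow> (\<forall>p<n. arrs s2 aOUT (int p) = g p))"
          then have "result_of n s2 = Some (map g [0..<n])"
            using False by (auto simp: result_of_def)
          then show ?thesis using a sol p(2) by auto
        qed
        done
    qed
    done
qed

lemma bounded_input: "bounded_state H (input_state x)"
proof -
  have n: "int n \<le> H" using n_le_H by simp
  have "\<bar>x ! i\<bar> \<le> H" if "i < n" for i
  proof -
    have "1 * \<bar>x ! i\<bar> \<le> d * \<bar>x ! i\<bar>" using d_pos by (intro mult_right_mono) auto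
    moreover have "\<bar>x ! i\<bar> \<le> (\<Sum>i<n. \<bar>x ! i\<bar>)" using that by (intro member_le_sum) auto
    then have "d * \<bar>x ! i\<bar> \<le> d * (\<Sum>i<n. \<bar>x ! i\<bar>)" using d_pos by (intro mult_left_mono) auto
    ultimately show ?thesis using H_tot by linarith
  qed
  then show ?thesis using n H_pos by (auto simp: bounded_state_def input_state_def)
qed

text \<open>Once both draws are fixed, everything is deterministic, so the final state is a function
  \<open>F\<close> of the draws. Its behaviour is only described for draws in range.\<close>

lemma steps_program:
  obtains F where
    "\<And>T. program_time d n B lm \<le> T \<Longrightarrow>
      steps w T (program d q A1 A2 c1 c2, input_state x) =
        bind_spmf (spmf_of_set {0..<Q}) (\<lambda>a. bind_spmf (spmf_of_set {0..<Q}) (\<lambda>r.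
          return_spmf (Skip, F a r)))"
    "\<And>a r c. a \<in> {0..<Q} \<Longrightarrow> r \<in> {0..<Q} \<Longrightarrow> result_of n (F a r) = Some c \<Longrightarrow>
      is_solution {-d..d} x c"
    "\<And>a r. a \<in> {0..<Q} \<Longrightarrow> r \<in> {0..<Q} \<Longrightarrow> result_of n (F a r) = None \<Longrightarrow> no_hit a r"
proof -
  let ?main = "main_loop d q A1 A2;; write_output d"
  let ?Q = "Var vK3 \<otimes> Var vL3"
  have qH: "q \<le> H" using cbnd by simp
  have "wp w H (init d q c1 c2) (\<lambda>t' s'. t' \<le> 0 + 24 * n + 40 \<and> init_state q c1 c2 s') 0 (input_state x)"
    by (rule wp_init[OF cbnd(1) qH c12])
      (use KL_H lim_H in \<open>auto simp: K_val_def L_val_def B1_val_def\<close>)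
  then obtain k s1 where k: "(ds w ^^ k) (init d q c1 c2, input_state x) (Skip, s1)"
    "bounded_state H s1" "k \<le> 24 * n + 40" "init_state q c1 c2 s1"
    using bounded_input unfolding wp_def by force
  define T1 where "T1 = (2 * n + 1) * (engine_time B lm + 40) + 12 * n + 6"
  have "\<exists>s'. (\<forall>t \<ge> T1. steps w t (?main, set_var vR3 r (set_var vA3 a s1)) = return_spmf (Skip, s')) \<and>
      (\<forall>c. result_of n s' = Some c \<longrightarrow> is_solution {-d..d} x c) \<and>
      (result_of n s' = None \<longrightarrow> no_hit a r)"
    if ar: "a \<in> {0..<Q}" "r \<in> {0..<Q}" for a r
  proof -
    have bs: "bounded_state H (set_var vR3 r (set_var vA3 a s1))"
      using ar KL by (intro bounded_state_upd k(2)) auto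
    from wp_main[OF ar k(4), of 0, unfolded wp_def, rule_format, OF bs]
    obtain k' s' where k': "(ds w ^^ k') (?main, set_var vR3 r (set_var vA3 a s1)) (Skip, s')"
      "0 + k' \<le> 0 + (2 * n + 1) * (engine_time B lm + 40) + 12 * n + 6"
      "\<forall>c. result_of n s' = Some c \<longrightarrow> is_solution {-d..d} x c"
      "result_of n s' = None \<longrightarrow> no_hit a r"
      by (elim exE conjE) (rule that; assumption)
    then have kT: "k' \<le> T1" by (simp add: T1_def)
    have "\<forall>t\<ge>T1. steps w t (?main, set_var vR3 r (set_var vA3 a s1)) = return_spmf (Skip, s')"
    proof (intro allI impI)
      fix t assume that: "T1 \<le> t"
      have "k' + (t - k') = t" using kT that by linarith
      then show "steps w t (?main, set_var vR3 r (set_var vA3 a s1)) = return_spmf (Skip, s')"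
        using steps_ds[OF k'(1), of "t - k'"] by (simp only: steps_Skip)
    qed
    then show ?thesis using k'(3,4) by (intro exI[of _ s'] conjI)
  qed
  then obtain F where F: "\<And>a r. a \<in> {0..<Q} \<Longrightarrow> r \<in> {0..<Q} \<Longrightarrow>
      (\<forall>t \<ge> T1. steps w t (?main, set_var vR3 r (set_var vA3 a s1)) = return_spmf (Skip, F a r)) \<and>
      (\<forall>c. result_of n (F a r) = Some c \<longrightarrow> is_solution {-d..d} x c) \<and>
      (result_of n (F a r) = None \<longrightarrow> no_hit a r)"
    by metis
  have st: "steps w T (program d q A1 A2 c1 c2, input_state x) =
        bind_spmf (spmf_of_set {0..<Q}) (\<lambda>a. bind_spmf (spmf_of_set {0..<Q}) (\<lambda>r.
          return_spmf (Skip, F a r)))" if T: "program_time d n B lm \<le> T" for T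
  proof -
    have vs: "vars s1 vK3 = K_val d q c1 n" "vars s1 vL3 = L_val x d"
      using k(4) by (auto simp: init_state_def K_val_def L_val_def B1_val_def)
    \<comment> \<open>The 5 steps: dropping the \<open>Skip\<close> left by the initialisation, and
      for each \<open>Rand\<close> the draw and dropping its \<open>Skip\<close>.\<close>
    have "k + 5 + T1 \<le> program_time d n B lm"
      using k(3) by (simp add: program_time_def T1_def engine_time_def algebra_simps)
    then obtain t where t: "T = k + Suc (Suc (Suc (Suc (Suc t))))" "T1 \<le> t"
      using T by (intro that[of "T - k - 5"]) auto
    let ?rest = "Rand vA3 ?Q;; Rand vR3 ?Q;; ?main"
    have "steps w T (program d q A1 A2 c1 c2, input_state x) =
        steps w (Suc (Suc (Suc (Suc (Suc t))))) (Skip;; ?rest, s1)"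
      unfolding t program_def by (rule steps_ds[OF ds_pow_Seq[OF k(1)]])
    also have "\<dots> = steps w (Suc (Suc (Suc (Suc t)))) (?rest, s1)" by simp
    also have "\<dots> = bind_spmf (spmf_of_set {0..<Q}) (\<lambda>a.
        steps w (Suc (Suc t)) (Rand vR3 ?Q;; ?main, set_var vA3 a s1))"
    proof (rule steps_Rand)
      show "eval_exp w s1 ?Q = Some Q" using eval_ok[OF k(2), of ?Q] by (simp add: exp_ok_def vs)
    qed
    also have "\<dots> = bind_spmf (spmf_of_set {0..<Q}) (\<lambda>a. bind_spmf (spmf_of_set {0..<Q}) (\<lambda>r.
        steps w t (?main, set_var vR3 r (set_var vA3 a s1))))"
    proof (rule bind_spmf_cong[OF refl], rule steps_Rand)
      fix a assume "a \<in> set_spmf (spmf_of_set {0..<Q})"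
      then have "bounded_state H (set_var vA3 a s1)"
        using KL by (intro bounded_state_upd k(2)) (auto simp: set_spmf_of_set)
      then show "eval_exp w (set_var vA3 a s1) ?Q = Some Q"
        using eval_ok[of "set_var vA3 a s1" ?Q] by (simp add: exp_ok_def vs)
    qed
    also have "\<dots> = bind_spmf (spmf_of_set {0..<Q}) (\<lambda>a. bind_spmf (spmf_of_set {0..<Q}) (\<lambda>r.
          return_spmf (Skip, F a r)))"
      using F t by (intro bind_spmf_cong refl) (auto simp: set_spmf_of_set)
    finally show ?thesis .
  qed
  show ?thesis by (rule that[of F]) (use st F in auto)
qed

end

section \<open>Sizes and completeness of the lists\<close>

lemma sum_list_concat_map:
  "sum_list (map g (concat zs)) = sum_list (map (\<lambda>z. sum_list (map g z)) zs)"
  by (induction zs) auto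

lemma sum_list_filter_le:
  assumes "\<And>c. c \<in> set cs \<Longrightarrow> 0 \<le> g c"
  shows "sum_list (map g (filter P cs)) \<le> (sum_list (map g cs) :: real)"
  using assms by (induction cs) (auto simp: add_increasing)

text \<open>
  An exponential moment bound: every vector that is listed has weight at most \<open>\<tau>\<close> and hence
  contributes at least \<open>t\<^sup>\<tau>\<close> to the \<open>l\<close>-fold product of the generating function of the weights.
\<close>

lemma length_lev_le:
  fixes t :: real
  assumes t: "0 < t" "t \<le> 1" and tau: "0 \<le> \<tau>"
  shows "real (length (lev n cs f \<tau> pos l)) * t powr \<tau> \<le> (\<Sum>c\<leftarrow>cs. t powr f c) ^ l"
proof -
  let ?\<Phi> = "\<Sum>c\<leftarrow>cs. t powr f c"
  have \<Phi>0: "0 \<le> ?\<Phi>" by (intro sum_list_nonneg) auto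
  have 1: "(\<Sum>z\<leftarrow>lev n cs f \<tau> pos l. t powr real_of_int (snd z)) \<le> ?\<Phi> ^ l"
  proof (induction l)
    case (Suc l)
    have step: "(\<Sum>z'\<leftarrow>ext f \<tau> p cs z. t powr real_of_int (snd z')) \<le> t powr real_of_int (snd z) * ?\<Phi>" for p z
    proof -
      have "(\<Sum>z'\<leftarrow>ext f \<tau> p cs z. t powr real_of_int (snd z')) =
          (\<Sum>c\<leftarrow>filter (\<lambda>c. snd z + f c \<le> \<tau>) cs. t powr real_of_int (snd z + f c))"
        by (cases z) (simp add: ext_def o_def)
      also have "\<dots> \<le> (\<Sum>c\<leftarrow>cs. t powr real_of_int (snd z + f c))" by (rule sum_list_filter_le) auto
      also have "\<dots> = t powr real_of_int (snd z) * ?\<Phi>"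
        by (simp add: powr_add sum_list_const_mult)
      finally show ?thesis .
    qed
    have "(\<Sum>z\<leftarrow>lev n cs f \<tau> pos (Suc l). t powr real_of_int (snd z)) =
        (\<Sum>z\<leftarrow>lev n cs f \<tau> pos l. \<Sum>z'\<leftarrow>ext f \<tau> ((pos + l) mod n) cs z. t powr real_of_int (snd z'))"
      by (simp add: sum_list_concat_map o_def)
    also have "\<dots> \<le> (\<Sum>z\<leftarrow>lev n cs f \<tau> pos l. t powr real_of_int (snd z) * ?\<Phi>)"
      by (intro sum_list_mono step)
    also have "\<dots> = (\<Sum>z\<leftarrow>lev n cs f \<tau> pos l. t powr real_of_int (snd z)) * ?\<Phi>"
      by (simp add: sum_list_mult_const)
    also have "\<dots> \<le> ?\<Phi> ^ l * ?\<Phi>" using Suc \<Phi>0 by (intro mult_right_mono)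
    finally show ?case by (simp add: mult.commute)
  qed (use t in simp)
  have "snd z \<le> \<tau>" if "z \<in> set (lev n cs f \<tau> pos l)" for z
    using that tau by (cases l) (auto simp: ext_def)
  then have "(\<Sum>z\<leftarrow>lev n cs f \<tau> pos l. t powr \<tau>) \<le> (\<Sum>z\<leftarrow>lev n cs f \<tau> pos l. t powr real_of_int (snd z))"
    using t by (intro sum_list_mono powr_mono') auto
  then show ?thesis using 1 by (simp add: sum_list_triv)
qed

lemma distinct_concat_map:
  assumes "distinct zs" "\<And>z. z \<in> set zs \<Longrightarrow> distinct (g z)"
    "\<And>z z' y. z \<in> set zs \<Longrightarrow> z' \<in> set zs \<Longrightarrow> y \<in> set (g z) \<Longrightarrow> y \<in> set (g z') \<Longrightarrow> z = z'"
  shows "distinct (concat (map g zs))"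
  using assms
proof (induction zs)
  case (Cons z zs)
  have "distinct (concat (map g zs))" using Cons.prems by (intro Cons.IH) auto
  moreover have "set (g z) \<inter> set (concat (map g zs)) = {}"
    using Cons.prems(1,3) by fastforce
  ultimately show ?case using Cons.prems(2) by simp
qed simp

lemma inj_on_add_mod: "l \<le> n \<Longrightarrow> inj_on (\<lambda>i. (m + i) mod n) {..<l :: nat}"
  by (rule inj_onI, rule mod_add_left_cancel[of m _ n]) auto

text \<open>A discrete intermediate value argument: averaged over all rotations a window of length h
  has sum h W / n for the total W, and shifting it by one position raises the sum by at most d.
  Hence some window is below the average by at most d.\<close>

lemma window_balance:
  fixes g :: "nat \<Rightarrow> int"
  assumes g: "\<And>p. 0 \<le> g p" "\<And>p. g p \<le> d" and h: "h \<le> n" and n: "0 < n"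
  shows "\<exists>j<n. int n * (\<Sum>i<h. g ((j + i) mod n)) \<le> int h * (\<Sum>p<n. g p) \<and>
     int h * (\<Sum>p<n. g p) - int n * d \<le> int n * (\<Sum>i<h. g ((j + i) mod n))"
proof -
  define win where "win = (\<lambda>j. \<Sum>i<h. g ((j + i) mod n))"
  let ?W = "\<Sum>p<n. g p"
  have shift: "(\<Sum>j<n. g ((j + i) mod n)) = ?W" for i
  proof (rule sum.reindex_bij_betw[of "\<lambda>j. (j + i) mod n" "{..<n}" "{..<n}" g])
    have "inj_on (\<lambda>j. (j + i) mod n) {..<n}"
      using inj_on_add_mod[of n n i] by (simp add: add.commute)
    moreover have "(\<lambda>j. (j + i) mod n) ` {..<n} \<subseteq> {..<n}" using n by auto
    ultimately show "bij_betw (\<lambda>j. (j + i) mod n) {..<n} {..<n}"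
      by (simp add: bij_betw_def endo_inj_surj)
  qed
  have total: "(\<Sum>j<n. win j) = int h * ?W"
    unfolding win_def by (subst sum.swap) (simp add: shift)
  have step: "win (Suc j) \<le> win j + d" for j
  proof -
    have "win (Suc j) + g (j mod n) = (\<Sum>i<Suc h. g ((j + i) mod n))"
      unfolding win_def sum.lessThan_Suc_shift by simp
    also have "\<dots> = win j + g ((j + h) mod n)" by (simp add: win_def)
    finally show ?thesis using g[of "j mod n"] g[of "(j + h) mod n"] by linarith
  qed
  have per: "win (j mod n) = win j" for j by (simp add: win_def mod_add_left_eq)
  obtain j0 where j0: "j0 < n" "int n * win j0 \<le> int h * ?W"
  proof (rule ccontr)
    assume "\<not> thesis"
    then have "\<And>j. j < n \<Longrightarrow> int h * ?W < int n * win j" using that by force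
    then have "(\<Sum>j<n. int h * ?W) < (\<Sum>j<n. int n * win j)"
      using n by (intro sum_strict_mono) auto
    then show False by (simp add: sum_distrib_left[symmetric] total)
  qed
  obtain j1 where j1: "j1 < n" "int h * ?W \<le> int n * win j1"
  proof (rule ccontr)
    assume "\<not> thesis"
    then have "\<And>j. j < n \<Longrightarrow> int n * win j < int h * ?W" using that by force
    then have "(\<Sum>j<n. int n * win j) < (\<Sum>j<n. int h * ?W)"
      using n by (intro sum_strict_mono) auto
    then show False by (simp add: sum_distrib_left[symmetric] total)
  qed
  \<comment> \<open>Starting at a window not above the average, the first one that reaches it is
    considered. Its predecessor is below the average and at most d away; if there is no predecessor,
    the start itself is exactly average.\<close>
  let ?P = "\<lambda>k. int h * ?W \<le> int n * win (j0 + k)"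
  have "?P (n + j1 - j0)" using j0 j1 per[of "n + j1"] per[of j1] by simp
  then have P: "?P (LEAST k. ?P k)" by (rule LeastI)
  obtain j where j: "int n * win j \<le> int h * ?W" "int h * ?W - int n * d \<le> int n * win j"
  proof (cases "LEAST k. ?P k")
    case 0
    then show ?thesis using P j0 n g(1)[of 0] g(2)[of 0]
      by (intro that[of j0]) (auto intro: order_trans[of _ "int h * ?W"])
  next
    case (Suc k)
    then have "\<not> ?P k" using not_less_Least[of k ?P] by simp
    moreover have "int n * win (Suc (j0 + k)) \<le> int n * (win (j0 + k) + d)"
      using step by (intro mult_left_mono) auto
    ultimately show ?thesis using P Suc by (intro that[of "j0 + k"]) (auto simp: algebra_simps)
  qed
  show ?thesis
    using j n per[of j] by (intro exI[of _ "j mod n"]) (simp add: win_def mod_add_left_eq)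
qed

section \<open>Distinctness and completeness of the lists\<close>

context alg
begin

text \<open>The new position is 0 in every parent, so resetting it recovers the parent from the
  child. Distinctness is used to see that the zero vector can occupy only one place among the
  candidates.\<close>

lemma distinct_lev:
  assumes "\<And>c. \<bar>c\<bar> \<le> d \<Longrightarrow> 0 \<le> f c \<and> f c \<le> d" "- d \<le> lo" "l \<le> n"
  shows "distinct (map fst (lev n [lo..d] f \<tau> pos l))"
  using assms(3)
proof (induction l)
  case (Suc l)
  let ?p = "(pos + l) mod n"
  let ?L = "lev n [lo..d] f \<tau> pos l"
  let ?g = "\<lambda>z. map (\<lambda>c. (fst z)(?p := c)) (filter (\<lambda>c. snd z + f c \<le> \<tau>) [lo..d])"
  have e: "map fst (lev n [lo..d] f \<tau> pos (Suc l)) = concat (map ?g ?L)"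
    by (simp add: ext_def map_concat o_def case_prod_beta)
  have zero: "fst z ?p = 0" if "z \<in> set ?L" for z
  proof -
    have "(fst z, snd z) \<in> set ?L" "l \<le> n" using that Suc.prems by auto
    from lev_props[OF assms(1,2) this(2,1)] show ?thesis
      using positions_new[of l pos] Suc.prems by auto
  qed
  have "distinct (concat (map ?g ?L))"
  proof (rule distinct_concat_map)
    show "distinct ?L" using Suc by (simp add: distinct_map)
    show "distinct (?g z)" for z
    proof -
      have "c = c'" if "(fst z)(?p := c) = (fst z)(?p := c')" for c c'
        using fun_cong[OF that, of ?p] by simp
      then have "inj (\<lambda>c. (fst z)(?p := c))" by (auto simp: inj_on_def)
      then show ?thesis by (auto simp: distinct_map intro: inj_on_subset)
    qed
    fix z z' y assume z: "z \<in> set ?L" "z' \<in> set ?L" and y: "y \<in> set (?g z)" "y \<in> set (?g z')"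
    have "fst z = y(?p := 0)" if z: "z \<in> set ?L" and "y \<in> set (?g z)" for z
    proof -
      obtain c where "y = (fst z)(?p := c)" using \<open>y \<in> set (?g z)\<close> by auto
      then show ?thesis using zero[OF z] by auto
    qed
    then have "fst z = fst z'" using z y by metis
    then show "z = z'" using z Suc by (auto simp: distinct_map inj_on_def)
  qed
  then show ?case by (simp only: e)
qed simp

lemma lev_complete:
  assumes f: "\<And>c. \<bar>c\<bar> \<le> d \<Longrightarrow> 0 \<le> f c \<and> f c \<le> d" and "l \<le> n"
    "\<And>p. p \<notin> positions pos l \<Longrightarrow> y p = 0" "\<And>p. p \<in> positions pos l \<Longrightarrow> lo \<le> y p" "small d y"
    "(\<Sum>p\<in>positions pos l. f (y p)) \<le> \<tau>"
  shows "(y, \<Sum>p\<in>positions pos l. f (y p)) \<in> set (lev n [lo..d] f \<tau> pos l)"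
  using assms(2-)
proof (induction l arbitrary: y)
  case 0
  then show ?case by (auto simp: positions_def fun_eq_iff)
next
  case (Suc l)
  let ?p = "(pos + l) mod n"
  have new: "?p \<notin> positions pos l" using positions_new Suc.prems by simp
  have fin: "finite (positions pos l)" by (simp add: positions_def)
  let ?y = "y(?p := 0)"
  have yd: "\<bar>y p\<bar> \<le> d" for p using Suc.prems by (simp add: small_def)
  have sum: "(\<Sum>p\<in>positions pos (Suc l). f (y p)) = f (y ?p) + (\<Sum>p\<in>positions pos l. f (?y p))"
    using new fin by (auto simp: positions_Suc intro!: sum.cong)
  have mem: "(?y, \<Sum>p\<in>positions pos l. f (?y p)) \<in> set (lev n [lo..d] f \<tau> pos l)"
  proof (rule Suc.IH)
    show "small d ?y" using Suc.prems d_pos by (simp add: small_def)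
    show "(\<Sum>p\<in>positions pos l. f (?y p)) \<le> \<tau>" using Suc.prems(5) sum f[OF yd[of ?p]] by simp
    show "?y p = 0" if "p \<notin> positions pos l" for p
      using Suc.prems(2)[of p] that by (auto simp: positions_Suc)
    show "lo \<le> ?y p" if "p \<in> positions pos l" for p
      using Suc.prems(3)[of p] that new by (auto simp: positions_Suc)
  qed (use Suc.prems in auto)
  have "lo \<le> y ?p" "y ?p \<le> d"
    using Suc.prems(3)[of ?p] yd[of ?p] by (auto simp: positions_Suc)
  then have "(?y(?p := y ?p), (\<Sum>p\<in>positions pos l. f (?y p)) + f (y ?p)) \<in>
      set (ext f \<tau> ?p [lo..d] (?y, \<Sum>p\<in>positions pos l. f (?y p)))"
    using Suc.prems(5) unfolding sum ext_def prod.case set_map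
    by (intro image_eqI[of _ _ "y ?p"]) (auto simp: add.commute)
  then have "(y, (\<Sum>p\<in>positions pos l. f (?y p)) + f (y ?p)) \<in>
      set (ext f \<tau> ?p [lo..d] (?y, \<Sum>p\<in>positions pos l. f (?y p)))"
    unfolding fun_upd_upd fun_upd_triv .
  then show ?case
    using mem unfolding sum lev.simps set_concat set_map add.commute[of "f (y ?p)"] by blast
qed

lemma sum_positions:
  assumes "l \<le> n"
  shows "(\<Sum>p\<in>positions pos l. g p) = (\<Sum>i<l. g ((pos + i) mod n))"
  unfolding positions_def by (subst sum.reindex[OF inj_on_add_mod[OF assms]]) simp

lemma positions_split:
  assumes "0 < n"
  shows "positions pos (n div 2) \<union> positions (pos + n div 2) (n - n div 2) = {..<n}"
proof -
  have "positions pos (n div 2) \<union> positions (pos + n div 2) (n - n div 2) = positions pos n"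
  proof -
    have "{..<n} = {..<n div 2} \<union> (\<lambda>j. n div 2 + j) ` {..<n - n div 2}"
    proof (intro set_eqI iffI)
      fix i assume "i \<in> {..<n}"
      then show "i \<in> {..<n div 2} \<union> (\<lambda>j. n div 2 + j) ` {..<n - n div 2}"
        by (cases "i < n div 2") (auto intro!: image_eqI[of _ _ "i - n div 2"])
    qed auto
    then show ?thesis unfolding positions_def by (simp add: image_Un image_image add.assoc)
  qed
  also have "\<dots> = {..<n}"
  proof -
    have "inj_on (\<lambda>k. (pos + k) mod n) {..<n}"
      by (rule inj_on_add_mod) simp
    moreover have "(\<lambda>k. (pos + k) mod n) ` {..<n} \<subseteq> {..<n}" using assms by auto
    ultimately show ?thesis unfolding positions_def by (simp add: endo_inj_surj)
  qed
  finally show ?thesis .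
qed

text \<open>Write the two residues as L k + remainder. Their sum is K L e + \<rho> with \<rho> < L,
  so L (K e - k1 - k2) equals the sum of the two remainders minus \<rho>, which lies strictly
  between -L and 2 L. Hence K e - k1 - k2 is 0 or 1, the carry out of the low part.\<close>

lemma key_sum:
  assumes "0 < K" "0 < L" "(a * (tot x u + tot x v) + r) mod (K * L) < L"
  shows "key x K L a 0 u = (0 - key x K L a r v) mod K \<or>
     key x K L a 0 u = (-1 - key x K L a r v) mod K"
proof -
  let ?m = "K * L"
  define \<alpha> where "\<alpha> = (a * tot x u) mod ?m"
  define \<beta> where "\<beta> = (a * tot x v + r) mod ?m"
  define k1 where "k1 = \<alpha> div L"
  define k2 where "k2 = \<beta> div L"
  define e where "e = (\<alpha> + \<beta>) div ?m"
  define \<rho> where "\<rho> = (\<alpha> + \<beta>) mod ?m"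
  have keys: "key x K L a 0 u = k1" "key x K L a r v = k2"
    by (simp_all add: key_def k1_def k2_def \<alpha>_def \<beta>_def)
  have "\<rho> = (a * (tot x u + tot x v) + r) mod ?m"
    unfolding \<rho>_def \<alpha>_def \<beta>_def by (simp add: mod_add_eq algebra_simps)
  then have \<rho>: "0 \<le> \<rho>" "\<rho> < L" using assms by (auto simp: \<rho>_def)
  have s: "\<alpha> = L * k1 + \<alpha> mod L" "\<beta> = L * k2 + \<beta> mod L" by (simp_all add: k1_def k2_def)
  have sb: "0 \<le> \<alpha> mod L" "\<alpha> mod L < L" "0 \<le> \<beta> mod L" "\<beta> mod L < L" using assms by auto
  have e: "\<alpha> + \<beta> = ?m * e + \<rho>" by (simp add: e_def \<rho>_def)
  define D where "D = K * e - k1 - k2"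
  have "L * D = K * L * e - L * k1 - L * k2" by (simp add: D_def algebra_simps)
  then have LD: "L * D = \<alpha> mod L + \<beta> mod L - \<rho>" using s e by linarith
  have "L * (-1) < L * D" "L * D < L * 2" using LD sb \<rho> by linarith+
  then have "-1 < D" "D < 2" using assms(2) mult_less_cancel_left_pos by blast+
  then have D: "D = 0 \<or> D = 1" by linarith
  have "k1 = (- D - k2) + K * e" by (simp add: D_def)
  then have "k1 mod K = (- D - k2) mod K" by simp
  moreover have "0 \<le> k1" "k1 < K" using key_bounds[OF assms(1,2), of a 0 u] keys by auto
  ultimately have "k1 = (- D - k2) mod K" by simp
  then show ?thesis unfolding keys using D by auto
qed

end

section \<open>Completeness of the runs\<close>

context runs
begin

lemma split_vec:
  assumes n: "0 < n" and y: "small d y" "\<And>p. n \<le> p \<Longrightarrow> y p = 0" "\<And>p. p < n \<Longrightarrow> lo_of \<rho> \<le> y p"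
    and w: "(\<Sum>p\<in>positions (pos_of \<rho>) (n div 2). w0_of \<rho> + w1_of \<rho> * \<bar>y p\<bar>) \<le> tau_of \<rho>"
      "(\<Sum>p\<in>positions (pos_of \<rho> + n div 2) (n - n div 2). w0_of \<rho> + w1_of \<rho> * \<bar>y p\<bar>) \<le> tau_of \<rho>"
  obtains u v where "u \<in> set (half_list \<rho> 0 (n div 2))" "v \<in> set (half_list \<rho> (n div 2) (n - n div 2))"
    "y = add v u"
proof -
  let ?h = "n div 2" and ?pos = "pos_of \<rho>"
  let ?P1 = "positions ?pos ?h" and ?P2 = "positions (?pos + ?h) (n - ?h)"
  define u where "u = (\<lambda>p. if p \<in> ?P1 then y p else 0)"
  define v where "v = (\<lambda>p. if p \<in> ?P2 then y p else 0)"
  have split: "?P1 \<union> ?P2 = {..<n}" using positions_split n by blast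
  have sm: "small d u" "small d v" using y(1) d_pos by (auto simp: small_def u_def v_def)
  have lo: "lo_of \<rho> \<le> y p" if "p \<in> ?P1 \<union> ?P2" for p using y(3) that split by auto
  have "(u, \<Sum>p\<in>?P1. w0_of \<rho> + w1_of \<rho> * \<bar>u p\<bar>) \<in> set (lev n [lo_of \<rho>..d]
      (\<lambda>c. w0_of \<rho> + w1_of \<rho> * \<bar>c\<bar>) (tau_of \<rho>) ?pos ?h)"
    by (rule lev_complete[OF weight_bounds _ _ _ sm(1)]) (use w lo in \<open>auto simp: u_def\<close>)
  then have "u \<in> set (half_list \<rho> 0 ?h)" unfolding half_list_def by force
  moreover have "(v, \<Sum>p\<in>?P2. w0_of \<rho> + w1_of \<rho> * \<bar>v p\<bar>) \<in> set (lev n [lo_of \<rho>..d]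
      (\<lambda>c. w0_of \<rho> + w1_of \<rho> * \<bar>c\<bar>) (tau_of \<rho>) (?pos + ?h) (n - ?h))"
    by (rule lev_complete[OF weight_bounds _ _ _ sm(2)]) (use w lo in \<open>auto simp: v_def\<close>)
  then have "v \<in> set (half_list \<rho> ?h (n - ?h))" unfolding half_list_def by force
  moreover have "y = add v u"
  proof
    fix p
    show "y p = add v u p"
    proof -
      have "p \<in> ?P1 \<or> p \<in> ?P2 \<or> p \<notin> ?P1 \<and> p \<notin> ?P2 \<and> y p = 0"
        using y(2)[of p] split by (metis UnI1 UnI2 UnE lessThan_iff linorder_not_le)
      moreover have "\<not> (p \<in> ?P1 \<and> p \<in> ?P2)" using positions_disjoint[of p ?pos] by blast
      ultimately show ?thesis unfolding u_def v_def add_def by (elim disjE) simp_all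
    qed
  qed
  ultimately show thesis by (rule that)
qed

lemma distinct_half_list: "l \<le> n \<Longrightarrow> distinct (half_list \<rho> off l)"
  unfolding half_list_def by (rule distinct_lev[OF weight_bounds lo_bounds(1)])

lemma add_inj:
  assumes "u \<in> set (half_list \<rho> 0 (n div 2))" "v \<in> set (half_list \<rho> (n div 2) (n - n div 2))"
    "u' \<in> set (half_list \<rho> 0 (n div 2))" "v' \<in> set (half_list \<rho> (n div 2) (n - n div 2))"
    "add v u = add v' u'"
  shows "u = u' \<and> v = v'"
proof -
  have z: "u p = 0 \<and> u' p = 0 \<or> v p = 0 \<and> v' p = 0" for p
    using half_list_props(2)[OF assms(1)] half_list_props(2)[OF assms(2)]
      half_list_props(2)[OF assms(3)] half_list_props(2)[OF assms(4)]
      positions_disjoint[of p "pos_of \<rho>"] by (metis add_0_right div_le_dividend diff_le_self)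
  have "u p + v p = u' p + v' p" for p using fun_cong[OF assms(5), of p] by (simp add: add_def)
  then have "u p = u' p \<and> v p = v' p" if "u p = 0 \<and> u' p = 0 \<or> v p = 0 \<and> v' p = 0" for p
    using that by (metis add_0 add_0_right)
  then show ?thesis using z by blast
qed

text \<open>The halves have disjoint supports and are determined by their sum, and the two lookups
  go to different buckets because keys that differ by 1 differ modulo K.\<close>

lemma distinct_run_cands:
  assumes "2 \<le> K_of \<rho>"
  shows "distinct (run_cands \<rho>)"
proof -
  let ?us = "half_list \<rho> 0 (n div 2)" and ?vs = "half_list \<rho> (n div 2) (n - n div 2)"
  have d: "distinct ?us" "distinct ?vs" by (rule distinct_half_list; simp)+
  show ?thesis unfolding run_cands_def cands_def
  proof (rule distinct_concat_map[OF d(2)])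
    fix v assume v: "v \<in> set ?vs"
    let ?q = "key x (K_of \<rho>) (L_of \<rho>) (a_of \<rho>) (r_of \<rho>) v"
    have neq: "(0 - ?q) mod K_of \<rho> \<noteq> (-1 - ?q) mod K_of \<rho>"
    proof
      assume "(0 - ?q) mod K_of \<rho> = (-1 - ?q) mod K_of \<rho>"
      then have "K_of \<rho> dvd 1" by (simp add: mod_eq_dvd_iff)
      then show False using assms by (auto dest: zdvd_imp_le)
    qed
    have inj: "inj_on (add v) (set ?us)" using add_inj[OF _ v _ v] by (auto simp: inj_on_def)
    have dis: "distinct (map (add v) (rev (filter P ?us)) @ map (add v) (rev (filter P' ?us)))"
      if "inj_on (add v) (set ?us)" "\<And>u. \<not> (P u \<and> P' u)" for P P'
      using that d(1) by (auto simp: distinct_map inj_on_def)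
    show "distinct (cands_of x (K_of \<rho>) (L_of \<rho>) (a_of \<rho>) (r_of \<rho>) ?us v)"
      unfolding cands_of_def Let_def by (rule dis[OF inj]) (use neq in metis)
  next
    fix v v' y
    assume "v \<in> set ?vs" "v' \<in> set ?vs"
      "y \<in> set (cands_of x (K_of \<rho>) (L_of \<rho>) (a_of \<rho>) (r_of \<rho>) ?us v)"
      "y \<in> set (cands_of x (K_of \<rho>) (L_of \<rho>) (a_of \<rho>) (r_of \<rho>) ?us v')"
    then show "v = v'" using add_inj[of _ \<rho> v _ v'] unfolding cands_of_def Let_def by auto
  qed
qed

lemma run_cands_zero:
  assumes "y \<in> set (run_cands \<rho>)" "n \<le> p"
  shows "y p = 0"
proof -
  obtain u v where uv: "u \<in> set (half_list \<rho> 0 (n div 2))"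
    "v \<in> set (half_list \<rho> (n div 2) (n - n div 2))" "y = add v u"
    using assms(1) by (auto simp: run_cands_def cands_mem)
  have "p \<notin> positions pos l" if "l \<le> n" for pos l
  proof
    assume "p \<in> positions pos l"
    then obtain k where "k < l" "p = (pos + k) mod n" by (auto simp: positions_def)
    then have "p < n" using that mod_less_divisor[of n "pos + k"] by linarith
    then show False using assms(2) by simp
  qed
  then show ?thesis
    using half_list_props(2)[OF uv(1)] half_list_props(2)[OF uv(2)] uv(3) by (simp add: add_def)
qed

text \<open>The rotation from \<open>window_balance\<close> puts both halves of \<open>c\<close>
  below the threshold, so \<open>c\<close> is among the candidates of that run. All of these have
  sum 0; without a collision the examined ones have code 0 and are the zero vector. Being distinct,
  there is at most one, so the limit was not reached and \<open>c\<close> was examined, a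
  contradiction.\<close>

lemma low_run_complete:
  assumes c: "small d c" "\<And>p. n \<le> p \<Longrightarrow> c p = 0" "tot x c = 0" "\<exists>p<n. c p \<noteq> 0" and lm: "2 \<le> lm"
    and w: "q * (\<Sum>p<n. \<bar>c p\<bar>) \<le> A1 * int n \<or> q * (\<Sum>p<n. d - \<bar>c p\<bar>) \<le> A2 * int n"
  shows "\<exists>\<rho><2 * n. \<not> no_collision (set (take lm (run_cands \<rho>)))"
proof -
  let ?h = "n div 2"
  define low where "low \<longleftrightarrow> q * (\<Sum>p<n. \<bar>c p\<bar>) \<le> A1 * int n"
  define g where "g = (\<lambda>p. if low then \<bar>c p\<bar> else d - \<bar>c p\<bar>)"
  define A where "A = (if low then A1 else A2)"
  have n: "0 < n" using c(4) by auto
  have cd: "\<bar>c p\<bar> \<le> d" for p using c(1) by (simp add: small_def)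
  have W: "q * (\<Sum>p<n. g p) \<le> A * int n" using w by (auto simp: g_def A_def low_def)
  have g: "0 \<le> g p" "g p \<le> d" for p using cd[of p] by (auto simp: g_def)
  let ?W = "\<Sum>p<n. g p"
  obtain j where j: "j < n" "int n * (\<Sum>i<?h. g ((j + i) mod n)) \<le> int ?h * ?W"
    "int ?h * ?W - int n * d \<le> int n * (\<Sum>i<?h. g ((j + i) mod n))"
    using window_balance[of g d ?h n] g n by auto
  define \<rho> where "\<rho> = 2 * j + (if low then 1 else 0)"
  have \<rho>: "\<rho> < 2 * n" "pos_of \<rho> = j" "odd \<rho> \<longleftrightarrow> low" using j by (auto simp: \<rho>_def pos_of_def)
  have wg: "w0_of \<rho> + w1_of \<rho> * \<bar>c p\<bar> = g p" for p using \<rho> by (simp add: w0_of_def w1_of_def g_def)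
  have tau: "tau_of \<rho> = threshold d q n A" using \<rho> by (simp add: tau_of_def A_def)
  let ?a = "\<Sum>p\<in>positions j ?h. g p" and ?b = "\<Sum>p\<in>positions (j + ?h) (n - ?h). g p"
  have a: "?a = (\<Sum>i<?h. g ((j + i) mod n))" by (rule sum_positions) simp
  have "?a + ?b = (\<Sum>p\<in>positions j ?h \<union> positions (j + ?h) (n - ?h). g p)"
    using positions_disjoint[of _ j]
    by (intro sum.union_disjoint[symmetric]) (auto simp: positions_def[of _ "n div 2"] positions_def[of _ "n - n div 2"])
  then have ab: "?a + ?b = ?W" using positions_split[OF n, of j] by simp
  have W0: "0 \<le> ?W" "?W \<le> int n * d"
    using g sum_bounded_above[of "{..<n}" g d] by (auto intro: sum_nonneg)
  \<comment> \<open>As q W \<le> A n, the premise gives s \<le> A n / (2 q) + 3 d / 2, and the slack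
    2 d + 1 absorbs 3 d / 2 and the rounding.\<close>
  have le: "s \<le> threshold d q n A" if "2 * s \<le> ?W + 3 * d" for s
  proof -
    have "q * (2 * s) \<le> q * (?W + 3 * d)" using that cbnd by (intro mult_left_mono) auto
    then have "2 * q * s \<le> A * int n + 3 * d * q" using W by (simp add: algebra_simps)
    moreover have "A * int n < 2 * q * ((A * int n) div (2 * q) + 1)"
    proof -
      have "(A * int n) mod (2 * q) < 2 * q" using cbnd by (intro pos_mod_bound) simp
      then show ?thesis
        using mult_div_mod_eq[of "2 * q" "A * int n"] unfolding distrib_left mult_1_right by linarith
    qed
    ultimately have "2 * q * s < 2 * q * ((A * int n) div (2 * q) + 1) + 3 * d * q" by linarith
    also have "\<dots> \<le> 2 * q * ((A * int n) div (2 * q) + 1) + 4 * d * q" using d_pos cbnd by simp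
    also have "\<dots> = 2 * q * ((A * int n) div (2 * q) + 1 + 2 * d)" by (simp add: algebra_simps)
    finally show ?thesis using cbnd by (simp add: threshold_def)
  qed
  have h2: "2 * int ?h \<le> int n" "int n \<le> 2 * int ?h + 1" by linarith+
  have 1: "?a \<le> tau_of \<rho>"
    unfolding tau
  proof (rule le)
    have "2 * int ?h * ?W \<le> int n * ?W" using h2 W0 by (intro mult_right_mono) auto
    then have "2 * (int ?h * ?W) \<le> int n * ?W" by (simp only: mult.assoc)
    then have "2 * (int n * ?a) \<le> int n * ?W" using j(2)[folded a] by linarith
    then have "int n * (2 * ?a) \<le> int n * ?W" by (simp only: mult.left_commute)
    then have "2 * ?a \<le> ?W" using n by simp
    then show "2 * ?a \<le> ?W + 3 * d" using d_pos by linarith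
  qed
  \<comment> \<open>Twice the second half exceeds \<open>?W\<close> by at most 2 d for the inexact
    rotation and by W / n \<le> d for odd n.\<close>
  have 2: "?b \<le> tau_of \<rho>"
    unfolding tau
  proof (rule le)
    have "int n * ?W \<le> (2 * int ?h + 1) * ?W" using h2 W0 by (intro mult_right_mono) auto
    then have "int n * ?W \<le> 2 * (int ?h * ?W) + ?W" by (simp add: algebra_simps)
    moreover have "int n * ?a + int n * ?b = int n * ?W" by (simp only: distrib_left[symmetric] ab)
    ultimately have "2 * (int n * ?b) \<le> int n * ?W + 3 * (int n * d)" using j(3)[folded a] W0 by linarith
    then have "int n * (2 * ?b) \<le> int n * (?W + 3 * d)" by (simp add: algebra_simps)
    then show "2 * ?b \<le> ?W + 3 * d" using n by simp
  qed
  obtain u v where uv: "u \<in> set (half_list \<rho> 0 ?h)" "v \<in> set (half_list \<rho> ?h (n - ?h))" "c = add v u"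
  proof (rule split_vec[OF n c(1,2)])
    show "lo_of \<rho> \<le> c p" for p using cd[of p] \<rho> by (simp add: lo_of_def)
  qed (use 1 2 in \<open>auto simp: wg \<rho>\<close>)
  have "tot x u = - tot x v" using c(3) uv(3) by (simp add: tot_add)
  then have "key x (2 * B1) 1 2 0 u = (0 - key x (2 * B1) 1 2 0 v) mod (2 * B1)"
    using mod_diff_right_eq[of 0 "2 * tot x v" "2 * B1"] by (simp add: key_def del: mod_mult_mult1)
  then have mem: "c \<in> set (run_cands \<rho>)"
    using uv \<rho> unfolding run_cands_def cands_mem by (auto simp: K_of_def L_of_def a_of_def r_of_def)
  have "\<not> no_collision (set (take lm (run_cands \<rho>)))"
  proof
    assume nc: "no_collision (set (take lm (run_cands \<rho>)))"
    have zero: "y = (\<lambda>_. 0)" if y: "y \<in> set (take lm (run_cands \<rho>))" for y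
    proof -
      have yr: "y \<in> set (run_cands \<rho>)" using y by (rule in_set_takeD)
      have sm: "small d y" "tot x y = 0" using run_cands_low[OF \<rho>(1) yr] by auto
      have c0: "cod d n y = 0" using nc y sm(2) unfolding no_collision_def by blast
      have "y p = 0" for p
      proof (cases "p < n")
        case True
        then show ?thesis using cod_eq_0[OF sm(1) _ c0] d_pos by simp
      next
        case False
        then show ?thesis using run_cands_zero[OF yr] by simp
      qed
      then show ?thesis by (simp add: fun_eq_iff)
    qed
    have "K_of \<rho> \<ge> 2" using \<rho> B1_pos by (simp add: K_of_def)
    then have "distinct (take lm (run_cands \<rho>))" by (intro distinct_take distinct_run_cands)
    then have "length (take lm (run_cands \<rho>)) = card (set (take lm (run_cands \<rho>)))"
      by (simp add: distinct_card)
    also have "\<dots> \<le> card {\<lambda>_ :: nat. 0 :: int}" using zero by (intro card_mono) auto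
    finally have "take lm (run_cands \<rho>) = run_cands \<rho>" using lm by (simp split: if_splits)
    then show False using zero mem c(4) by force
  qed
  then show ?thesis using \<rho>(1) by blast
qed

lemma box_run_complete:
  assumes n: "0 < n" and y: "\<And>p. 0 \<le> y p \<and> y p \<le> d" "\<And>p. n \<le> p \<Longrightarrow> y p = 0"
    and hit: "(a3 * tot x y + r3) mod (K3 * L3) < L3"
  shows "y \<in> set (run_cands (2 * n))"
proof -
  obtain u v where uv: "u \<in> set (half_list (2 * n) 0 (n div 2))"
    "v \<in> set (half_list (2 * n) (n div 2) (n - n div 2))" "y = add v u"
  proof (rule split_vec[where \<rho> = "2 * n", OF n _ y(2)])
    show "small d y" using y(1) by (simp add: small_def)
  qed (use y in \<open>auto simp: lo_of_def w0_of_def w1_of_def tau_of_def\<close>)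
  show ?thesis
    using uv key_sum[OF KL3(1,2), of a3 u v r3] hit unfolding run_cands_def cands_mem
    by (auto simp: K_of_def L_of_def a_of_def r_of_def tot_add)
qed

end

section \<open>The hash function\<close>

lemma card_shift:
  fixes Q :: int
  assumes "0 < Q"
  shows "card {r \<in> {0..<Q}. P ((c + r) mod Q)} = card {r \<in> {0..<Q}. P r}"
proof -
  let ?f = "\<lambda>r. (c + r) mod Q"
  have inj: "inj_on ?f {0..<Q}"
  proof (rule inj_onI)
    fix r s assume rs: "r \<in> {0..<Q}" "s \<in> {0..<Q}" "?f r = ?f s"
    then have "Q dvd (c + r) - (c + s)" by (simp only: mod_eq_dvd_iff)
    then have "Q dvd r - s" by simp
    then have "r mod Q = s mod Q" by (simp only: mod_eq_dvd_iff)
    then show "r = s" using rs by simp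
  qed
  have "?f ` {r \<in> {0..<Q}. P (?f r)} = {r \<in> {0..<Q}. P r}"
  proof (intro set_eqI iffI)
    fix s assume s: "s \<in> {r \<in> {0..<Q}. P r}"
    have "?f ((s - c) mod Q) = s" using s by (simp add: mod_add_right_eq)
    moreover have "(s - c) mod Q \<in> {0..<Q}" using assms by simp
    ultimately show "s \<in> ?f ` {r \<in> {0..<Q}. P (?f r)}" using s by (auto intro!: image_eqI[of _ ?f "(s - c) mod Q"])
  qed (use assms in auto)
  moreover have "inj_on ?f {r \<in> {0..<Q}. P (?f r)}" by (rule inj_on_subset[OF inj]) auto
  ultimately show ?thesis using card_image by fastforce
qed

text \<open>With g = gcd(\<Delta>, Q), the residues u + a \<Delta> stay in one class modulo g, and
  each determines a modulo Q / g. So \<open>?\<phi>\<close>, the quotient of the residue by g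
  together with the period of a, is injective. Below L there are at most (L - 1) / g + 1 such
  residues, each taken at most g times, and g \<le> |\<Delta>|.\<close>

lemma card_multiples_in_interval:
  fixes Q :: int
  assumes "0 < Q" "0 < L" "\<Delta> \<noteq> 0"
  shows "int (card {a \<in> {0..<Q}. (u + a * \<Delta>) mod Q < L}) \<le> L + \<bar>\<Delta>\<bar>"
proof -
  define g where "g = gcd \<Delta> Q"
  have g: "0 < g" "g dvd \<Delta>" "g dvd Q" using assms by (auto simp: g_def)
  define M where "M = Q div g"
  have Q: "Q = g * M" using g by (simp add: M_def)
  have M: "0 < M" using assms(1) g(1) by (simp add: Q zero_less_mult_iff)
  obtain \<Delta>' where \<Delta>': "\<Delta> = g * \<Delta>'" using g by (auto elim: dvdE)
  have cop: "coprime M \<Delta>'"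
    using assms gcd_coprime_exists[of \<Delta> Q] unfolding coprime_iff_gcd_eq_1
    by (metis Q \<Delta>' g(1) g_def gcd.commute gcd_mult_distrib_int mult_cancel_left1 abs_of_pos less_irrefl)
  let ?S = "{a \<in> {0..<Q}. (u + a * \<Delta>) mod Q < L}"
  let ?\<phi> = "\<lambda>a. (((u + a * \<Delta>) mod Q) div g, a div M)"
  have "inj_on ?\<phi> ?S"
  proof (rule inj_onI)
    fix a b assume ab: "a \<in> ?S" "b \<in> ?S" "?\<phi> a = ?\<phi> b"
    have mg: "((u + c * \<Delta>) mod Q) mod g = u mod g" for c
    proof -
      have "u + c * \<Delta> = u + g * (c * \<Delta>')" by (simp add: \<Delta>')
      then have "(u + c * \<Delta>) mod g = u mod g" by (simp only: mod_mult_self2)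
      then show ?thesis using g(3) by (simp add: mod_mod_cancel)
    qed
    have "(u + a * \<Delta>) mod Q = (u + b * \<Delta>) mod Q"
      using ab(3) mg[of a] mg[of b]
      by (metis (no_types, lifting) div_mult_mod_eq prod.inject)
    then have "Q dvd (u + a * \<Delta>) - (u + b * \<Delta>)" by (simp only: mod_eq_dvd_iff)
    then have "g * M dvd g * ((a - b) * \<Delta>')" by (simp add: Q \<Delta>' algebra_simps)
    then have "M dvd (a - b) * \<Delta>'" using g(1) by simp
    then have "M dvd a - b" using cop by (simp add: coprime_dvd_mult_left_iff)
    then have "a mod M = b mod M" by (simp only: mod_eq_dvd_iff)
    then show "a = b" using ab(3) by (metis div_mult_mod_eq prod.inject)
  qed
  moreover have "?\<phi> ` ?S \<subseteq> {0..(L - 1) div g} \<times> {0..<g}"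
  proof (intro image_subsetI)
    fix a assume a: "a \<in> ?S"
    have "a div M < g"
    proof -
      have "M * (a div M) \<le> a" using M mult_div_mod_eq[of M a] pos_mod_sign[of M a] by linarith
      also have "a < M * g" using a by (simp add: Q mult.commute)
      finally show ?thesis using M mult_less_cancel_left_pos by blast
    qed
    moreover have "(u + a * \<Delta>) mod Q div g \<le> (L - 1) div g"
      using a g(1) by (intro zdiv_mono1) auto
    ultimately show "?\<phi> a \<in> {0..(L - 1) div g} \<times> {0..<g}"
      using a M g(1) assms(1) by (simp add: pos_imp_zdiv_nonneg_iff)
  qed
  ultimately have "card ?S \<le> card ({0..(L - 1) div g} \<times> {0..<g})"
    by (intro card_inj_on_le[of ?\<phi>]) auto
  also have "\<dots> = nat ((L - 1) div g + 1) * nat g" by (simp add: card_cartesian_product)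
  finally have "int (card ?S) \<le> int (nat ((L - 1) div g + 1) * nat g)" by (simp only: of_nat_le_iff)
  also have "\<dots> = ((L - 1) div g + 1) * g"
    using assms(2) g(1) by (simp add: pos_imp_zdiv_nonneg_iff add_nonneg_nonneg)
  also have "\<dots> \<le> (L - 1) + g"
  proof -
    have "g * ((L - 1) div g) \<le> L - 1"
      using mult_div_mod_eq[of g "L - 1"] pos_mod_sign[OF g(1), of "L - 1"] by linarith
    then show ?thesis by (simp add: algebra_simps)
  qed
  also have "g \<le> \<bar>\<Delta>\<bar>" using g(2) assms(3) by (intro zdvd_imp_le) auto
  finally show ?thesis by linarith
qed

lemma card_pair_sum:
  "card {(a, r). a \<in> A \<and> r \<in> B \<and> P a r} = (\<Sum>a\<in>A. card {r \<in> B. P a r})"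
  if "finite A" "finite B"
proof -
  have "{(a, r). a \<in> A \<and> r \<in> B \<and> P a r} = Sigma A (\<lambda>a. {r \<in> B. P a r})" by auto
  then show ?thesis using that by simp
qed

text \<open>The outcome \<omega> = (a, r) of the draws puts the sum t into block 0, the bucket that
  the last run searches.\<close>

definition hit :: "int \<Rightarrow> int \<Rightarrow> int \<times> int \<Rightarrow> int \<Rightarrow> bool" where
  "hit Q L = (\<lambda>(a, r) t. (a * t + r) mod Q < L)"

lemma card_hit:
  assumes "0 < L" "L \<le> Q"
  shows "card {\<omega> \<in> {0..<Q} \<times> {0..<Q}. hit Q L \<omega> t} = nat (Q * L)"
proof -
  have e: "{\<omega> \<in> {0..<Q} \<times> {0..<Q}. hit Q L \<omega> t} =
      {(a, r). a \<in> {0..<Q} \<and> r \<in> {0..<Q} \<and> (a * t + r) mod Q < L}" by (auto simp: hit_def)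
  have "card {\<omega> \<in> {0..<Q} \<times> {0..<Q}. hit Q L \<omega> t} =
      (\<Sum>a\<in>{0..<Q}. card {r \<in> {0..<Q}. (a * t + r) mod Q < L})"
    unfolding e by (rule card_pair_sum) auto
  also have "\<dots> = (\<Sum>a\<in>{0..<Q}. card {r \<in> {0..<Q}. r < L})"
    using assms by (intro sum.cong card_shift[where P = "\<lambda>r. r < L"]) auto
  also have "{r \<in> {0..<Q}. r < L} = {0..<L}" using assms by auto
  finally show ?thesis using assms by (simp add: nat_mult_distrib)
qed

text \<open>Substituting r for the first residue a t + r turns the second one into r + a (t' - t),
  and \<open>card_multiples_in_interval\<close> counts the suitable a. Independence would give L^2;
  the excess L |t' - t| is negligible when L is large.\<close>

lemma card_hit2:
  assumes "0 < L" "L \<le> Q" "t \<noteq> t'"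
  shows "int (card {\<omega> \<in> {0..<Q} \<times> {0..<Q}. hit Q L \<omega> t \<and> hit Q L \<omega> t'}) \<le> L * (L + \<bar>t' - t\<bar>)"
proof -
  let ?D = "t' - t"
  have e: "{\<omega> \<in> {0..<Q} \<times> {0..<Q}. hit Q L \<omega> t \<and> hit Q L \<omega> t'} =
      {(a, r). a \<in> {0..<Q} \<and> r \<in> {0..<Q} \<and> ((a * t + r) mod Q < L \<and> (a * t' + r) mod Q < L)}"
    by (auto simp: hit_def)
  have "card {\<omega> \<in> {0..<Q} \<times> {0..<Q}. hit Q L \<omega> t \<and> hit Q L \<omega> t'} = (\<Sum>a\<in>{0..<Q}. card {r \<in> {0..<Q}. (a * t + r) mod Q < L \<and> (a * t' + r) mod Q < L})"
    unfolding e by (rule card_pair_sum) auto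
  also have "\<dots> = (\<Sum>a\<in>{0..<Q}. card {r \<in> {0..<Q}. r < L \<and> (r + a * ?D) mod Q < L})"
  proof (intro sum.cong refl)
    fix a
    have "(a * t' + r) mod Q = ((a * t + r) mod Q + a * ?D) mod Q" for r
    proof -
      have "a * t' + r = (a * t + r) + a * ?D" by (simp add: algebra_simps)
      then show ?thesis by (simp only: mod_add_left_eq)
    qed
    then show "card {r \<in> {0..<Q}. (a * t + r) mod Q < L \<and> (a * t' + r) mod Q < L} =
        card {r \<in> {0..<Q}. r < L \<and> (r + a * ?D) mod Q < L}"
      using assms card_shift[where P = "\<lambda>r. r < L \<and> (r + a * ?D) mod Q < L" and c = "a * t" and Q = Q]
      by simp
  qed
  also have "\<dots> = card {(a, r). a \<in> {0..<Q} \<and> r \<in> {0..<Q} \<and> (r < L \<and> (r + a * ?D) mod Q < L)}"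
    by (rule card_pair_sum[symmetric]) auto
  also have "\<dots> = card {(r, a). r \<in> {0..<L} \<and> a \<in> {0..<Q} \<and> (r + a * ?D) mod Q < L}"
    by (rule bij_betw_same_card[of prod.swap]) (use assms in \<open>auto simp: bij_betw_def inj_on_def image_iff\<close>)
  also have "\<dots> = (\<Sum>r\<in>{0..<L}. card {a \<in> {0..<Q}. (r + a * ?D) mod Q < L})"
    by (rule card_pair_sum) auto
  finally have "int (card {\<omega> \<in> {0..<Q} \<times> {0..<Q}. hit Q L \<omega> t \<and> hit Q L \<omega> t'}) =
      (\<Sum>r\<in>{0..<L}. int (card {a \<in> {0..<Q}. (r + a * ?D) mod Q < L}))" by simp
  also have "\<dots> \<le> (\<Sum>r\<in>{0..<L}. L + \<bar>?D\<bar>)"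
    using assms by (intro sum_mono card_multiples_in_interval) auto
  also have "\<dots> = L * (L + \<bar>?D\<bar>)" using assms by simp
  finally show ?thesis .
qed

text \<open>Chebyshev's inequality, as distinct numbers are hit almost independently.\<close>

lemma card_no_hit_le:
  fixes L Q g :: int
  assumes "0 < L" "L \<le> Q" and T: "finite T" "T \<noteq> {}"
    "\<And>t t'. t \<in> T \<Longrightarrow> t' \<in> T \<Longrightarrow> \<bar>t' - t\<bar> \<le> g"
  shows "real (card {\<omega> \<in> {0..<Q} \<times> {0..<Q}. \<forall>t\<in>T. \<not> hit Q L \<omega> t}) * (real (card T) * L)
    \<le> (real_of_int Q)\<^sup>2 * (Q + real (card T) * g)"
proof -
  let ?\<Omega> = "{0..<Q} \<times> {0..<Q}"
  let ?Bad = "{\<omega> \<in> ?\<Omega>. \<forall>t\<in>T. \<not> hit Q L \<omega> t}"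
  define N where "N = real (card T)"
  define X where "X = (\<lambda>\<omega>. \<Sum>t\<in>T. of_bool (hit Q L \<omega> t) :: real)"
  have N: "0 < N" using T by (simp add: N_def card_gt_0_iff)
  have fin: "finite ?\<Omega>" by simp
  have Q: "0 < Q" using assms by simp
  have g0: "0 \<le> g" using T(2,3) by force
  have count: "(\<Sum>\<omega>\<in>?\<Omega>. of_bool (P \<omega>)) = real (card {\<omega> \<in> ?\<Omega>. P \<omega>})" for P
    by (simp add: Int_def)
  have X1: "(\<Sum>\<omega>\<in>?\<Omega>. X \<omega>) = N * (Q * L)"
  proof -
    have "(\<Sum>\<omega>\<in>?\<Omega>. X \<omega>) = (\<Sum>t\<in>T. \<Sum>\<omega>\<in>?\<Omega>. of_bool (hit Q L \<omega> t))"
      unfolding X_def by (rule sum.swap)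
    also have "\<dots> = (\<Sum>t\<in>T. real (nat (Q * L)))" by (simp only: count card_hit[OF assms(1,2)])
    finally show ?thesis using assms by (simp add: N_def)
  qed
  have X2: "(\<Sum>\<omega>\<in>?\<Omega>. (X \<omega>)\<^sup>2) \<le> N * (Q * L) + N * N * (L * (L + g))"
  proof -
    have "(\<Sum>\<omega>\<in>?\<Omega>. (X \<omega>)\<^sup>2) = (\<Sum>\<omega>\<in>?\<Omega>. \<Sum>t\<in>T. \<Sum>t'\<in>T. of_bool (hit Q L \<omega> t \<and> hit Q L \<omega> t'))"
      unfolding X_def power2_eq_square sum_product by (intro sum.cong refl) simp
    also have "\<dots> = (\<Sum>t\<in>T. \<Sum>t'\<in>T. \<Sum>\<omega>\<in>?\<Omega>. of_bool (hit Q L \<omega> t \<and> hit Q L \<omega> t'))"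
      by (subst sum.swap, rule sum.cong[OF refl], rule sum.swap)
    also have "\<dots> = (\<Sum>t\<in>T. \<Sum>t'\<in>T. real (card {\<omega> \<in> ?\<Omega>. hit Q L \<omega> t \<and> hit Q L \<omega> t'}))"
      by (simp only: count)
    also have "\<dots> \<le> (\<Sum>t\<in>T. \<Sum>t'\<in>T. (if t' = t then real_of_int (Q * L) else 0) + real_of_int (L * (L + g)))"
    proof (intro sum_mono)
      fix t t' assume t: "t \<in> T" "t' \<in> T"
      have Lg: "0 \<le> L * (L + g)" using assms(1) g0 by simp
      show "real (card {\<omega> \<in> ?\<Omega>. hit Q L \<omega> t \<and> hit Q L \<omega> t'}) \<le>
          (if t' = t then real_of_int (Q * L) else 0) + real_of_int (L * (L + g))"
      proof (cases "t' = t")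
        case True
        have "real (nat (Q * L)) = real_of_int (Q * L)" using assms by simp
        then show ?thesis using True Lg card_hit[OF assms(1,2), of t] by (simp del: of_int_mult of_nat_nat)
      next
        case False
        have "int (card {\<omega> \<in> ?\<Omega>. hit Q L \<omega> t \<and> hit Q L \<omega> t'}) \<le> L * (L + \<bar>t' - t\<bar>)"
          using card_hit2[OF assms(1,2), of t t'] False by simp
        also have "\<dots> \<le> L * (L + g)" using T(3)[OF t] assms(1) by (intro mult_left_mono) auto
        finally have "real_of_int (int (card {\<omega> \<in> ?\<Omega>. hit Q L \<omega> t \<and> hit Q L \<omega> t'})) \<le> real_of_int (L * (L + g))"
          by (simp only: of_int_le_iff)
        then show ?thesis using False by (simp del: of_int_mult)
      qed
    qed
    also have "\<dots> = N * (Q * L) + N * N * (L * (L + g))"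
      using T(1) by (simp add: sum.distrib N_def algebra_simps)
    finally show ?thesis .
  qed
  \<comment> \<open>The mean of \<open>X\<close> is N L / Q, so Q X - N L is the deviation scaled by
    Q. On \<open>?Bad\<close> the variable \<open>X\<close> vanishes and every term is the square of
    N L.\<close>
  have "real (card ?Bad) * (N * L)\<^sup>2 = (\<Sum>\<omega>\<in>?Bad. (Q * X \<omega> - N * L)\<^sup>2)"
    by (simp add: X_def)
  also have "\<dots> \<le> (\<Sum>\<omega>\<in>?\<Omega>. (Q * X \<omega> - N * L)\<^sup>2)"
    by (intro sum_mono2) auto
  also have "\<dots> = (\<Sum>\<omega>\<in>?\<Omega>. Q\<^sup>2 * (X \<omega>)\<^sup>2 - 2 * Q * N * L * X \<omega> + (N * L)\<^sup>2)"
    by (intro sum.cong refl) (simp add: power2_eq_square algebra_simps)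
  also have "\<dots> = Q\<^sup>2 * (\<Sum>\<omega>\<in>?\<Omega>. (X \<omega>)\<^sup>2) - 2 * Q * N * L * (\<Sum>\<omega>\<in>?\<Omega>. X \<omega>) + Q\<^sup>2 * (N * L)\<^sup>2"
    using Q by (simp add: sum.distrib sum_subtractf sum_distrib_left card_cartesian_product power2_eq_square)
  also have "\<dots> \<le> Q\<^sup>2 * (N * (Q * L) + N * N * (L * (L + g))) - 2 * Q * N * L * (N * (Q * L)) + Q\<^sup>2 * (N * L)\<^sup>2"
    using X2 unfolding X1 by (intro add_right_mono diff_right_mono mult_left_mono) auto
  also have "\<dots> = (N * L) * (Q\<^sup>2 * (Q + N * g))" by (simp add: power2_eq_square algebra_simps)
  finally have "(N * L) * (real (card ?Bad) * (N * L)) \<le> (N * L) * (Q\<^sup>2 * (Q + N * g))"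
    by (simp add: power2_eq_square algebra_simps)
  moreover have "0 < N * L" using N assms(1) by simp
  ultimately show ?thesis unfolding N_def[symmetric]
    by (simp only: mult_le_cancel_left_pos of_int_power)
qed

text \<open>Varying \<open>r\<close> alone shifts the residue of \<open>v\<close> uniformly, and the
  condition prescribes its block, which has \<open>L\<close> elements.\<close>

lemma card_key_le:
  assumes "0 < K" "0 < L"
  shows "int (card {r \<in> {0..<K * L}. \<kappa> = (e - key x K L a r v) mod K}) \<le> L"
proof -
  have Q: "0 < K * L" using assms by simp
  let ?S = "{s \<in> {0..<K * L}. \<kappa> = (e - s div L) mod K}"
  have "card {r \<in> {0..<K * L}. \<kappa> = (e - key x K L a r v) mod K} = card ?S"
    unfolding key_def by (rule card_shift[OF Q, where P = "\<lambda>s. \<kappa> = (e - s div L) mod K"])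
  also have "\<dots> \<le> card {0..<L}"
  proof (rule card_inj_on_le[of "\<lambda>s. s mod L"])
    have lt: "0 \<le> s div L \<and> s div L < K" if "s \<in> ?S" for s
    proof -
      have "L * (s div L) \<le> s" using assms mult_div_mod_eq[of L s] pos_mod_sign[of L s] by linarith
      also have "s < L * K" using that by (simp add: mult.commute)
      finally show ?thesis using assms that by (simp add: pos_imp_zdiv_nonneg_iff)
    qed
    show "inj_on (\<lambda>s. s mod L) ?S"
    proof (rule inj_onI)
      fix s t assume st: "s \<in> ?S" "t \<in> ?S" "s mod L = t mod L"
      then have "(e - s div L) mod K = (e - t div L) mod K" by simp
      then have "K dvd (e - s div L) - (e - t div L)" by (simp only: mod_eq_dvd_iff)
      then have "K dvd t div L - s div L" by simp
      then have "(t div L) mod K = (s div L) mod K" by (simp only: mod_eq_dvd_iff)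
      then have "t div L = s div L" using lt[OF st(1)] lt[OF st(2)] by simp
      then show "s = t" using st(3) by (metis div_mult_mod_eq)
    qed
  qed (use assms in auto)
  finally show ?thesis using assms by simp
qed

lemma sum_swap_list: "(\<Sum>r\<in>A. \<Sum>v\<leftarrow>vs. g v r) = (\<Sum>v\<leftarrow>vs. \<Sum>r\<in>A. g v r :: int)"
  by (induction vs) (auto simp: sum.distrib)

lemma length_filter_sum_list: "int (length (filter P us)) = (\<Sum>u\<leftarrow>us. of_bool (P u))"
  by (induction us) auto

lemma sum_list_bound: "(\<And>u. u \<in> set us \<Longrightarrow> g u \<le> b) \<Longrightarrow> (\<Sum>u\<leftarrow>us. g u) \<le> int (length us) * b"
  by (induction us) (auto simp: algebra_simps add_mono)

text \<open>A first-moment bound: for every fixed \<open>a\<close>, each of the two lookups succeeds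
  for a given pair with probability at most 1 / K, so the average number of candidates is at most 2
  |us| |vs| / K.\<close>

lemma sum_length_cands:
  assumes "0 < K" "0 < L"
  shows "(\<Sum>\<omega>\<in>{0..<K * L} \<times> {0..<K * L}. int (length (cands x K L (fst \<omega>) (snd \<omega>) us vs)))
     \<le> K * L * (int (length vs) * (int (length us) * (2 * L)))"
proof -
  let ?Q = "K * L"
  have len: "int (length (cands x K L a r us vs)) = (\<Sum>v\<leftarrow>vs. \<Sum>u\<leftarrow>us.
      of_bool (key x K L a 0 u = (0 - key x K L a r v) mod K) +
      of_bool (key x K L a 0 u = (-1 - key x K L a r v) mod K))" for a r
  proof -
    have "int (length (cands x K L a r us vs)) = (\<Sum>v\<leftarrow>vs. int (length (cands_of x K L a r us v)))"
      unfolding cands_def by (induction vs) auto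
    also have "\<dots> = (\<Sum>v\<leftarrow>vs. \<Sum>u\<leftarrow>us.
      of_bool (key x K L a 0 u = (0 - key x K L a r v) mod K) +
      of_bool (key x K L a 0 u = (-1 - key x K L a r v) mod K))"
      by (simp add: cands_of_def Let_def length_filter_sum_list sum_list_addf)
    finally show ?thesis .
  qed
  have fixed: "(\<Sum>r\<in>{0..<?Q}. int (length (cands x K L a r us vs))) \<le>
      int (length vs) * (int (length us) * (2 * L))" for a
  proof -
    have "(\<Sum>r\<in>{0..<?Q}. of_bool (key x K L a 0 u = (e - key x K L a r v) mod K)) \<le> L" for u e v
      using card_key_le[OF assms, of "key x K L a 0 u" e x a v] by (simp add: Int_def)
    note A = this
    have "(\<Sum>r\<in>{0..<?Q}. of_bool (key x K L a 0 u = (0 - key x K L a r v) mod K) +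
      of_bool (key x K L a 0 u = (-1 - key x K L a r v) mod K)) \<le> 2 * L" for u v
      using A[of u 0 v] A[of u "-1" v] unfolding sum.distrib by linarith
    then show ?thesis unfolding len sum_swap_list by (intro sum_list_bound)
  qed
  have "(\<Sum>\<omega>\<in>{0..<?Q} \<times> {0..<?Q}. int (length (cands x K L (fst \<omega>) (snd \<omega>) us vs))) =
      (\<Sum>a\<in>{0..<?Q}. \<Sum>r\<in>{0..<?Q}. int (length (cands x K L a r us vs)))"
    by (simp add: sum.cartesian_product case_prod_beta)
  also have "\<dots> \<le> (\<Sum>a\<in>{0..<?Q}. int (length vs) * (int (length us) * (2 * L)))"
    by (intro sum_mono fixed)
  finally show ?thesis using assms by simp
qed

section \<open>The probability of failure\<close>

text \<open>Entries beyond the input are 0, so that equality of vectors is equality of functions and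
  sets of vectors can be counted.\<close>

definition solution_vec :: "int list \<Rightarrow> int \<Rightarrow> vec \<Rightarrow> bool" where
  "solution_vec x d c \<longleftrightarrow> small d c \<and> (\<forall>p\<ge>length x. c p = 0) \<and> tot x c = 0 \<and> (\<exists>p<length x. c p \<noteq> 0)"

definition norm1 :: "nat \<Rightarrow> vec \<Rightarrow> int" where
  "norm1 n c = (\<Sum>p<n. \<bar>c p\<bar>)"

lemma solution_vecI:
  assumes "is_solution {-d..d} x c" "0 \<le> d"
  shows "\<exists>g. solution_vec x d g"
proof -
  let ?g = "\<lambda>p. if p < length x then c ! p else 0"
  have "c ! p \<in> {-d..d}" if "p < length x" for p
  proof -
    have "c ! p \<in> set c" using assms(1) that by (simp add: is_solution_def)
    then show ?thesis using assms(1) unfolding is_solution_def by blast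
  qed
  then have "small d ?g" using assms(2) by (auto simp: small_def abs_le_iff minus_le_iff)
  then show ?thesis using assms by (intro exI[of _ ?g]) (auto simp: solution_vec_def is_solution_def tot_def)
qed

lemma minimal_solution_vec:
  assumes "solution_vec x d g"
  obtains c where "solution_vec x d c" "\<And>c'. solution_vec x d c' \<Longrightarrow> norm1 (length x) c \<le> norm1 (length x) c'"
proof -
  have nn: "0 \<le> norm1 n c" for n c by (simp add: norm1_def sum_nonneg)
  obtain c where c: "solution_vec x d c"
    "\<forall>c'. solution_vec x d c' \<longrightarrow> nat (norm1 (length x) c) \<le> nat (norm1 (length x) c')"
    using ex_has_least_nat[of "solution_vec x d" g "\<lambda>c. nat (norm1 (length x) c)"] assms by blast
  show thesis
  proof (rule that[OF c(1)])
    fix c' assume "solution_vec x d c'"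
    then show "norm1 (length x) c \<le> norm1 (length x) c'" using c(2) nn[of "length x" c'] by fastforce
  qed
qed

text \<open>Only the first member y of a pair is recorded; the second is y - c and has the same sum.
  Coordinate p leaves d + 1 - |c_p| choices for y.\<close>

definition box_pairs :: "nat \<Rightarrow> int \<Rightarrow> vec \<Rightarrow> vec set" where
  "box_pairs n d c = {y. (\<forall>p<n. 0 \<le> y p \<and> y p \<le> d \<and> 0 \<le> y p - c p \<and> y p - c p \<le> d) \<and> (\<forall>p\<ge>n. y p = 0)}"

lemma inj_on_tot_box_pairs:
  assumes c: "solution_vec x d c" "\<And>c'. solution_vec x d c' \<Longrightarrow> norm1 (length x) c \<le> norm1 (length x) c'"
    and large: "d * int (length x) < 2 * norm1 (length x) c"
  shows "inj_on (tot x) (box_pairs (length x) d c)"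
proof (rule inj_onI, rule ccontr)
  let ?n = "length x"
  fix y z assume yz: "y \<in> box_pairs ?n d c" "z \<in> box_pairs ?n d c" "tot x y = tot x z" "y \<noteq> z"
  let ?c = "\<lambda>p. y p - z p"
  have b: "\<bar>?c p\<bar> \<le> d - \<bar>c p\<bar>" if "p < ?n" for p
    using yz(1,2) that by (force simp: box_pairs_def)
  have z: "?c p = 0" if "?n \<le> p" for p using yz(1,2) that by (simp add: box_pairs_def)
  have d0: "0 \<le> d" using c(1) by (force simp: solution_vec_def small_def)
  have "\<bar>?c p\<bar> \<le> d" for p using b[of p] z[of p] d0 by (cases "p < ?n") auto
  moreover have "\<exists>p<?n. ?c p \<noteq> 0"
  proof (rule ccontr)
    assume "\<not> ?thesis"
    then have "y p = z p" for p using z[of p] by (cases "p < ?n") auto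
    then show False using yz(4) by auto
  qed
  ultimately have "solution_vec x d ?c" using z yz(3) by (simp add: solution_vec_def small_def tot_diff)
  then have "norm1 ?n c \<le> norm1 ?n ?c" by (rule c(2))
  also have "\<dots> \<le> (\<Sum>p<?n. d - \<bar>c p\<bar>)" unfolding norm1_def using b by (intro sum_mono) auto
  also have "\<dots> = d * int ?n - norm1 ?n c" by (simp add: norm1_def sum_subtractf)
  finally show False using large by simp
qed

text \<open>The logarithm of d + 1 - j is concave in j, hence above its chord between j = 0 and j =
  d; Young's inequality with second factor 1 expresses this. Applied coordinatewise, it bounds the
  number of pairs in terms of the norm alone.\<close>

lemma powr_le_affine:
  assumes "0 < d" "0 \<le> j" "j \<le> d"
  shows "(d + 1) powr (1 - j / d) \<le> d + 1 - (j :: real)"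
proof -
  have "(d + 1) powr (1 - j / d) * 1 powr (j / d) \<le> (1 - j / d) * (d + 1) + j / d * 1"
    using assms by (intro Youngs_inequality_0) auto
  also have "\<dots> = d + 1 - j" using assms by (simp add: field_simps)
  finally show ?thesis by simp
qed

lemma card_box_pairs:
  assumes "0 < d" "small d c"
  shows "finite (box_pairs n d c)"
    "real_of_int (d + 1) powr (n - norm1 n c / d) \<le> real (card (box_pairs n d c))"
proof -
  let ?A = "\<lambda>p. {max 0 (c p)..min d (d + c p)}"
  let ?\<phi> = "\<lambda>z p. if p < n then z p else (0 :: int)"
  have cd: "\<bar>c p\<bar> \<le> d" for p using assms(2) by (simp add: small_def)
  have img: "?\<phi> ` Pi\<^sub>E {..<n} ?A = box_pairs n d c"
  proof (intro set_eqI iffI)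
    fix y assume y: "y \<in> box_pairs n d c"
    have "y = ?\<phi> (restrict y {..<n})" using y by (auto simp: box_pairs_def fun_eq_iff)
    moreover have "restrict y {..<n} \<in> Pi\<^sub>E {..<n} ?A" using y by (auto simp: box_pairs_def)
    ultimately show "y \<in> ?\<phi> ` Pi\<^sub>E {..<n} ?A" by (rule image_eqI)
  next
    fix y assume "y \<in> ?\<phi> ` Pi\<^sub>E {..<n} ?A"
    then obtain z where "z \<in> Pi\<^sub>E {..<n} ?A" "y = ?\<phi> z" by auto
    then show "y \<in> box_pairs n d c" by (auto simp: box_pairs_def PiE_def Pi_def)
  qed
  have "inj_on ?\<phi> (Pi\<^sub>E {..<n} ?A)"
  proof (rule inj_onI)
    fix y z assume yz: "y \<in> Pi\<^sub>E {..<n} ?A" "z \<in> Pi\<^sub>E {..<n} ?A" "?\<phi> y = ?\<phi> z"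
    show "y = z"
    proof (rule PiE_ext[OF yz(1,2)])
      fix p assume "p \<in> {..<n}"
      then show "y p = z p" using fun_cong[OF yz(3), of p] by simp
    qed
  qed
  then have "card (box_pairs n d c) = card (Pi\<^sub>E {..<n} ?A)" unfolding img[symmetric] by (rule card_image)
  also have "\<dots> = (\<Prod>p<n. card (?A p))" by (simp add: card_PiE)
  also have "\<dots> = (\<Prod>p<n. nat (d + 1 - \<bar>c p\<bar>))"
  proof (intro prod.cong refl)
    fix p
    have "min d (d + c p) - max 0 (c p) = d - \<bar>c p\<bar>" by (simp add: min_def max_def abs_if)
    then show "card (?A p) = nat (d + 1 - \<bar>c p\<bar>)" by (simp add: algebra_simps)
  qed
  finally have "real (card (box_pairs n d c)) = (\<Prod>p<n. real_of_int (d + 1 - \<bar>c p\<bar>))"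
    using cd by (simp add: of_nat_nat add_increasing2)
  moreover have "(\<Prod>p<n. real_of_int (d + 1) powr (1 - \<bar>c p\<bar> / d)) \<le> (\<Prod>p<n. real_of_int (d + 1 - \<bar>c p\<bar>))"
  proof (intro prod_mono conjI)
    fix p
    show "real_of_int (d + 1) powr (1 - \<bar>c p\<bar> / d) \<le> real_of_int (d + 1 - \<bar>c p\<bar>)"
      using powr_le_affine[of "real_of_int d" "real_of_int \<bar>c p\<bar>"] cd[of p] assms(1) by simp
  qed auto
  moreover have "(\<Prod>p<n. real_of_int (d + 1) powr (1 - \<bar>c p\<bar> / d)) = real_of_int (d + 1) powr (n - norm1 n c / d)"
    using assms(1) by (subst powr_sum[symmetric])
      (auto simp: sum_subtractf norm1_def sum_divide_distrib)
  ultimately show "real_of_int (d + 1) powr (n - norm1 n c / d) \<le> real (card (box_pairs n d c))" by simp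
  show "finite (box_pairs n d c)" unfolding img[symmetric] by (intro finite_imageI finite_PiE) auto
qed

lemma pair_spmf_of_set: "pair_spmf (spmf_of_set A) (spmf_of_set B) = spmf_of_set (A \<times> B)"
proof (rule spmf_eqI)
  fix z :: "'a \<times> 'b"
  show "spmf (pair_spmf (spmf_of_set A) (spmf_of_set B)) z = spmf (spmf_of_set (A \<times> B)) z"
    by (cases z) (simp add: spmf_of_set card_cartesian_product indicator_def)
qed

context balancing
begin

abbreviation "K \<equiv> K_val d q c1 n"
abbreviation "L \<equiv> L_val x d"

text \<open>The first two terms are Chebyshev's bound for missing all pairs: the number of buckets
  over a lower bound on the number of sums, and the error \<open>B1_val\<close> /
  \<open>L_val\<close> from imperfect independence. The third is Markov's bound for more than
  \<open>lm\<close> candidates in the bucket.\<close>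

definition failure_bound :: real where
  "failure_bound = K / real_of_int (d + 1) powr (A2 * n / (q * d)) + 1 / real_of_int (d + 1) ^ n +
     2 * real_of_int (d + 1) ^ n / (K * lm)"

lemma failure_bound_nonneg: "0 \<le> failure_bound"
  using KL_pos d_pos by (simp add: failure_bound_def)

text \<open>If the norm of the minimal solution deviates from the average, a weight-bounded run
  succeeds for all draws. Otherwise the hypothesis on \<open>A1\<close> forces the norm above d n /
  2, so the pairs have distinct sums, and only the two events \<open>?Bad1\<close> and
  \<open>?Bad2\<close> can spoil the last run.\<close>

lemma card_no_hit:
  assumes sol: "solution_vec x d g" and A1: "q * d \<le> 2 * A1"
  shows "real (card {\<omega> \<in> {0..<Q} \<times> {0..<Q}. no_hit (fst \<omega>) (snd \<omega>)}) \<le> (real_of_int Q)\<^sup>2 * failure_bound"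
proof -
  let ?\<Omega> = "{0..<Q} \<times> {0..<Q}"
  let ?F = "\<lambda>\<omega>. runs.run_cands x d q A1 A2 (B1_val x d) K L (fst \<omega>) (snd \<omega>) (2 * n)"
  obtain c where c: "solution_vec x d c" "\<And>c'. solution_vec x d c' \<Longrightarrow> norm1 n c \<le> norm1 n c'"
    using minimal_solution_vec[OF sol] by blast
  have cc: "small d c" "\<And>p. n \<le> p \<Longrightarrow> c p = 0" "tot x c = 0" "\<exists>p<n. c p \<noteq> 0"
    using c(1) by (auto simp: solution_vec_def)
  have n: "0 < n" using cc(4) by auto
  have "1 \<le> c2 ^ (n div nat q)" using c12 by (simp add: one_le_power)
  then have lm2: "2 \<le> lm" using int_lm by linarith
  show ?thesis
  proof (cases "q * norm1 n c \<le> A1 * int n \<or> q * (\<Sum>p<n. d - \<bar>c p\<bar>) \<le> A2 * int n")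
    case True
    have "\<not> no_hit (fst \<omega>) (snd \<omega>)" if "\<omega> \<in> ?\<Omega>" for \<omega>
    proof -
      interpret runs w H x d q A1 A2 "B1_val x d" K L "fst \<omega>" "snd \<omega>" lm B
        using that by (intro runs) auto
      show ?thesis using low_run_complete[OF cc lm2] True unfolding no_hit_def norm1_def
        by (meson less_imp_le)
    qed
    then have "{\<omega> \<in> ?\<Omega>. no_hit (fst \<omega>) (snd \<omega>)} = {}" by auto
    then show ?thesis using failure_bound_nonneg by (simp only: card.empty of_nat_0) simp
  next
    case False
    let ?W = "norm1 n c"
    have W: "A1 * int n < q * ?W" "A2 * int n < q * (d * int n - ?W)"
      using False by (auto simp: norm1_def sum_subtractf mult.commute[of d])
    have "q * (d * int n) \<le> 2 * A1 * int n" using mult_right_mono[OF A1, of "int n"] by (simp add: mult.assoc)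
    also have "2 * A1 * int n < q * (2 * ?W)" using W(1) by (simp add: algebra_simps)
    finally have large: "d * int n < 2 * ?W" using cbnd by (simp only: mult_less_cancel_left_pos)
    let ?S = "box_pairs n d c"
    define T where "T = tot x ` ?S"
    have inj: "inj_on (tot x) ?S" by (rule inj_on_tot_box_pairs[OF c large])
    have finS: "finite ?S" by (rule card_box_pairs[OF d_pos cc(1)])
    define N where "N = real (card T)"
    let ?D = "real_of_int (d + 1)"
    have D1: "1 < ?D" using d_pos by simp
    have "?D powr (A2 * n / (q * d)) \<le> ?D powr (n - ?W / d)"
    proof (rule powr_mono)
      have "real_of_int (A2 * int n) < real_of_int (q * (d * int n - ?W))" using W(2) by (simp only: of_int_less_iff)
      then show "A2 * n / (q * d) \<le> n - ?W / d" using cbnd d_pos by (simp add: field_simps)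
    qed (use D1 in simp)
    also have "\<dots> \<le> N" using card_box_pairs(2)[OF d_pos cc(1), of n] inj by (simp add: N_def T_def card_image)
    finally have N: "?D powr (A2 * n / (q * d)) \<le> N" .
    have N0: "0 < N" using N D1 by (smt (verit) powr_gt_zero)
    have g: "\<bar>t' - t\<bar> \<le> B1_val x d" if t: "t \<in> T" "t' \<in> T" for t t'
    proof -
      obtain y z where yz: "y \<in> ?S" "z \<in> ?S" "t' = tot x y" "t = tot x z" using t by (auto simp: T_def)
      have "\<bar>y p - z p\<bar> \<le> d" for p
      proof -
        have "0 \<le> y p \<and> y p \<le> d" "0 \<le> z p \<and> z p \<le> d"
          using yz(1,2) d_pos by (cases "p < n"; simp add: box_pairs_def)+
        then show ?thesis by linarith
      qed
      then have "\<bar>tot x (\<lambda>p. y p - z p)\<bar> \<le> d * (\<Sum>i<n. \<bar>x ! i\<bar>)"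
        by (intro abs_tot_le) (simp add: small_def)
      then show ?thesis using yz by (simp add: tot_diff B1_val_def)
    qed
    let ?Bad1 = "{\<omega> \<in> ?\<Omega>. \<forall>t\<in>T. \<not> hit Q L \<omega> t}"
    let ?Bad2 = "{\<omega> \<in> ?\<Omega>. lm < length (?F \<omega>)}"
    have LQ: "0 < L" "L \<le> Q" using KL_pos mult_right_mono[of 1 K L] by simp_all
    have Q0: "0 < Q" using LQ by simp
    have sub: "{\<omega> \<in> ?\<Omega>. no_hit (fst \<omega>) (snd \<omega>)} \<subseteq> ?Bad1 \<union> ?Bad2"
    proof
      fix \<omega> assume \<omega>: "\<omega> \<in> {\<omega> \<in> ?\<Omega>. no_hit (fst \<omega>) (snd \<omega>)}"
      interpret runs w H x d q A1 A2 "B1_val x d" K L "fst \<omega>" "snd \<omega>" lm B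
        using \<omega> by (intro runs) auto
      have nc: "no_collision (set (take lm (?F \<omega>)))" using \<omega> by (simp add: no_hit_def)
      show "\<omega> \<in> ?Bad1 \<union> ?Bad2"
      proof (rule ccontr)
        assume nb: "\<omega> \<notin> ?Bad1 \<union> ?Bad2"
        then obtain t where t: "t \<in> T" "hit Q L \<omega> t" using \<omega> by auto
        then obtain y where y: "y \<in> ?S" "t = tot x y" by (auto simp: T_def)
        \<comment> \<open>As \<open>c\<close> has sum 0, both members of the pair have the same sum
          and the same hash value, so a single hit brings both into the bucket. Equal codes would
          then make the code of \<open>c\<close> zero.\<close>
        let ?z = "\<lambda>p. y p - c p"
        have tz: "tot x ?z = tot x y" using cc(3) by (simp add: tot_diff)
        have y0: "y p = 0" "?z p = 0" if "n \<le> p" for p using y(1) cc(2)[OF that] that by (simp_all add: box_pairs_def)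
        have yp: "0 \<le> y p \<and> y p \<le> d" "0 \<le> ?z p \<and> ?z p \<le> d" for p
        proof -
          have "(0 \<le> y p \<and> y p \<le> d) \<and> 0 \<le> ?z p \<and> ?z p \<le> d"
          proof (cases "p < n")
            case True
            then show ?thesis using y(1) unfolding box_pairs_def by blast
          next
            case False
            then show ?thesis using y0[of p] d_pos by simp
          qed
          then show "0 \<le> y p \<and> y p \<le> d" "0 \<le> ?z p \<and> ?z p \<le> d" by blast+
        qed
        have h: "(fst \<omega> * tot x y + snd \<omega>) mod Q < L" using t y by (simp add: hit_def case_prod_beta)
        have mem: "y \<in> set (?F \<omega>)" "?z \<in> set (?F \<omega>)"
          using box_run_complete[OF n yp(1) y0(1) h] box_run_complete[OF n yp(2) y0(2) h[folded tz]] by auto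
        have tk: "take lm (?F \<omega>) = ?F \<omega>" using nb \<omega> by simp
        have "cod d n y = cod d n ?z"
          by (rule nc[unfolded tk no_collision_def, THEN conjunct1, rule_format, OF mem tz[symmetric]])
        then have "cod d n c = 0" by (simp add: cod_diff)
        then show False using cod_eq_0[OF cc(1)] d_pos cc(4) by fastforce
      qed
    qed
    have b1: "real (card ?Bad1) \<le> (real_of_int Q)\<^sup>2 * (K / N + B1_val x d / L)"
    proof -
      have "real (card ?Bad1) * (N * L) \<le> (real_of_int Q)\<^sup>2 * (Q + N * B1_val x d)"
        unfolding N_def
      proof (rule card_no_hit_le[OF LQ])
        show "T \<noteq> {}" using N0 by (auto simp: N_def)
      qed (use finS g in \<open>auto simp: T_def\<close>)
      then have "real (card ?Bad1) \<le> (real_of_int Q)\<^sup>2 * (Q + N * B1_val x d) / (N * L)"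
        using N0 LQ(1) by (simp add: field_simps)
      also have "\<dots> = (real_of_int Q)\<^sup>2 * ((Q + N * B1_val x d) / (N * L))" by simp
      also have "(Q + N * B1_val x d) / (N * L) = K / N + B1_val x d / L"
        using N0 LQ(1) by (simp add: field_simps)
      finally show ?thesis .
    qed
    have BL: "B1_val x d / L = 1 / ?D ^ n" using B1_val_pos by (simp add: L_val_def)
    have KN: "K / N \<le> K / ?D powr (A2 * n / (q * d))"
      using N N0 KL_pos D1 by (intro divide_left_mono) auto
    have b2: "real (card ?Bad2) \<le> (real_of_int Q)\<^sup>2 * (2 * ?D ^ n / (K * lm))"
    proof -
      let ?us = "map fst (lev n [0..d] (\<lambda>c. 0) 0 0 (n div 2))"
      let ?vs = "map fst (lev n [0..d] (\<lambda>c. 0) 0 (n div 2) (n - n div 2))"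
      have F: "?F \<omega> = cands x K L (fst \<omega>) (snd \<omega>) ?us ?vs" if "\<omega> \<in> ?\<Omega>" for \<omega>
      proof -
        interpret runs w H x d q A1 A2 "B1_val x d" K L "fst \<omega>" "snd \<omega>" lm B
          using that by (intro runs) auto
        show ?thesis
          by (simp add: run_cands_def half_list_def lo_of_def w0_of_def w1_of_def tau_of_def pos_of_def
              K_of_def L_of_def a_of_def r_of_def)
      qed
      have len: "real (length (lev n [0..d] (\<lambda>c. 0) 0 pos l)) \<le> ?D ^ l" for pos l
        using length_lev_le[of 1 0 n "[0..d]" "\<lambda>_. 0" pos l] d_pos by (simp add: sum_list_triv)
      have "int (card ?Bad2) * int lm = (\<Sum>\<omega>\<in>?Bad2. int lm)" by simp
      also have "\<dots> \<le> (\<Sum>\<omega>\<in>?Bad2. int (length (?F \<omega>)))" by (intro sum_mono) auto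
      also have "\<dots> \<le> (\<Sum>\<omega>\<in>?\<Omega>. int (length (?F \<omega>)))" by (intro sum_mono2) auto
      also have "\<dots> = (\<Sum>\<omega>\<in>?\<Omega>. int (length (cands x K L (fst \<omega>) (snd \<omega>) ?us ?vs)))"
        by (intro sum.cong refl) (simp only: F)
      also have "\<dots> \<le> Q * (int (length ?vs) * (int (length ?us) * (2 * L)))"
        by (rule sum_length_cands) (use KL_pos in auto)
      finally have "real_of_int (int (card ?Bad2) * int lm) \<le>
          real_of_int (Q * (int (length ?vs) * (int (length ?us) * (2 * L))))"
        by (simp only: of_int_le_iff)
      then have "real (card ?Bad2) * lm \<le> real_of_int Q * (real (length ?vs) * real (length ?us) * (2 * L))"
        by (simp add: mult.assoc)
      also have "\<dots> \<le> real_of_int Q * (?D ^ (n - n div 2) * ?D ^ (n div 2) * (2 * L))"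
        using LQ Q0 D1 len by (intro mult_left_mono mult_right_mono mult_mono) auto
      also have "?D ^ (n - n div 2) * ?D ^ (n div 2) = ?D ^ n" by (simp add: power_add[symmetric])
      also have "real_of_int Q * (?D ^ n * (2 * L)) = (real_of_int Q)\<^sup>2 * (2 * ?D ^ n / K)"
        using KL_pos by (simp add: power2_eq_square field_simps)
      finally show ?thesis using lm2 KL_pos by (simp add: field_simps)
    qed
    have "real (card {\<omega> \<in> ?\<Omega>. no_hit (fst \<omega>) (snd \<omega>)}) \<le> real (card (?Bad1 \<union> ?Bad2))"
      using sub by (intro of_nat_mono card_mono) auto
    also have "\<dots> \<le> real (card ?Bad1) + real (card ?Bad2)"
      unfolding of_nat_add[symmetric] by (intro of_nat_mono card_Un_le)
    also have "\<dots> \<le> (real_of_int Q)\<^sup>2 * (K / N + B1_val x d / L) + (real_of_int Q)\<^sup>2 * (2 * ?D ^ n / (K * lm))"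
      using b1 b2 by linarith
    also have "\<dots> = (real_of_int Q)\<^sup>2 * (K / N + B1_val x d / L + 2 * ?D ^ n / (K * lm))"
      by (simp only: distrib_left)
    also have "\<dots> \<le> (real_of_int Q)\<^sup>2 * failure_bound"
      unfolding failure_bound_def BL using KN by (intro mult_left_mono add_right_mono) auto
    finally show ?thesis .
  qed
qed

lemma program_correct:
  assumes A1: "q * d \<le> 2 * A1"
  shows "halts_within w (program_time d n B lm) (program d q A1 A2 c1 c2) x"
    "\<And>c. Some c \<in> set_spmf (run w (program_time d n B lm) (program d q A1 A2 c1 c2) x) \<Longrightarrow>
       is_solution {-d..d} x c"
    "\<And>c. is_solution {-d..d} x c \<Longrightarrow>
       1 - failure_bound \<le> measure (measure_spmf (run w (program_time d n B lm) (program d q A1 A2 c1 c2) x))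
         {Some c |c. is_solution {-d..d} x c}"
proof -
  let ?T = "program_time d n B lm" and ?p = "program d q A1 A2 c1 c2"
  let ?\<Omega> = "{0..<Q} \<times> {0..<Q}"
  obtain F where F: "\<And>T. ?T \<le> T \<Longrightarrow> steps w T (?p, input_state x) =
        bind_spmf (spmf_of_set {0..<Q}) (\<lambda>a. bind_spmf (spmf_of_set {0..<Q}) (\<lambda>r.
          return_spmf (Skip, F a r)))"
    "\<And>a r c. a \<in> {0..<Q} \<Longrightarrow> r \<in> {0..<Q} \<Longrightarrow> result_of n (F a r) = Some c \<Longrightarrow> is_solution {-d..d} x c"
    "\<And>a r. a \<in> {0..<Q} \<Longrightarrow> r \<in> {0..<Q} \<Longrightarrow> result_of n (F a r) = None \<Longrightarrow> no_hit a r"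
    using steps_program by blast
  have Q0: "0 < Q" using KL_pos by simp
  have pair: "spmf_of_set ?\<Omega> = bind_spmf (spmf_of_set {0..<Q}) (\<lambda>a. bind_spmf (spmf_of_set {0..<Q}) (\<lambda>r.
          return_spmf (a, r)))"
    using pair_spmf_of_set[of "{0..<Q}" "{0..<Q}"] by (simp add: pair_spmf_alt_def)
  have st: "steps w ?T (?p, input_state x) = map_spmf (\<lambda>\<omega>. (Skip, F (fst \<omega>) (snd \<omega>))) (spmf_of_set ?\<Omega>)"
    unfolding pair F(1)[OF order_refl] by (simp add: map_spmf_bind_spmf o_def)
  have \<Omega>: "finite ?\<Omega>" "?\<Omega> \<noteq> {}" using Q0 by auto
  show "halts_within w ?T ?p x"
    using \<Omega> unfolding halts_within_def st by (auto simp: lossless_spmf_of_set)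
  have rn: "run w ?T ?p x = map_spmf (\<lambda>\<omega>. result_of n (F (fst \<omega>) (snd \<omega>))) (spmf_of_set ?\<Omega>)"
    unfolding run_def st by (simp add: spmf.map_comp o_def)
  show "is_solution {-d..d} x c" if "Some c \<in> set_spmf (run w ?T ?p x)" for c
    using that F(2) unfolding rn by (auto simp: set_spmf_of_set)
  show "1 - failure_bound \<le> measure (measure_spmf (run w ?T ?p x)) {Some c |c. is_solution {-d..d} x c}"
    if sol: "is_solution {-d..d} x c" for c
  proof -
    let ?Sol = "{Some c |c. is_solution {-d..d} x c}"
    let ?f = "\<lambda>\<omega>. result_of n (F (fst \<omega>) (snd \<omega>))"
    let ?NH = "{\<omega> \<in> ?\<Omega>. no_hit (fst \<omega>) (snd \<omega>)}"
    obtain g where g: "solution_vec x d g" using solution_vecI[OF sol] d_pos by auto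
    have cardO: "real (card ?\<Omega>) = (real_of_int Q)\<^sup>2"
      using Q0 by (simp add: card_cartesian_product power2_eq_square)
    have "?\<Omega> - ?NH \<subseteq> ?\<Omega> \<inter> ?f -` ?Sol"
    proof
      fix \<omega> assume \<omega>: "\<omega> \<in> ?\<Omega> - ?NH"
      then obtain c where c: "?f \<omega> = Some c" using F(3)[of "fst \<omega>" "snd \<omega>"] by (cases "?f \<omega>") auto
      then have "is_solution {-d..d} x c" using F(2)[of "fst \<omega>" "snd \<omega>" c] \<omega> by auto
      then show "\<omega> \<in> ?\<Omega> \<inter> ?f -` ?Sol" using \<omega> c by auto
    qed
    then have "card (?\<Omega> - ?NH) \<le> card (?\<Omega> \<inter> ?f -` ?Sol)" by (intro card_mono) auto
    moreover have "card (?\<Omega> - ?NH) = card ?\<Omega> - card ?NH" by (intro card_Diff_subset) auto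
    ultimately have "real (card ?\<Omega>) - real (card ?NH) \<le> real (card (?\<Omega> \<inter> ?f -` ?Sol))" by linarith
    then have "(real_of_int Q)\<^sup>2 - (real_of_int Q)\<^sup>2 * failure_bound \<le> real (card (?\<Omega> \<inter> ?f -` ?Sol))"
      using card_no_hit[OF g A1] cardO by linarith
    then have "1 - failure_bound \<le> real (card (?\<Omega> \<inter> ?f -` ?Sol)) / real (card ?\<Omega>)"
    proof -
      have P: "0 < (real_of_int Q)\<^sup>2" using Q0 by (simp only: zero_less_power of_int_0_less_iff)
      assume *: "(real_of_int Q)\<^sup>2 - (real_of_int Q)\<^sup>2 * failure_bound \<le> real (card (?\<Omega> \<inter> ?f -` ?Sol))"
      show ?thesis unfolding cardO pos_le_divide_eq[OF P] using * by (simp only: left_diff_distrib mult_1 mult.commute)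
    qed
    also have "\<dots> = measure (measure_spmf (run w ?T ?p x)) ?Sol"
      unfolding rn measure_map_spmf by (simp add: measure_spmf_of_set)
    finally show ?thesis .
  qed
qed

end

section \<open>Choice of the parameters\<close>

text \<open>At t = 1 the sum of the t powr (f c - \<theta>) equals card S and its derivative, the
  sum of the f c - \<theta>, is positive. So some t slightly below 1 gives a smaller value.\<close>

lemma moment_rate:
  fixes S :: "int set" and f :: "int \<Rightarrow> int" and \<theta> :: real
  assumes "finite S" "\<theta> * card S < real_of_int (\<Sum>c\<in>S. f c)"
  obtains t where "0 < t" "t < 1" "(\<Sum>c\<in>S. t powr f c) * t powr (- \<theta>) < card S"
proof -
  let ?\<phi> = "\<lambda>t. \<Sum>c\<in>S. t powr (f c - \<theta>)"
  have "(?\<phi> has_real_derivative (\<Sum>c\<in>S. (f c - \<theta>) * 1 powr (f c - \<theta> - 1))) (at 1)"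
    by (intro DERIV_sum has_real_derivative_powr) auto
  moreover have "0 < (\<Sum>c\<in>S. (f c - \<theta>) * 1 powr (f c - \<theta> - 1))"
    using assms(2) by (simp add: sum_subtractf mult.commute)
  ultimately obtain \<delta> where \<delta>: "0 < \<delta>" "\<And>h. 0 < h \<Longrightarrow> h < \<delta> \<Longrightarrow> ?\<phi> (1 - h) < ?\<phi> 1"
    using DERIV_pos_inc_left[of ?\<phi> _ 1] by blast
  define h where "h = min (\<delta> / 2) (1 / 2)"
  have h: "0 < h" "h < \<delta>" "h < 1" using \<delta>(1) by (auto simp: h_def min_def)
  have "?\<phi> (1 - h) < card S" using \<delta>(2)[OF h(1,2)] by simp
  moreover have "?\<phi> (1 - h) = (\<Sum>c\<in>S. (1 - h) powr f c) * (1 - h) powr (- \<theta>)"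
    by (simp add: sum_distrib_right powr_add[symmetric])
  ultimately show thesis using h by (intro that[of "1 - h"]) auto
qed

text \<open>A weight bound strictly below the average saves an exponential factor over all vectors
  on half of the positions, of which there are about sqrt (2 d + 1) to the n. The constant C pays
  for the longer half when n is odd and for the slack in the threshold.\<close>

lemma lev_rate:
  fixes d :: int and f :: "int \<Rightarrow> int" and \<theta> :: real
  assumes d: "0 < d" and \<theta>: "\<theta> * real_of_int (2 * d + 1) < real_of_int (\<Sum>c\<in>{-d..d}. f c)"
    and c0: "c0 \<in> {-d..d}" "f c0 = 0"
  obtains C \<gamma> where "0 < C" "0 < \<gamma>" "\<gamma> < sqrt (real_of_int (2 * d + 1))"
    "\<And>(n :: nat) l pos \<tau>. l \<le> n - n div 2 \<Longrightarrow> 0 \<le> \<tau> \<Longrightarrow> real_of_int \<tau> \<le> \<theta> * real n / 2 + real_of_int (2 * d + 1) \<Longrightarrow>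
       real (length (lev n [-d..d] f \<tau> pos l)) \<le> C * \<gamma> ^ n"
proof -
  have "card {-d..d} = nat (2 * d + 1)" by (simp add: algebra_simps)
  then have card: "real (card {-d..d}) = 2 * d + 1" using d by simp
  obtain t where t: "0 < t" "t < 1" "(\<Sum>c\<in>{-d..d}. t powr f c) * t powr (- \<theta>) < 2 * d + 1"
    using moment_rate[of "{-d..d}" \<theta> f] \<theta> card by auto
  define \<Phi> where "\<Phi> = (\<Sum>c\<in>{-d..d}. t powr f c)"
  have \<Phi>: "\<Phi> = (\<Sum>c\<leftarrow>[-d..d]. t powr f c)"
    by (simp add: \<Phi>_def sum_list_distinct_conv_sum_set)
  \<comment> \<open>The coefficient of weight 0 yields \<Phi> \<ge> 1, so powers of \<Phi> grow with
    the exponent and the length (n + 1) / 2 bounds all l.\<close>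
  have "t powr f c0 \<le> \<Phi>" unfolding \<Phi>_def using c0 by (intro member_le_sum) auto
  then have \<Phi>1: "1 \<le> \<Phi>" using c0 t by simp
  define \<gamma> where "\<gamma> = (\<Phi> * t powr (- \<theta>)) powr (1 / 2)"
  define C where "C = \<Phi> powr (1 / 2) * t powr (- real_of_int (2 * d + 1))"
  have pos: "0 < \<Phi> * t powr (- \<theta>)" using \<Phi>1 t by simp
  show thesis
  proof (rule that[of C \<gamma>])
    show "0 < C" "0 < \<gamma>" using \<Phi>1 t pos by (auto simp: C_def \<gamma>_def)
    show "\<gamma> < sqrt (real_of_int (2 * d + 1))"
      unfolding \<gamma>_def powr_half_sqrt[OF less_imp_le[OF pos]] using t(3) by (simp add: \<Phi>_def)
    fix n l pos' :: nat and \<tau> :: int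
    assume l: "l \<le> n - n div 2" and \<tau>: "0 \<le> \<tau>" "real_of_int \<tau> \<le> \<theta> * real n / 2 + real_of_int (2 * d + 1)"
    let ?len = "real (length (lev n [-d..d] f \<tau> pos' l))"
    have "?len * t powr (\<theta> * real n / 2 + real_of_int (2 * d + 1)) \<le> ?len * t powr \<tau>"
      using t \<tau> by (intro mult_left_mono powr_mono') auto
    also have "\<dots> \<le> \<Phi> ^ l" using length_lev_le[of t \<tau> n "[-d..d]" f pos' l] t \<tau> by (simp add: \<Phi>)
    also have "\<dots> = \<Phi> powr l" using \<Phi>1 by (simp add: powr_realpow)
    also have "\<dots> \<le> \<Phi> powr (n / 2 + 1 / 2)"
    proof (rule powr_mono)
      have "2 * l \<le> n + 1" using l by linarith
      then show "real l \<le> n / 2 + 1 / 2" by linarith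
    qed (rule \<Phi>1)
    finally have 1: "?len * t powr (\<theta> * real n / 2 + real_of_int (2 * d + 1)) \<le> \<Phi> powr (n / 2 + 1 / 2)" .
    have "t powr y * t powr (- y) = 1" for y using t by (simp add: powr_minus)
    then have "?len = ?len * t powr (\<theta> * real n / 2 + real_of_int (2 * d + 1)) * t powr (- (\<theta> * real n / 2 + real_of_int (2 * d + 1)))"
      by (simp only: mult.assoc mult_1_right)
    also have "\<dots> \<le> \<Phi> powr (n / 2 + 1 / 2) * t powr (- (\<theta> * real n / 2 + real_of_int (2 * d + 1)))"
      using 1 by (intro mult_right_mono) auto
    also have "\<dots> = C * (\<Phi> powr (n / 2) * t powr (- (\<theta> * n / 2)))"
    proof -
      have "- (\<theta> * real n / 2 + real_of_int (2 * d + 1)) = - (\<theta> * n / 2) + - real_of_int (2 * d + 1)" by simp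
      then show ?thesis unfolding C_def by (simp only: powr_add ac_simps)
    qed
    also have "\<Phi> powr (n / 2) * t powr (- (\<theta> * n / 2)) = (\<Phi> * t powr (- \<theta>)) powr (n / 2)"
      using \<Phi>1 t by (simp add: powr_mult powr_powr)
    also have "\<dots> = \<gamma> ^ n"
    proof -
      have "0 < \<gamma>" unfolding \<gamma>_def powr_gt_zero using pos by linarith
      then have "\<gamma> ^ n = \<gamma> powr n" by (simp add: powr_realpow)
      then show ?thesis by (simp add: \<gamma>_def powr_powr)
    qed
    finally show "?len \<le> C * \<gamma> ^ n" .
  qed
qed

lemma sum_abs_symmetric: "(\<Sum>c\<in>{- int D..int D}. \<bar>c\<bar>) = int D * (int D + 1)"
proof (induction D)
  case (Suc D)
  have "{- int (Suc D)..int (Suc D)} = insert (int (Suc D)) (insert (- int (Suc D)) {- int D..int D})"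
    by auto
  then show ?case using Suc by (simp add: algebra_simps)
qed simp

text \<open>This is what makes the balanced case fast enough; it amounts to Bernoulli's inequality.\<close>

lemma power_base_less:
  assumes "1 \<le> (D :: nat)"
  shows "real (D + 1) ^ (2 * D + 2) < real (2 * D + 1) ^ (2 * D + 1)"
proof -
  let ?r = "real D / (D + 1)"
  have "1 + real (2 * D + 1) * ?r \<le> (1 + ?r) ^ (2 * D + 1)"
    by (rule Bernoulli_inequality) (simp add: order_trans[of _ 0])
  moreover have "real (D + 1) < 1 + real (2 * D + 1) * ?r"
  proof -
    have "real D * (D + 1) < real D * (2 * D + 1)" using assms by simp
    then show ?thesis by (simp add: field_simps)
  qed
  ultimately have "real (D + 1) < (1 + ?r) ^ (2 * D + 1)" by linarith
  then have "real (D + 1) * real (D + 1) ^ (2 * D + 1) < (1 + ?r) ^ (2 * D + 1) * real (D + 1) ^ (2 * D + 1)"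
    by (intro mult_strict_right_mono) auto
  also have "\<dots> = ((1 + ?r) * real (D + 1)) ^ (2 * D + 1)" by (rule power_mult_distrib[symmetric])
  also have "(1 + ?r) * real (D + 1) = real (2 * D + 1)" by (simp add: field_simps)
  finally show ?thesis by simp
qed

text \<open>The strict inequality of \<open>power_base_less\<close> has a ratio \<rho> > 1. Scaling
  all exponents by D Z makes the gap \<rho>^(D Z) exceed (D + 1)^6, the cost of the additive
  constant 3. The lower bound 2 on Z later keeps the truncated subtractions exact.\<close>

lemma scale_exists:
  assumes "1 \<le> (D :: nat)"
  obtains Z where "2 \<le> Z" "real (D + 1) ^ (2 * (D * (D + 1) * Z + 3)) < real (2 * D + 1) ^ ((2 * D + 1) * D * Z)"
proof -
  define \<rho> where "\<rho> = real (2 * D + 1) ^ (2 * D + 1) / real (D + 1) ^ (2 * D + 2)"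
  have \<rho>: "1 < \<rho>" using power_base_less[OF assms] by (simp add: \<rho>_def)
  obtain Z0 where Z0: "real (D + 1) ^ 6 < \<rho> ^ Z0" using real_arch_pow[OF \<rho>] by blast
  define Z where "Z = Z0 + 2"
  have "1 * Z \<le> D * Z" using assms by (intro mult_right_mono) auto
  then have "Z0 \<le> D * Z" by (simp add: Z_def)
  then have "\<rho> ^ Z0 \<le> \<rho> ^ (D * Z)" using \<rho> by (intro power_increasing) auto
  then have "real (D + 1) ^ 6 < \<rho> ^ (D * Z)" using Z0 by linarith
  also have "\<dots> = real (2 * D + 1) ^ ((2 * D + 1) * (D * Z)) / real (D + 1) ^ ((2 * D + 2) * (D * Z))"
    unfolding \<rho>_def power_divide power_mult ..
  finally have "real (D + 1) ^ 6 * real (D + 1) ^ ((2 * D + 2) * (D * Z)) < real (2 * D + 1) ^ ((2 * D + 1) * (D * Z))"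
    by (simp add: field_simps)
  moreover have "6 + (2 * D + 2) * (D * Z) = 2 * (D * (D + 1) * Z + 3)" by (simp add: algebra_simps)
  ultimately have "real (D + 1) ^ (2 * (D * (D + 1) * Z + 3)) < real (2 * D + 1) ^ ((2 * D + 1) * D * Z)"
    by (simp only: power_add[symmetric] mult.assoc)
  then show thesis by (intro that[of Z]) (auto simp: Z_def)
qed

text \<open>Apart from the input integers, every quantity is built from few factors that are at most
  M = 2^(e (n + 1)); the integers contribute one factor 2^b. So M^8 2^b is a common bound, and its
  16th power fits into the chosen word.\<close>

lemma balancing_intro:
  fixes x :: "int list" and d q A1 A2 c1 c2 :: int and e b B :: nat
  defines "n \<equiv> length x"
  assumes pos: "0 < d" "0 < q" "0 \<le> A1" "0 \<le> A2" "1 \<le> c1" "1 \<le> c2" "2 \<le> e"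
    and G: "2 * d + 1 \<le> 2 ^ e" "c1 \<le> 2 ^ e" "c2 \<le> 2 ^ e" "2 * q \<le> 2 ^ e" "A1 \<le> 2 ^ e" "A2 \<le> 2 ^ e"
    and x: "\<And>i. i < n \<Longrightarrow> \<bar>x ! i\<bar> \<le> 2 ^ b" and B: "int B \<le> 2 ^ (e * (n + 1))"
    and lists: "\<And>l pos. l \<le> n - n div 2 \<Longrightarrow> length (lev n [-d..d] (\<lambda>c. \<bar>c\<bar>) (threshold d q n A1) pos l) \<le> B"
      "\<And>l pos. l \<le> n - n div 2 \<Longrightarrow> length (lev n [-d..d] (\<lambda>c. d - \<bar>c\<bar>) (threshold d q n A2) pos l) \<le> B"
      "\<And>l pos. l \<le> n - n div 2 \<Longrightarrow> length (lev n [0..d] (\<lambda>c. 0) 0 pos l) \<le> B"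
  shows "balancing (16 * (8 * (e * (n + 1)) + b) + 1) (2 ^ (8 * (e * (n + 1)) + b)) x d q A1 A2 c1 c2 B"
proof -
  define G :: int where "G = 2 ^ e"
  define M :: int where "M = 2 ^ (e * (n + 1))"
  define b2 :: int where "b2 = 2 ^ b"
  let ?H = "2 ^ (8 * (e * (n + 1)) + b) :: int"
  let ?S = "\<Sum>i<n. \<bar>x ! i\<bar>"
  have H: "?H = M ^ 8 * b2"
    unfolding M_def b2_def power_mult[symmetric] power_add[symmetric] by (simp add: mult.commute)
  have G4: "4 \<le> G" using power_increasing[of 2 e "2 :: int"] pos by (simp add: G_def)
  have MG: "M = G ^ n * G" by (simp add: M_def G_def power_mult[symmetric] power_add[symmetric])
  have Gn: "1 \<le> G ^ n" using G4 by (simp add: one_le_power)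
  have GM: "G \<le> M" using mult_right_mono[OF Gn, of G] G4 by (simp add: MG)
  have GnM: "G ^ n \<le> M" using mult_left_mono[of 1 G "G ^ n"] Gn G4 by (simp add: MG)
  have M1: "1 \<le> M" using GM G4 by linarith
  have b2: "1 \<le> b2" by (simp add: b2_def)
  have "int n + 1 \<le> G ^ n"
  proof -
    have "int n + 1 \<le> 2 ^ n" by (induction n) auto
    also have "\<dots> \<le> G ^ n" using G4 by (intro power_mono) auto
    finally show ?thesis .
  qed
  then have "(int n + 1) * 4 \<le> M" unfolding MG using G4 Gn by (intro mult_mono) auto
  then have "4 * int n + 4 \<le> M" by simp
  then have nM: "2 * int n + 2 \<le> M" "int n \<le> M" by linarith+
  have leH: "y \<le> ?H" if "y \<le> M ^ i * b2" "i \<le> 8" for y i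
  proof -
    have "M ^ i \<le> M ^ 8" using that M1 by (intro power_increasing) auto
    then have "M ^ i * b2 \<le> M ^ 8 * b2" using b2 by (intro mult_right_mono) auto
    then show ?thesis using that H by linarith
  qed
  have leH': "y \<le> ?H" if "y \<le> M ^ i" "i \<le> 8" for y i
  proof (rule leH[OF _ that(2)])
    have "M ^ i * 1 \<le> M ^ i * b2" using b2 M1 by (intro mult_left_mono) auto
    then show "y \<le> M ^ i * b2" using that by linarith
  qed
  have small: "y \<le> ?H" if "y \<le> M" for y using leH'[of y 1] that by simp
  have smallG: "y \<le> ?H" if "y \<le> 2 ^ e" for y using small[of y] that GM by (simp add: G_def)
  have dG: "2 * d + 1 \<le> G" "d + 1 \<le> G" "d \<le> M" using G(1) pos(1) GM by (auto simp: G_def)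
  have S: "?S \<le> int n * b2" using x sum_bounded_above[of "{..<n}" "\<lambda>i. \<bar>x ! i\<bar>" b2] by (simp add: b2_def)
  have S0: "0 \<le> ?S" by (simp add: sum_nonneg)
  have B1: "B1_val x d \<le> M ^ 2 * b2"
  proof -
    have "d * ?S \<le> d * (int n * b2)" using S pos by (intro mult_left_mono) auto
    moreover have "1 \<le> d * b2" using pos b2 mult_mono[of 1 d 1 b2] by simp
    ultimately have "B1_val x d \<le> d * ((int n + 1) * b2)" by (simp add: B1_val_def n_def algebra_simps)
    also have "\<dots> \<le> M * (M * b2)" using dG nM b2 pos M1 by (intro mult_mono) auto
    finally show ?thesis by (simp add: power2_eq_square mult.assoc)
  qed
  have B1p: "0 < B1_val x d" using S0 pos by (simp add: B1_val_def n_def add_nonneg_pos)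
  have pw: "y ^ k \<le> G ^ n" if "1 \<le> y" "y \<le> G" "k \<le> n" for y :: int and k
    using power_mono[of y G k] power_increasing[of k n G] that G4 by linarith
  have mq: "n div nat q \<le> n" by simp
  have K: "K_val d q c1 n \<le> M"
  proof -
    have "K_val d q c1 n \<le> G * G ^ n"
      unfolding K_val_def using dG pos pw[OF pos(5) _ mq] G(2) G4 by (intro mult_mono) (auto simp: G_def)
    then show ?thesis by (simp add: MG mult.commute)
  qed
  have K0: "0 < K_val d q c1 n" using pos by (simp add: K_val_def)
  have Lb: "L_val x d \<le> M ^ 3 * b2"
  proof -
    have "(d + 1) ^ n \<le> M" using pw[of "d + 1" n] dG pos GnM by linarith
    then have "L_val x d \<le> (M ^ 2 * b2) * M"
      unfolding L_val_def n_def[symmetric] using B1 B1p M1 b2 pos by (intro mult_mono) auto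
    then show ?thesis by (simp add: power_numeral_reduce mult.commute mult.left_commute)
  qed
  have L0: "0 < L_val x d" using B1p pos by (simp add: L_val_def)
  have thr: "threshold d q n A \<le> ?H" if A: "0 \<le> A" "A \<le> 2 ^ e" for A
  proof -
    have "A * int n \<le> M * M" using A nM GM M1 by (intro mult_mono) (auto simp: G_def)
    moreover have "(A * int n) div (2 * q) \<le> A * int n"
      using abs_div_le[of "A * int n" "2 * q"] A by (simp add: abs_le_iff)
    moreover have "2 * d + 1 \<le> M * M" using dG GM M1 mult_left_mono[of 1 M M] by linarith
    ultimately have "threshold d q n A \<le> 2 * (M * M)" by (simp add: threshold_def)
    also have "\<dots> \<le> M * (M * M)" using GM G4 M1 by (intro mult_right_mono) auto
    finally show ?thesis using leH'[of _ 3] by (simp add: power_numeral_reduce)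
  qed
  show ?thesis
  proof (unfold_locales, fold n_def)
    show "2 \<le> ?H" using small[of 2] GM G4 by simp
    show "?H ^ 16 < 2 ^ (16 * (8 * (e * (n + 1)) + b) + 1)"
      unfolding power_mult[symmetric] by (rule power_strict_increasing) auto
    show "0 < d" by fact
    show "d * ?S \<le> ?H" using leH[OF B1] by (simp add: B1_val_def n_def)
    show "(2 * d + 1) ^ n \<le> ?H"
      using pw[of "2 * d + 1" n] dG pos small[OF GnM] by linarith
    have "d * (2 * int n + 2) \<le> M * M" using dG nM pos M1 by (intro mult_mono) auto
    then show "d * (2 * int n + 2) \<le> ?H" using leH'[of _ 2] by (simp add: power2_eq_square)
    show "2 * d + 1 \<le> ?H" "c1 \<le> ?H" "c2 \<le> ?H" "2 * q \<le> ?H" "A1 \<le> ?H" "A2 \<le> ?H" using smallG G by auto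
    show "1 \<le> c1" "1 \<le> c2" "0 < q" "0 \<le> A1" "0 \<le> A2" by fact+
    have "K_val d q c1 n * L_val x d \<le> M * (M ^ 3 * b2)" using K Lb K0 L0 M1 by (intro mult_mono) auto
    then show "K_val d q c1 n * L_val x d \<le> ?H" using leH[of _ 4] by (simp add: power_numeral_reduce mult.assoc)
    have "K_val d q c1 n * (2 * int n + 1) \<le> M * M" using K K0 nM M1 by (intro mult_mono) auto
    then show "K_val d q c1 n * (2 * int n + 1) \<le> ?H" using leH'[of _ 2] by (simp add: power2_eq_square)
    have "2 * B1_val x d * (2 * int n + 1) \<le> M * (M ^ 2 * b2) * M"
      using B1 B1p nM M1 b2 GM G4 by (intro mult_mono) auto
    then show "2 * B1_val x d * (2 * int n + 1) \<le> ?H"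
      using leH[of _ 4] by (simp add: power_numeral_reduce mult.commute mult.left_commute)
    have "c2 ^ (n div nat q) + 1 \<le> G ^ n * 2" using pw[OF pos(6) G(3)[folded G_def] mq] Gn by linarith
    also have "\<dots> \<le> M" unfolding MG using G4 Gn by (intro mult_left_mono) auto
    finally show "c2 ^ (n div nat q) + 1 \<le> ?H" by (rule small)
    show "threshold d q n A1 \<le> ?H" "threshold d q n A2 \<le> ?H" using thr pos G by auto
    have "(2 * int n + 1) * (2 * (int n + 1) * int B) \<le> M * (M * M)"
      using nM B M1 by (intro mult_mono) (auto simp: M_def)
    moreover have "2 * d + 1 \<le> M * (M * M)"
      using dG GM M1 mult_mono[of M M 1 "M * M"] mult_mono[of 1 M 1 M] by linarith
    ultimately have "(2 * int n + 1) * (2 * (int n + 1) * int B) + 2 * d + 1 \<le> 2 * (M * (M * M))" by linarith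
    also have "\<dots> \<le> M * (M * (M * M))" using GM G4 M1 by (intro mult_right_mono) auto
    finally show "(2 * int n + 1) * (2 * (int n + 1) * int B) + 2 * d + 1 \<le> ?H"
      using leH'[of _ 4] by (simp add: power_numeral_reduce)
  qed (use lists in auto)
qed

lemma threshold_bounds:
  fixes d q A :: int and n :: nat
  assumes "0 < d" "0 < q" "0 \<le> A"
  shows "0 \<le> threshold d q n A" "real_of_int (threshold d q n A) \<le> (real_of_int A / real_of_int q) * real n / 2 + real_of_int (2 * d + 1)"
proof -
  show "0 \<le> threshold d q n A"
    using assms by (simp add: threshold_def pos_imp_zdiv_nonneg_iff)
  have "real_of_int ((A * int n) div (2 * q)) \<le> real_of_int (A * int n) / real_of_int (2 * q)"
    by (rule real_of_int_div4)
  then show "real_of_int (threshold d q n A) \<le> (real_of_int A / real_of_int q) * real n / 2 + real_of_int (2 * d + 1)"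
    by (simp add: threshold_def)
qed

lemma program_time_le:
  assumes "1 \<le> n" "real B \<le> X" "real lm \<le> X" "1 \<le> X"
  shows "real (program_time d n B lm) \<le> (96 + 3 * (2 * real (16 * nat (2 * d + 1) + 8) + 208)) * (real n ^ 2 * X)"
proof -
  define \<kappa> where "\<kappa> = 16 * nat (2 * d + 1) + 8"
  have n: "1 \<le> real n" using assms by simp
  have nX: "real n * 1 \<le> real n * (real n * X)"
    using n assms mult_mono[of 1 "real n" 1 X] by (intro mult_left_mono) auto
  have X: "X \<le> real n * X" using n assms mult_right_mono[of 1 "real n" X] by simp
  have "real (program_time d n B lm) = 36 * real n + 60 +
      (2 * real n + 1) * (2 * (real n * (real B * real \<kappa> + 12)) + 40 * real B + 24 * real lm + 120)"
    by (simp add: program_time_def \<kappa>_def algebra_simps)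
  also have "\<dots> \<le> 96 * real n + (3 * real n) * (2 * (real n * (X * real \<kappa> + 12 * X)) + 40 * X + 24 * X + 120 * X)"
    using n assms by (intro add_mono mult_mono mult_left_mono mult_right_mono) auto
  also have "\<dots> \<le> 96 * real n + (3 * real n) * (2 * (real n * (X * real \<kappa> + 12 * X)) + 184 * (real n * X))"
    using X n by (intro add_left_mono mult_left_mono) auto
  also have "\<dots> = 96 * (real n * 1) + 3 * (2 * real \<kappa> + 208) * (real n * (real n * X))"
    by (simp add: algebra_simps)
  also have "\<dots> \<le> 96 * (real n * (real n * X)) + 3 * (2 * real \<kappa> + 208) * (real n * (real n * X))"
    using nX by (intro add_right_mono) simp
  finally show ?thesis unfolding \<kappa>_def[symmetric] by (simp add: power2_eq_square algebra_simps)
qed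

text \<open>Let a = d + 1 and m = n div q. There are at least a^((p1 + 1) n / q) sums against a^(p1
  m + 1) buckets, and p1 + p2 = q + 1 makes buckets times limit at least a^((q + 1) m), against a^n
  \<le> a^(q m + q) box vectors. Each surplus 1 in the exponents yields a factor a^(-m).\<close>

lemma failure_small:
  fixes D q p1 p2 n :: nat
  assumes D: "1 \<le> D" and q: "0 < q" "p1 + p2 = q + 1"
    and bal: "balancing w H x (int D) (int q) A1 (int (D * (p1 + 1))) (int (D + 1) ^ p1) (int (D + 1) ^ p2) B"
    and n: "n = length x"
  shows "balancing.failure_bound x (int D) (int q) (int (D * (p1 + 1))) (int (D + 1) ^ p1) (int (D + 1) ^ p2)
    \<le> 4 * real (D + 1) ^ q / 2 ^ (n div q)"
proof -
  define a where "a = real (D + 1)"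
  define m where "m = n div q"
  have a: "2 \<le> a" "1 \<le> a" "0 < a" using D by (auto simp: a_def)
  have Ka: "real_of_int (K_val (int D) (int q) (int (D + 1) ^ p1) n) = a ^ (p1 * m + 1)"
    by (simp add: K_val_def a_def m_def power_mult add.commute)
  have la: "real (lim_val (int q) (int (D + 1) ^ p2) n) = a ^ (p2 * m) + 1"
  proof -
    have "lim_val (int q) (int (D + 1) ^ p2) n = nat (int ((D + 1) ^ (p2 * m) + 1))"
      by (simp add: lim_val_def m_def power_mult)
    then show ?thesis unfolding nat_int by (simp add: a_def)
  qed
  have expo: "real (D * (p1 + 1)) * real n / (real q * real D) = real (p1 + 1) * (real n / real q)"
    using D q(1) by (simp add: field_simps)
  have mn: "real m \<le> real n / q" unfolding m_def 
    using q(1) of_nat_mono[OF div_times_less_eq_dividend[of n q], where 'a = real] by (simp add: field_simps)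
  have "a ^ ((p1 + 1) * m) = a powr ((p1 + 1) * real m)" using a by (simp add: powr_realpow[symmetric] algebra_simps)
  also have "\<dots> \<le> a powr ((p1 + 1) * (real n / q))" using a mn by (intro powr_mono mult_left_mono) auto
  finally have 1: "a ^ ((p1 + 1) * m) \<le> a powr ((p1 + 1) * (real n / q))" .
  have "a ^ (p1 * m + 1) / a powr ((p1 + 1) * (real n / q)) \<le> a ^ (p1 * m + 1) / a ^ ((p1 + 1) * m)"
    using 1 a by (intro divide_left_mono) auto
  also have "\<dots> = a / a ^ m" using a by (simp add: power_add field_simps)
  finally have t1: "a ^ (p1 * m + 1) / a powr ((p1 + 1) * (real n / q)) \<le> a / a ^ m" .
  have t2: "1 / a ^ n \<le> 1 / a ^ m"
    using a by (intro divide_left_mono power_increasing) (auto simp: m_def)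
  have t3: "2 * a ^ n / (a ^ (p1 * m + 1) * (a ^ (p2 * m) + 1)) \<le> 2 * a ^ q / a ^ m"
  proof -
    have "n < q * m + q" using dividend_less_times_div[OF q(1), of n] unfolding m_def by linarith
    then have "a ^ n \<le> a ^ (q * m + q)" using a by (intro power_increasing) auto
    moreover have "a ^ (p1 * m) * a ^ (p2 * m) \<le> a ^ (p1 * m + 1) * (a ^ (p2 * m) + 1)"
      using a by (intro mult_mono power_increasing) auto
    ultimately have "2 * a ^ n / (a ^ (p1 * m + 1) * (a ^ (p2 * m) + 1)) \<le>
        2 * a ^ (q * m + q) / (a ^ (p1 * m) * a ^ (p2 * m))"
      using a by (intro frac_le) auto
    also have "a ^ (p1 * m) * a ^ (p2 * m) = a ^ (q * m) * a ^ m"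
      by (simp add: power_add[symmetric] distrib_right[symmetric] q(2) add.commute)
    also have "2 * a ^ (q * m + q) / (a ^ (q * m) * a ^ m) = 2 * a ^ q / a ^ m"
      using a by (simp add: power_add)
    finally show ?thesis .
  qed
  have aq: "a \<le> a ^ q" "1 \<le> a ^ q" using a q(1) self_le_power[of a q] by (auto simp: one_le_power)
  have "balancing.failure_bound x (int D) (int q) (int (D * (p1 + 1))) (int (D + 1) ^ p1) (int (D + 1) ^ p2) =
    a ^ (p1 * m + 1) / a powr ((p1 + 1) * (real n / q)) + 1 / a ^ n +
      2 * a ^ n / (a ^ (p1 * m + 1) * (a ^ (p2 * m) + 1))"
  proof -
    have aD: "real_of_int (int D + 1) = a" by (simp add: a_def)
    show ?thesis
      unfolding balancing.failure_bound_def[OF bal] n[symmetric] of_int_mult of_int_of_nat_eq Ka la aD expo ..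
  qed
  also have "\<dots> \<le> a / a ^ m + 1 / a ^ m + 2 * a ^ q / a ^ m" using t1 t2 t3 by linarith
  also have "\<dots> = (a + 1 + 2 * a ^ q) / a ^ m" by (simp add: add_divide_distrib)
  also have "\<dots> \<le> 4 * a ^ q / 2 ^ m" using aq a by (intro frac_le power_mono) auto
  finally show ?thesis by (simp add: a_def m_def)
qed

text \<open>Halving the rate from 1 / q to 1 / (2 q) pays for the constant A and for rounding n / q
  down.\<close>

lemma eventually_small:
  fixes q :: nat and A :: real
  assumes q: "0 < q" and A: "0 < A"
  shows "\<forall>\<^sub>F n in sequentially. A / 2 ^ (n div q) \<le> 2 powr (- (1 / (2 * real q)) * real n)"
proof -
  have "\<forall>\<^sub>F n in sequentially. 2 * real q * log 2 (2 * A) \<le> real n"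
    by (rule filterlim_real_sequentially[unfolded filterlim_at_top, rule_format])
  then show ?thesis
  proof eventually_elim
    case (elim n)
    let ?m = "n div q"
    have "n < q * ?m + q" using dividend_less_times_div[OF q, of n] by linarith
    then have "real n < real (q * ?m + q)" by (simp only: of_nat_less_iff)
    then have "real n / q \<le> real ?m + 1" using q by (simp add: field_simps)
    moreover have "log 2 (2 * A) \<le> real n / (2 * q)" using elim q by (simp add: field_simps)
    ultimately have "log 2 (2 * A) + real n / (2 * q) \<le> real ?m + 1" by simp
    then have "2 powr (log 2 (2 * A) + real n / (2 * q)) \<le> 2 powr (real ?m + 1)" by simp
    then have "2 * A * 2 powr (real n / (2 * q)) \<le> 2 * 2 ^ ?m"
      using A by (simp add: powr_add powr_realpow)
    then show ?case by (simp add: powr_minus field_simps)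
  qed
qed

lemma poly_bounded_word:
  assumes "poly_bounded b"
  shows "poly_bounded (\<lambda>n. 16 * (8 * (e * (n + 1)) + b n) + 1)"
proof -
  obtain k where k: "(\<lambda>n. real (b n)) \<in> O(\<lambda>n. real n ^ k)" using assms by (auto simp: poly_bounded_def)
  then obtain c where c: "\<forall>\<^sub>F n in sequentially. norm (real (b n)) \<le> c * norm (real n ^ k)"
    by (rule landau_o.bigE)
  have "\<forall>\<^sub>F n in sequentially. norm (real (16 * (8 * (e * (n + 1)) + b n) + 1)) \<le>
      (256 * real e + 16 * \<bar>c\<bar> + 1) * norm (real n ^ (k + 1))"
    using c eventually_gt_at_top[of 0]
  proof eventually_elim
    case (elim n)
    have n: "1 \<le> real n" using elim(2) by simp
    then have k1: "1 \<le> real n ^ k" by (rule one_le_power)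
    have nk: "real n ^ k \<le> real n ^ (k + 1)" "real n \<le> real n ^ (k + 1)" "1 \<le> real n ^ (k + 1)"
      using n k1 mult_mono[of 1 "real n" "real n ^ k" "real n ^ k"] mult_left_mono[of 1 "real n ^ k" "real n"]
        one_le_power[of "real n" "k + 1"] by auto
    have "real (b n) \<le> c * real n ^ k" using elim(1) by simp
    also have "\<dots> \<le> \<bar>c\<bar> * real n ^ (k + 1)" using nk by (intro mult_mono) auto
    finally have 1: "real (b n) \<le> \<bar>c\<bar> * real n ^ (k + 1)" .
    have "real n + 1 \<le> 2 * real n ^ (k + 1)" using nk by linarith
    then have "real e * (real n + 1) \<le> real e * (2 * real n ^ (k + 1))" by (intro mult_left_mono) auto
    then have "real (16 * (8 * (e * (n + 1)) + b n) + 1) \<le>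
        256 * (real e * real n ^ (k + 1)) + 16 * (\<bar>c\<bar> * real n ^ (k + 1)) + real n ^ (k + 1)"
      using 1 nk by (simp add: algebra_simps)
    then show ?case by (simp add: algebra_simps)
  qed
  then show ?thesis unfolding poly_bounded_def by (blast intro: bigoI)
qed

lemma card_symmetric_interval: "real (card {- int D..int D}) = 2 * real D + 1"
proof -
  have "card {- int D..int D} = 2 * D + 1" by simp
  then show ?thesis by simp
qed

lemma box_rate:
  fixes D n l pos :: nat
  assumes "l \<le> n - n div 2"
  shows "real (length (lev n [0..int D] (\<lambda>c. 0) 0 pos l)) \<le> (D + 1) * sqrt (D + 1) ^ n"
proof -
  have "real (length (lev n [0..int D] (\<lambda>c. 0) 0 pos l)) \<le> real (D + 1) ^ l"
    using length_lev_le[of 1 0 n "[0..int D]" "\<lambda>_. 0" pos l] by (simp add: sum_list_triv nat_add_distrib add.commute)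
  also have "\<dots> = sqrt (D + 1) ^ (2 * l)" by (simp add: power_mult)
  also have "\<dots> \<le> sqrt (D + 1) ^ (n + 2)" using assms by (intro power_increasing) (linarith, simp)
  also have "sqrt (D + 1) ^ (n + 2) = (D + 1) * sqrt (D + 1) ^ n"
    by (subst power_add) (simp add: mult.commute)
  finally show ?thesis .
qed

lemma lim_rate:
  fixes D q p n :: nat
  assumes "0 < q"
  shows "real (lim_val (int q) (int (D + 1) ^ p) n) \<le> 2 * (real (D + 1) powr (p / q)) ^ n"
proof -
  let ?a = "real (D + 1)"
  have "lim_val (int q) (int (D + 1) ^ p) n = nat (int ((D + 1) ^ (p * (n div q)) + 1))"
    by (simp add: lim_val_def power_mult)
  then have "real (lim_val (int q) (int (D + 1) ^ p) n) = ?a ^ (p * (n div q)) + 1"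
    unfolding nat_int by simp
  also have "\<dots> \<le> 2 * ?a ^ (p * (n div q))" using one_le_power[of ?a "p * (n div q)"] by simp
  also have "?a ^ (p * (n div q)) = ?a powr (real p * real (n div q))"
    by (simp add: powr_realpow[symmetric])
  also have "\<dots> \<le> ?a powr (p / q * n)"
  proof (rule powr_mono)
    have "real (n div q) \<le> real n / q"
      using assms of_nat_mono[OF div_times_less_eq_dividend[of n q], where 'a = real] by (simp add: field_simps)
    then show "real p * real (n div q) \<le> p / q * n"
      using mult_left_mono[of "real (n div q)" "real n / q" "real p"] by simp
  qed simp
  also have "?a powr (p / q * n) = (?a powr (p / q)) ^ n"
    using powr_realpow[of "?a powr (p / q)" n] by (simp add: powr_powr)
  finally show ?thesis by simp
qed

theorem theorem5p4:
  fixes d :: int and C :: "int set"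
  assumes "d > 0" and "C = {-d..d}"
  shows "\<exists>\<delta>>0. \<exists>p. solves_in_O_star C p (\<lambda>n. real (card C) powr ((1/2 - \<delta>) * real n))"
proof -
  define D where "D = nat d"
  have d: "d = int D" and D: "1 \<le> D" using assms(1) by (auto simp: D_def)
  obtain Z where Z: "2 \<le> Z"
    "real (D + 1) ^ (2 * (D * (D + 1) * Z + 3)) < real (2 * D + 1) ^ ((2 * D + 1) * D * Z)"
    by (rule scale_exists[OF D])
  \<comment> \<open>On C the average of |c| is D (D + 1) / (2 D + 1) and that of d - |c| is D^2 / (2
    D + 1). With denominator q, the fractions A1 / q and A2 / q lie below these averages by just 1 /
    q and D / q. The exponent p1 stays one below A2 / D, and p2 is determined by p1 + p2 = q +
    1.\<close>
  define q where "q = (2 * D + 1) * D * Z"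
  define p1 where "p1 = D * D * Z - 2"
  define p2 where "p2 = D * (D + 1) * Z + 3"
  define A1 where "A1 = D * D * (D + 1) * Z - 1"
  define A2 where "A2 = D * (p1 + 1)"
  let ?c1 = "int (D + 1) ^ p1" and ?c2 = "int (D + 1) ^ p2"
  define p where "p = program d (int q) (int A1) (int A2) ?c1 ?c2"
  have q: "0 < q" using D Z by (simp add: q_def)
  have "1 * 2 \<le> (D * D) * Z" using D Z by (intro mult_mono) auto
  then have DDZ: "2 \<le> D * D * Z" by simp
  have p12: "p1 + p2 = q + 1" using DDZ by (simp add: p1_def p2_def q_def algebra_simps)
  have "D * D * Z \<le> D * D * (D + 1) * Z" by simp
  then have "1 \<le> D * D * (D + 1) * Z" using DDZ by linarith
  from of_nat_diff[OF this, where 'a = real] have A1: "real A1 = real D * D * (D + 1) * Z - 1"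
    by (simp add: A1_def algebra_simps)
  \<comment> \<open>Even after the reduction by 1 / q, the average norm D (D + 1) / (2 D + 1) per
    coordinate stays at least D / 2; this amounts to D D Z \<ge> 2.\<close>
  have qA1: "int q * d \<le> 2 * int A1"
  proof -
    have "real q * D \<le> 2 * real A1"
    proof -
      have "real D * D * Z \<ge> 2" using DDZ by (metis of_nat_le_iff of_nat_mult of_nat_numeral)
      then show ?thesis unfolding A1 by (simp add: q_def algebra_simps)
    qed
    then have "real_of_int (int q * d) \<le> real_of_int (2 * int A1)" by (simp add: d)
    then show ?thesis by (simp only: of_int_le_iff)
  qed
  have "real p1 + 1 = real D * D * Z - 1" using DDZ by (simp add: p1_def of_nat_diff)
  moreover have "real A2 = D * (real p1 + 1)" unfolding A2_def of_nat_mult of_nat_add of_nat_1 ..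
  ultimately have A2: "real A2 = D * (real D * D * Z - 1)" by (simp only:)
  have DZ: "0 < real D * Z" using D Z by simp
  have qDZ: "real q = (2 * real D + 1) * (D * Z)" by (simp add: q_def algebra_simps)
  have ratio: "real A / q * (2 * real D + 1) = real A / (D * Z)" for A :: nat
  proof -
    have "a / (s * t) * s = a / t" if "s \<noteq> 0" for a s t :: real using that by simp
    then show ?thesis unfolding qDZ by simp
  qed
  obtain C1 \<gamma>1 where 1: "0 < C1" "0 < \<gamma>1" "\<gamma>1 < sqrt (real_of_int (2 * d + 1))"
    "\<And>(n :: nat) l pos \<tau>. l \<le> n - n div 2 \<Longrightarrow> 0 \<le> \<tau> \<Longrightarrow>
       real_of_int \<tau> \<le> real A1 / real q * real n / 2 + real_of_int (2 * d + 1) \<Longrightarrow>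
       real (length (lev n [-d..d] (\<lambda>c. \<bar>c\<bar>) \<tau> pos l)) \<le> C1 * \<gamma>1 ^ n"
  proof (rule lev_rate[of d "real A1 / real q" "\<lambda>c. \<bar>c\<bar>" 0])
    have "real A1 / (D * Z) < D * (D + 1)" using DZ unfolding A1 by (simp add: field_simps)
    then show "real A1 / real q * real_of_int (2 * d + 1) < real_of_int (\<Sum>c\<in>{-d..d}. \<bar>c\<bar>)"
      using ratio[of A1] unfolding d sum_abs_symmetric by (simp add: distrib_left)
  qed (use assms(1) in auto)
  obtain C2 \<gamma>2 where 2: "0 < C2" "0 < \<gamma>2" "\<gamma>2 < sqrt (real_of_int (2 * d + 1))"
    "\<And>(n :: nat) l pos \<tau>. l \<le> n - n div 2 \<Longrightarrow> 0 \<le> \<tau> \<Longrightarrow>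
       real_of_int \<tau> \<le> real A2 / real q * real n / 2 + real_of_int (2 * d + 1) \<Longrightarrow>
       real (length (lev n [-d..d] (\<lambda>c. d - \<bar>c\<bar>) \<tau> pos l)) \<le> C2 * \<gamma>2 ^ n"
  proof (rule lev_rate[of d "real A2 / real q" "\<lambda>c. d - \<bar>c\<bar>" d])
    have "real A2 / (D * Z) < D * D" using DZ D unfolding A2 by (simp add: field_simps)
    moreover have "(\<Sum>c\<in>{-d..d}. d - \<bar>c\<bar>) = int D * int D"
      unfolding d sum_subtractf sum_abs_symmetric by (simp add: algebra_simps)
    ultimately show "real A2 / real q * real_of_int (2 * d + 1) < real_of_int (\<Sum>c\<in>{-d..d}. d - \<bar>c\<bar>)"
      using ratio[of A2] by (simp add: d)
  qed (use assms(1) in auto)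
  let ?b = "2 * real D + 1"
  define \<gamma>4 where "\<gamma>4 = real (D + 1) powr (p2 / q)"
  have 4: "\<gamma>4 < sqrt ?b"
  proof -
    have "\<gamma>4 ^ (2 * q) = (real (D + 1) powr (p2 / q)) powr (2 * q)"
      by (simp add: \<gamma>4_def powr_realpow[symmetric])
    also have "\<dots> = real (D + 1) powr (2 * p2)" using q by (simp add: powr_powr mult.commute)
    also have "\<dots> = real (D + 1) ^ (2 * p2)" using powr_realpow[of "real (D + 1)" "2 * p2"] by simp
    also have "\<dots> < real (2 * D + 1) ^ q" using Z(2) by (simp only: p2_def q_def)
    also have "\<dots> = sqrt ?b ^ (2 * q)" by (simp add: power_mult add.commute)
    finally show ?thesis by (rule power_less_imp_less_base) simp
  qed
  \<comment> \<open>One rate for each list and for the limit: light halves, halves of small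
    co-weight d - |c|, halves of the box, and the number of candidates. All of them are strictly
    below sqrt (2 D + 1).\<close>
  define \<gamma> where "\<gamma> = Max {1, \<gamma>1, \<gamma>2, sqrt (D + 1), \<gamma>4}"
  define C' where "C' = C1 + C2 + real (D + 1) + 2"
  have \<gamma>: "1 \<le> \<gamma>" "\<gamma>1 \<le> \<gamma>" "\<gamma>2 \<le> \<gamma>" "sqrt (D + 1) \<le> \<gamma>" "\<gamma>4 \<le> \<gamma>" by (auto simp: \<gamma>_def)
  have b: "sqrt (real_of_int (2 * d + 1)) = sqrt ?b" by (simp add: d)
  have \<gamma>b: "\<gamma> < sqrt ?b" using 1(3) 2(3) 4 D unfolding b by (simp add: \<gamma>_def)
  have C'1: "1 \<le> C'" "C1 \<le> C'" "C2 \<le> C'" "real (D + 1) \<le> C'" "2 \<le> C'" using 1(1) 2(1) by (auto simp: C'_def)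
  have up: "K * g ^ n \<le> C' * \<gamma> ^ n" if "K \<le> C'" "0 \<le> g" "g \<le> \<gamma>" for K g and n :: nat
    using that C'1 by (intro mult_mono power_mono) auto
  define B where "B = (\<lambda>n :: nat. nat \<lfloor>C' * \<gamma> ^ n\<rfloor>)"
  define X where "X = (\<lambda>n :: nat. C' * \<gamma> ^ n)"
  have X1: "1 \<le> X n" for n using C'1(1) \<gamma>(1) mult_mono[of 1 C' 1 "\<gamma> ^ n"] by (simp add: X_def)
  have BX: "real (B n) \<le> X n" for n using X1[of n] by (simp add: B_def X_def)
  have leB: "k \<le> B n" if "real k \<le> C' * \<gamma> ^ n" for k n using that by (simp add: B_def le_nat_floor)
  let ?lm = "lim_val (int q) ?c2"
  have lmX: "real (?lm n) \<le> X n" for n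
    using lim_rate[OF q, of D p2 n] up[of 2 \<gamma>4 n] C'1 \<gamma> unfolding \<gamma>4_def[symmetric] X_def
    by (smt (verit) \<gamma>4_def powr_ge_zero)
  \<comment> \<open>Chosen such that |C| to the power 1/2 - \<delta> is exactly \<gamma>.\<close>
  define \<delta> where "\<delta> = 1 / 2 - log ?b \<gamma>"
  have b1: "1 < ?b" using D by simp
  have \<delta>: "0 < \<delta>"
  proof -
    have "\<gamma> < ?b powr (1 / 2)" using \<gamma>b by (simp add: powr_half_sqrt)
    then have "log ?b \<gamma> < 1 / 2" using b1 \<gamma> by (subst log_less_iff) auto
    then show ?thesis by (simp add: \<delta>_def)
  qed
  have g: "real (card C) powr ((1/2 - \<delta>) * real n) = \<gamma> ^ n" for n
    using b1 \<gamma>(1) unfolding assms(2) d card_symmetric_interval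
    by (simp add: \<delta>_def powr_powr[symmetric] powr_realpow)
  \<comment> \<open>A sum of all constants that a word must hold, so that each of them is at most
    2^e.\<close>
  define e0 where "e0 = nat (2 * d + 1) + nat ?c1 + nat ?c2 + 2 * q + A1 + A2 + nat \<lceil>C'\<rceil>"
  define e where "e = e0 + 2"
  have e: "int k \<le> 2 ^ e" if "k \<le> e0" for k
  proof -
    have "k < 2 ^ e" using that less_exp[of e] by (simp add: e_def)
    then have "int k < int (2 ^ e)" by (simp only: of_nat_less_iff)
    then show ?thesis by simp
  qed
  have C'e: "C' \<le> 2 ^ e"
  proof -
    have "nat \<lceil>C'\<rceil> < 2 ^ e" using less_exp[of e] by (simp add: e_def e0_def)
    then have "real (nat \<lceil>C'\<rceil>) < real (2 ^ e)" by (simp only: of_nat_less_iff)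
    then show ?thesis
      using real_nat_ceiling_ge[of C'] unfolding of_nat_power of_nat_numeral by linarith
  qed
  have \<gamma>e: "\<gamma> \<le> 2 ^ e"
  proof -
    have "sqrt ?b \<le> ?b" using b1 real_le_lsqrt[of ?b ?b] self_le_power[of ?b 2] by simp
    moreover have "int (nat (2 * d + 1)) \<le> 2 ^ e" by (rule e) (simp add: e0_def)
    then have "real_of_int (int (nat (2 * d + 1))) \<le> real_of_int (2 ^ e)" by (simp only: of_int_le_iff)
    then have "?b \<le> 2 ^ e" by (simp add: d)
    ultimately show ?thesis using \<gamma>b by linarith
  qed
  have BM: "int (B n) \<le> 2 ^ (e * (n + 1))" for n
  proof -
    have "C' * \<gamma> ^ n \<le> 2 ^ e * (2 ^ e) ^ n" using C'e \<gamma>e C'1 \<gamma>(1) by (intro mult_mono power_mono) auto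
    also have "\<dots> = real (2 ^ (e * (n + 1)))" by (simp add: power_mult power_add mult.commute)
    finally have "B n \<le> 2 ^ (e * (n + 1))" using BX[of n] unfolding X_def by linarith
    then have "int (B n) \<le> int (2 ^ (e * (n + 1)))" by (simp only: of_nat_le_iff)
    then show ?thesis by simp
  qed
  have "solves_in_O_star C p (\<lambda>n. real (card C) powr ((1/2 - \<delta>) * real n))"
    unfolding solves_in_O_star_def g
  proof (intro allI impI)
    fix b assume pb: "poly_bounded b"
    define k where "k = (\<lambda>n. 8 * (e * (n + 1)) + b n)"
    define w where "w = (\<lambda>n. 16 * k n + 1)"
    define T where "T = (\<lambda>n. program_time d n (B n) (?lm n))"
    have bal: "balancing (w n) (2 ^ k n) x d (int q) (int A1) (int A2) ?c1 ?c2 (B n)"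
      if x: "x \<in> inputs b n" for x n
    proof -
      have n: "n = length x" and xb: "\<And>i. i < length x \<Longrightarrow> \<bar>x ! i\<bar> \<le> 2 ^ b n" using x by (auto simp: inputs_def)
      note th = threshold_bounds[OF assms(1), of "int q"]
      show ?thesis unfolding w_def k_def n
      proof (rule balancing_intro)
        show "2 * d + 1 \<le> 2 ^ e" using e[of "nat (2 * d + 1)"] assms(1) by (simp add: e0_def)
        show "?c1 \<le> 2 ^ e" using e[of "nat ?c1"] by (simp add: e0_def)
        show "?c2 \<le> 2 ^ e" using e[of "nat ?c2"] by (simp add: e0_def)
        show "2 * int q \<le> 2 ^ e" using e[of "2 * q"] by (simp add: e0_def)
        show "int A1 \<le> 2 ^ e" "int A2 \<le> 2 ^ e" using e[of A1] e[of A2] by (simp_all add: e0_def)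
        show "1 \<le> ?c1" "1 \<le> ?c2" by (simp_all add: one_le_power)
        show "int (B (length x)) \<le> 2 ^ (e * (length x + 1))" by (rule BM)
        show "\<bar>x ! i\<bar> \<le> 2 ^ b (length x)" if "i < length x" for i using xb[OF that] by (simp add: n)
        fix l pos assume l: "l \<le> length x - length x div 2"
        show "length (lev (length x) [-d..d] (\<lambda>c. \<bar>c\<bar>) (threshold d (int q) (length x) (int A1)) pos l) \<le> B (length x)"
          using th[of "int A1" "length x"] q
          by (intro leB order_trans[OF 1(4)[OF l]] up C'1 \<gamma> less_imp_le[OF 1(2)]) auto
        show "length (lev (length x) [-d..d] (\<lambda>c. d - \<bar>c\<bar>) (threshold d (int q) (length x) (int A2)) pos l) \<le> B (length x)"
          using th[of "int A2" "length x"] q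
          by (intro leB order_trans[OF 2(4)[OF l]] up C'1 \<gamma> less_imp_le[OF 2(2)]) auto
        show "length (lev (length x) [0..d] (\<lambda>c. 0) 0 pos l) \<le> B (length x)"
          unfolding d using \<gamma>(4) C'1(4)
          by (intro leB order_trans[OF box_rate[OF l]] up) auto
      qed (use assms(1) q in \<open>auto simp: e_def\<close>)
    qed
    have TO: "T \<in> O_star (\<lambda>n. \<gamma> ^ n)"
    proof -
      let ?c = "96 + 3 * (2 * real (16 * nat (2 * d + 1) + 8) + 208)"
      have "\<forall>\<^sub>F n in sequentially. norm (real (T n)) \<le> (?c * C') * norm (real n ^ 2 * \<gamma> ^ n)"
        using eventually_ge_at_top[of 1]
      proof eventually_elim
        case (elim n)
        have "real (T n) \<le> ?c * (real n ^ 2 * X n)"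
          unfolding T_def by (rule program_time_le[OF elim BX lmX X1])
        then show ?case using \<gamma>(1) by (simp add: X_def mult.assoc mult.left_commute)
      qed
      then show ?thesis unfolding O_star_def by (blast intro: bigoI)
    qed
    have "solves_whp C b w T p"
      unfolding solves_whp_def
    proof (intro conjI allI ballI impI)
      fix n x assume x: "x \<in> inputs b n"
      then have n: "n = length x" by (simp add: inputs_def)
      note pc = balancing.program_correct[OF bal[OF x] qA1, folded n p_def]
      show "halts_within (w n) (T n) p x" using pc(1) by (simp add: T_def)
      show "is_solution C x c" if "Some c \<in> set_spmf (run (w n) (T n) p x)" for c
        using pc(2) that by (simp add: T_def assms(2))
    next
      let ?\<epsilon> = "1 / (2 * real q)"
      have pos: "0 < 4 * real (D + 1) ^ q" by simp
      have "\<forall>\<^sub>F n in sequentially. \<forall>x\<in>inputs b n. (\<exists>c. is_solution C x c) \<longrightarrow>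
        1 - 2 powr (- ?\<epsilon> * real n) \<le> measure (measure_spmf (run (w n) (T n) p x)) {Some c |c. is_solution C x c}"
        using eventually_small[OF q pos]
      proof eventually_elim
        case (elim n)
        show ?case
        proof (intro ballI impI)
          fix x assume x: "x \<in> inputs b n" and ex: "\<exists>c. is_solution C x c"
          then have n: "n = length x" by (simp add: inputs_def)
          note pc = balancing.program_correct[OF bal[OF x] qA1, folded n p_def]
          have "balancing.failure_bound x d (int q) (int A2) ?c1 ?c2 \<le> 4 * real (D + 1) ^ q / 2 ^ (n div q)"
            using failure_small[OF D q p12 bal[OF x, unfolded d A2_def] n] by (simp only: d A2_def)
          then show "1 - 2 powr (- ?\<epsilon> * real n) \<le>
              measure (measure_spmf (run (w n) (T n) p x)) {Some c |c. is_solution C x c}"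
            using pc(3) ex elim unfolding T_def assms(2) by force
        qed
      qed
      then show "\<exists>\<epsilon>>0. \<forall>\<^sub>F n in sequentially. \<forall>x\<in>inputs b n. (\<exists>c. is_solution C x c) \<longrightarrow>
        1 - 2 powr (- \<epsilon> * real n) \<le> measure (measure_spmf (run (w n) (T n) p x)) {Some c |c. is_solution C x c}"
        using q by (intro exI[of _ ?\<epsilon>]) simp
    qed
    moreover have "poly_bounded w" unfolding w_def k_def by (rule poly_bounded_word[OF pb])
    ultimately show "\<exists>w T. poly_bounded w \<and> T \<in> O_star (\<lambda>n. \<gamma> ^ n) \<and> solves_whp C b w T p"
      using TO by blast
  qed
  then show ?thesis using \<delta> by blast
qed

end
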